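(* Let $K$ be a field of characteristic $0$, let $n>1$, and let $U=K_n=K[x_1^{\pm1},\ldots,x_n^{\pm1}]$ with the $n$-ary multiplication $\mathrm{Jac}_n^S(u_1,\ldots,u_n)=\det(\partial_i u_j)$, where $\partial_i=\partial/\partial x_i$. Let $\theta=(1,\ldots,1)\in\mathbb Z^n$ and let $\epsilon_i\in\mathbb Z^n$ be the $i$-th standard basis vector. (i) The $n$-Lie algebra $(U,\mathrm{Jac}_n^S)$ is not simple. It has $1$-dimensional center $\langle 1\rangle$ and the ideal of codimension $1$ $\bar U=\langle x^\alpha:\alpha\in\mathbb Z^n,\ \alpha\neq-\theta\rangle$. The factor-algebra $(\bar U/\langle1\rangle,\mathrm{Jac}_n^S)$ is a simple $n$-Lie algebra. (ii) There is an exact sequence $$0\to \mathrm{Out}(U,\cdot,\mathrm{Jac}_n^S)\to \mathrm{Out}(U,\mathrm{Jac}_n^S)\to K^2\to0$$ (of vector spaces). More exactly, the factor-algebra $\mathrm{Out}(U,\mathrm{Jac}_n^S)/\mathrm{Out}(U,\cdot,\mathrm{Jac}_n^S)$ is $2$-dimensional and is generated by the classes of the derivations $\Delta$ and $D_{-\theta}$ defined by $$\Delta=\sum_{i=1}^n x_i\partial_i+n(1-n)^{-1}:\ x^\alpha\mapsto(|\alpha|+n(1-n)^{-1})x^\alpha,\qquad D_{-\theta}:\ x^\alpha\mapsto\delta_{\alpha,-\theta}\cdot 1 .$$ (iii) The linear maps $D_i:U\to U$, $i=1,\ldots,n$, given by $D_i(u)=x^{-\theta+\epsilon_i}\partial_i(u)$,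 are outer derivations of $(U,\cdot,\mathrm{Jac}_n^S)$. Their classes in $\mathrm{Out}(U,\cdot,\mathrm{Jac}_n^S)$ form a basis. In particular, $\dim \mathrm{Out}(U,\cdot,\mathrm{Jac}_n^S)=n$ and $\dim\mathrm{Out}(U,\mathrm{Jac}_n^S)=n+2$. (iv) The classes of the derivations $\Delta,D_1,\ldots,D_n$ in $\mathrm{Out}(\bar U/\langle1\rangle,\mathrm{Jac}_n^S)$ form a basis. In particular, $\dim\mathrm{Out}(\bar U/\langle1\rangle,\mathrm{Jac}_n^S)=n+1$.
   Context: For $\alpha=(\alpha_1,\ldots,\alpha_n)\in\mathbb Z^n$, $x^\alpha=x_1^{\alpha_1}\cdots x_n^{\alpha_n}$ and $|\alpha|=\sum_i\alpha_i$; $\langle Y\rangle$ is the linear span of $Y$; $\delta$ is the Kronecker symbol; $\cdot$ is the usual commutative multiplication of $U$. An $n$-Lie algebra $(A,\omega)$ is a vector space with a skew-symmetric $n$-linear map $\omega:A^n\to A$ such that every $L_{a_1,\ldots,a_{n-1}}:a\mapsto\omega(a_1,\ldots,a_{n-1},a)$ is a derivation of $\omega$. A derivation of $(A,\omega)$ is a linear map $D$ with $D(\omega(a_1,\ldots,a_n))=\sum_i\omega(a_1,\ldots,D(a_i),\ldots,a_n)$; $\mathrm{Der}(A,\omega)$ is the Lie algebra of derivations. $\mathrm{Int}(A,\omega)$ is the space of interior derivations (the linear span of the maps $L_{a_1,\ldots,a_{n-1}}$); it is an ideal of $\mathrm{Der}(A,\omega)$, and $\mathrm{Out}(A,\omega)=\mathrm{Der}(A,\omega)/\mathrm{Int}(A,\omega)$.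 A derivation is outer if it is not interior. $\mathrm{Der}(U,\cdot,\omega)$ is the space of linear maps that are derivations of both $(U,\cdot)$ and $(U,\omega)$. For $\omega=\mathrm{Jac}_n^S$ it contains $\mathrm{Int}(U,\omega)$, and $\mathrm{Out}(U,\cdot,\omega)=\mathrm{Der}(U,\cdot,\omega)/\mathrm{Int}(U,\omega)$. The center is $\{z:\omega(z,a_2,\ldots,a_n)=0\ \forall a_i\}$. An ideal is a subspace $J$ with $\omega(J,A,\ldots,A)\subseteq J$. $(A,\omega)$ is simple if $\omega\ne0$ and its only ideals are $0$ and $A$. On $\bar U/\langle 1\rangle$ one uses the operation and the derivations induced from $U$.
   Formalization: In (iv) the basis and dimension of Out(Ū/⟨1⟩) are stated only for n>2, since for n=2 the derivation induced by L with parameter x^{-θ} is not interior and the dimension exceeds n+1; for all n>1 they are stated modulo the derivations induced from Int(U). *)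

theory Defs
  imports
    "HOL-Algebra.QuotRing"
    "HOL-Algebra.Module"
    "HOL-Analysis.Determinants"
    "HOL-Combinatorics.Permutations"
    "HOL-Library.Poly_Mapping"
begin

text \<open>
  Quotient spaces force vector spaces with explicit carriers, so these are HOL-Algebra modules.
  The field of scalars is a type \<open>'k\<close>, viewed as a HOL-Algebra ring.  The \<open>mult\<close> component of a
  module record carries the product of the algebra at hand (commutative product or Lie bracket)
  and is irrelevant where only a vector space is meant; the \<open>one\<close> component of spaces of
  linear maps is a dummy, since Lie algebras have no unit.  Dimensions are expressed by
  \<open>has_dim\<close>, the existence of a basis with the given finite number of elements.
\<close>

definition scalars :: "'k::field ring" where
  "scalars = \<lparr>carrier = UNIV, monoid.mult = (*), one = 1, zero = 0, add = (+)\<rparr>"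

definition type_space :: "('k \<Rightarrow> 'v \<Rightarrow> 'v) \<Rightarrow> ('k, 'v::ring_1) module" where
  "type_space s = \<lparr>carrier = UNIV, monoid.mult = (*), one = 1, zero = 0, add = (+), smult = s\<rparr>"

abbreviation vec_space :: "('k::field, 'v) module \<Rightarrow> bool" where
  "vec_space V \<equiv> Module.module scalars V"

abbreviation vec_subspace :: "('k::field, 'v) module \<Rightarrow> 'v set \<Rightarrow> bool" where
  "vec_subspace V S \<equiv> submodule S scalars V"

definition lin_map :: "('k::field, 'v) module \<Rightarrow> ('k, 'w) module \<Rightarrow> ('v \<Rightarrow> 'w) \<Rightarrow> bool" where
  "lin_map V W f \<longleftrightarrow> vec_space V \<and> vec_space W \<and> f \<in> carrier V \<rightarrow> carrier W \<and>
     (\<forall>x\<in>carrier V. \<forall>y\<in>carrier V. f (x \<oplus>\<^bsub>V\<^esub> y) = f x \<oplus>\<^bsub>W\<^esub> f y) \<and>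
     (\<forall>c. \<forall>x\<in>carrier V. f (c \<odot>\<^bsub>V\<^esub> x) = c \<odot>\<^bsub>W\<^esub> f x)"

definition lin_span :: "('k::field, 'v) module \<Rightarrow> 'v set \<Rightarrow> 'v set" where
  "lin_span V S = {(\<Oplus>\<^bsub>V\<^esub>v\<in>F. c v \<odot>\<^bsub>V\<^esub> v) | F c. finite F \<and> F \<subseteq> S}"

definition lin_indep :: "('k::field, 'v) module \<Rightarrow> 'i set \<Rightarrow> ('i \<Rightarrow> 'v) \<Rightarrow> bool" where
  "lin_indep V I b \<longleftrightarrow>
     (\<forall>c. (\<Oplus>\<^bsub>V\<^esub>i\<in>I. c i \<odot>\<^bsub>V\<^esub> b i) = \<zero>\<^bsub>V\<^esub> \<longrightarrow> (\<forall>i\<in>I. c i = 0))"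

definition fin_basis :: "('k::field, 'v) module \<Rightarrow> 'i set \<Rightarrow> ('i \<Rightarrow> 'v) \<Rightarrow> bool" where
  "fin_basis V I b \<longleftrightarrow> vec_space V \<and> finite I \<and> b \<in> I \<rightarrow> carrier V \<and>
     lin_indep V I b \<and> lin_span V (b ` I) = carrier V"

definition has_dim :: "('k::field, 'v) module \<Rightarrow> nat \<Rightarrow> bool" where
  "has_dim V d \<longleftrightarrow> (\<exists>b. fin_basis V {..<d} b)"

definition quot :: "('k, 'v) module \<Rightarrow> 'v set \<Rightarrow> ('k, 'v set) module" where
  "quot V S = \<lparr>carrier = a_rcosets\<^bsub>V\<^esub> S, monoid.mult = rcoset_mult V S, one = S +>\<^bsub>V\<^esub> \<one>\<^bsub>V\<^esub>, zero = S,
     add = set_add V, smult = (\<lambda>c X. \<Union>x\<in>X. S +>\<^bsub>V\<^esub> (c \<odot>\<^bsub>V\<^esub> x))\<rparr>"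

text \<open>The union in \<open>smult\<close> over all representatives makes \<open>0 \<odot> X\<close> the coset \<open>S\<close> rather than \<open>{0}\<close>.\<close>

text \<open>The map \<open>V / S \<rightarrow> W / T\<close> induced by \<open>f : V \<rightarrow> W\<close> (meaningful if \<open>f\<close> maps \<open>S\<close> into \<open>T\<close>).\<close>

definition quot_map ::
    "('k, 'v) module \<Rightarrow> 'v set \<Rightarrow> ('k, 'w) module \<Rightarrow> 'w set \<Rightarrow> ('v \<Rightarrow> 'w) \<Rightarrow> 'v set \<Rightarrow> 'w set" where
  "quot_map V S W T f = (\<lambda>X\<in>a_rcosets\<^bsub>V\<^esub> S. \<Union>x\<in>X. T +>\<^bsub>W\<^esub> f x)"

text \<open>The operation on \<open>V / S\<close> induced by an \<open>n\<close>-ary operation (meaningful if \<open>S\<close> is an ideal).\<close>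

definition quot_op :: "('k, 'v) module \<Rightarrow> 'v set \<Rightarrow> (('n \<Rightarrow> 'v) \<Rightarrow> 'v) \<Rightarrow> ('n \<Rightarrow> 'v set) \<Rightarrow> 'v set" where
  "quot_op V S \<omega> = (\<lambda>X. \<Union>x\<in>Pi UNIV X. S +>\<^bsub>V\<^esub> \<omega> x)"

definition short_exact :: "('k::field, 'u) module \<Rightarrow> ('k, 'v) module \<Rightarrow> ('k, 'w) module \<Rightarrow>
    ('u \<Rightarrow> 'v) \<Rightarrow> ('v \<Rightarrow> 'w) \<Rightarrow> bool" where
  "short_exact U V W f g \<longleftrightarrow> lin_map U V f \<and> lin_map V W g \<and> inj_on f (carrier U) \<and>
     f ` carrier U = {v \<in> carrier V. g v = \<zero>\<^bsub>W\<^esub>} \<and> g ` carrier V = carrier W"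

text \<open>
  The Lie algebra of linear endomorphisms of \<open>V\<close>.  Endomorphisms are extensional functions,
  so that equality of functions is equality on the carrier.
\<close>

definition gl :: "('k::field, 'v) module \<Rightarrow> ('k, 'v \<Rightarrow> 'v) module" where
  "gl V = \<lparr>carrier = {f \<in> extensional (carrier V). lin_map V V f},
     monoid.mult = (\<lambda>f g. \<lambda>x\<in>carrier V. f (g x) \<ominus>\<^bsub>V\<^esub> g (f x)),
     one = undefined,
     zero = (\<lambda>x\<in>carrier V. \<zero>\<^bsub>V\<^esub>),
     add = (\<lambda>f g. \<lambda>x\<in>carrier V. f x \<oplus>\<^bsub>V\<^esub> g x),
     smult = (\<lambda>c f. \<lambda>x\<in>carrier V. c \<odot>\<^bsub>V\<^esub> f x)\<rparr>"

definition lie_ideal :: "('k::field, 'v) module \<Rightarrow> 'v set \<Rightarrow> bool" where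
  "lie_ideal \<g> J \<longleftrightarrow> vec_subspace \<g> J \<and> (\<forall>x\<in>carrier \<g>. \<forall>y\<in>J. x \<otimes>\<^bsub>\<g>\<^esub> y \<in> J)"

text \<open>
  The arguments of an \<open>n\<close>-ary operation are indexed by a finite linearly ordered type \<open>'n\<close>
  with \<open>n\<close> elements; the first and the last argument have index \<open>Min UNIV\<close> and \<open>Max UNIV\<close>.
\<close>

definition multilinear :: "('k::field, 'v) module \<Rightarrow> (('n \<Rightarrow> 'v) \<Rightarrow> 'v) \<Rightarrow> bool" where
  "multilinear V \<omega> \<longleftrightarrow> (\<forall>a\<in>UNIV \<rightarrow> carrier V. \<forall>i. lin_map V V (\<lambda>x. \<omega> (a(i := x))))"

definition skew_symmetric ::
    "('k::field, 'v) module \<Rightarrow> (('n::finite \<Rightarrow> 'v) \<Rightarrow> 'v) \<Rightarrow> bool" where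
  "skew_symmetric V \<omega> \<longleftrightarrow> (\<forall>a\<in>UNIV \<rightarrow> carrier V. \<forall>p. p permutes UNIV \<longrightarrow>
     \<omega> (a \<circ> p) = of_int (sign p) \<odot>\<^bsub>V\<^esub> \<omega> a)"

definition derivations ::
    "('k::field, 'v) module \<Rightarrow> (('n::finite \<Rightarrow> 'v) \<Rightarrow> 'v) \<Rightarrow> ('v \<Rightarrow> 'v) set" where
  "derivations V \<omega> = {D \<in> carrier (gl V). \<forall>a\<in>UNIV \<rightarrow> carrier V.
     D (\<omega> a) = (\<Oplus>\<^bsub>V\<^esub>i\<in>UNIV. \<omega> (a(i := D (a i))))}"

definition comm_derivations :: "('k::field, 'v) module \<Rightarrow> ('v \<Rightarrow> 'v) set" where
  "comm_derivations V = {D \<in> carrier (gl V). \<forall>x\<in>carrier V. \<forall>y\<in>carrier V.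
     D (x \<otimes>\<^bsub>V\<^esub> y) = (D x \<otimes>\<^bsub>V\<^esub> y) \<oplus>\<^bsub>V\<^esub> (x \<otimes>\<^bsub>V\<^esub> D y)}"

text \<open>\<open>left_mult V \<omega> a\<close> is \<open>L\<close> for all entries of \<open>a\<close> but the last, which is overwritten.\<close>

definition left_mult ::
    "('k, 'v) module \<Rightarrow> (('n::{finite,linorder} \<Rightarrow> 'v) \<Rightarrow> 'v) \<Rightarrow> ('n \<Rightarrow> 'v) \<Rightarrow> 'v \<Rightarrow> 'v" where
  "left_mult V \<omega> a = (\<lambda>x\<in>carrier V. \<omega> (a(Max UNIV := x)))"

definition n_lie_algebra ::
    "('k::field, 'v) module \<Rightarrow> (('n::{finite,linorder} \<Rightarrow> 'v) \<Rightarrow> 'v) \<Rightarrow> bool" where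
  "n_lie_algebra V \<omega> \<longleftrightarrow> vec_space V \<and> multilinear V \<omega> \<and> skew_symmetric V \<omega> \<and>
     (\<forall>a\<in>UNIV \<rightarrow> carrier V. left_mult V \<omega> a \<in> derivations V \<omega>)"

definition Der ::
    "('k::field, 'v) module \<Rightarrow> (('n::finite \<Rightarrow> 'v) \<Rightarrow> 'v) \<Rightarrow> ('k, 'v \<Rightarrow> 'v) module" where
  "Der V \<omega> = (gl V)\<lparr>carrier := derivations V \<omega>\<rparr>"

definition Der_comm ::
    "('k::field, 'v) module \<Rightarrow> (('n::finite \<Rightarrow> 'v) \<Rightarrow> 'v) \<Rightarrow> ('k, 'v \<Rightarrow> 'v) module" where
  "Der_comm V \<omega> = (gl V)\<lparr>carrier := comm_derivations V \<inter> derivations V \<omega>\<rparr>"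

definition Inn ::
    "('k::field, 'v) module \<Rightarrow> (('n::{finite,linorder} \<Rightarrow> 'v) \<Rightarrow> 'v) \<Rightarrow> ('v \<Rightarrow> 'v) set" where
  "Inn V \<omega> = lin_span (gl V) {left_mult V \<omega> a | a. a \<in> UNIV \<rightarrow> carrier V}"

definition Out ::
    "('k::field, 'v) module \<Rightarrow> (('n::{finite,linorder} \<Rightarrow> 'v) \<Rightarrow> 'v) \<Rightarrow> ('k, ('v \<Rightarrow> 'v) set) module" where
  "Out V \<omega> = quot (Der V \<omega>) (Inn V \<omega>)"

definition Out_comm ::
    "('k::field, 'v) module \<Rightarrow> (('n::{finite,linorder} \<Rightarrow> 'v) \<Rightarrow> 'v) \<Rightarrow> ('k, ('v \<Rightarrow> 'v) set) module" where
  "Out_comm V \<omega> = quot (Der_comm V \<omega>) (Inn V \<omega>)"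

text \<open>The canonical map from \<open>Out_comm\<close> to \<open>Out\<close>, induced by the inclusion of derivations.\<close>

definition Out_incl ::
    "('k::field, 'v) module \<Rightarrow> (('n::{finite,linorder} \<Rightarrow> 'v) \<Rightarrow> 'v) \<Rightarrow> ('v \<Rightarrow> 'v) set \<Rightarrow> ('v \<Rightarrow> 'v) set" where
  "Out_incl V \<omega> = quot_map (Der_comm V \<omega>) (Inn V \<omega>) (Der V \<omega>) (Inn V \<omega>) (\<lambda>D. D)"

definition center ::
    "('k::field, 'v) module \<Rightarrow> (('n::{finite,linorder} \<Rightarrow> 'v) \<Rightarrow> 'v) \<Rightarrow> 'v set" where
  "center V \<omega> = {z \<in> carrier V. \<forall>a\<in>UNIV \<rightarrow> carrier V. \<omega> (a(Min UNIV := z)) = \<zero>\<^bsub>V\<^esub>}"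

definition n_ideal ::
    "('k::field, 'v) module \<Rightarrow> (('n::{finite,linorder} \<Rightarrow> 'v) \<Rightarrow> 'v) \<Rightarrow> 'v set \<Rightarrow> bool" where
  "n_ideal V \<omega> J \<longleftrightarrow> vec_subspace V J \<and>
     (\<forall>z\<in>J. \<forall>a\<in>UNIV \<rightarrow> carrier V. \<omega> (a(Min UNIV := z)) \<in> J)"

definition n_simple ::
    "('k::field, 'v) module \<Rightarrow> (('n::{finite,linorder} \<Rightarrow> 'v) \<Rightarrow> 'v) \<Rightarrow> bool" where
  "n_simple V \<omega> \<longleftrightarrow> (\<exists>a\<in>UNIV \<rightarrow> carrier V. \<omega> a \<noteq> \<zero>\<^bsub>V\<^esub>) \<and>
     (\<forall>J. n_ideal V \<omega> J \<longrightarrow> J = {\<zero>\<^bsub>V\<^esub>} \<or> J = carrier V)"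

text \<open>
  Laurent polynomials: finitely supported functions from exponent vectors to coefficients,
  with the convolution product of \<open>poly_mapping\<close>.
\<close>

type_synonym ('k, 'n) laurent = "(int, 'n) vec \<Rightarrow>\<^sub>0 'k"

definition xpow :: "int ^ 'n \<Rightarrow> ('k::field, 'n::finite) laurent" where
  "xpow \<alpha> = Poly_Mapping.single \<alpha> 1"

definition lscale :: "'k::field \<Rightarrow> ('k, 'n::finite) laurent \<Rightarrow> ('k, 'n) laurent" where
  "lscale c u = Poly_Mapping.single 0 c * u"

definition laurent_space :: "('k::field, ('k, 'n::finite) laurent) module" where
  "laurent_space = type_space lscale"

definition part_deriv :: "'n \<Rightarrow> ('k::field, 'n::finite) laurent \<Rightarrow> ('k, 'n) laurent" where
  "part_deriv i u = (\<Sum>\<alpha>\<in>Poly_Mapping.keys u.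
     Poly_Mapping.single (\<alpha> - axis i 1) (of_int (\<alpha> $ i) * Poly_Mapping.lookup u \<alpha>))"

definition Jac :: "('n \<Rightarrow> ('k::field, 'n::finite) laurent) \<Rightarrow> ('k, 'n) laurent" where
  "Jac u = det (\<chi> i j. part_deriv i (u j))"

definition theta :: "int ^ 'n::finite" where
  "theta = (\<chi> i. 1)"

definition laurent_bar :: "('k::field, 'n::finite) laurent set" where
  "laurent_bar = lin_span laurent_space {xpow \<alpha> | \<alpha>. \<alpha> \<noteq> - theta}"

definition Delta_const :: "'n::finite itself \<Rightarrow> 'k::field" where
  "Delta_const _ = of_nat CARD('n) * inverse (1 - of_nat CARD('n))"

definition Delta :: "('k::field, 'n::finite) laurent \<Rightarrow> ('k, 'n) laurent" where
  "Delta u = (\<Sum>i\<in>UNIV. xpow (axis i 1) * part_deriv i u) + lscale (Delta_const TYPE('n)) u"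

text \<open>The coefficient of \<open>x\<^sup>-\<^sup>\<theta>\<close>, as a constant.\<close>

definition D_mtheta :: "('k::field, 'n::finite) laurent \<Rightarrow> ('k, 'n) laurent" where
  "D_mtheta u = lscale (Poly_Mapping.lookup u (- theta)) 1"

definition D_ind :: "'n \<Rightarrow> ('k::field, 'n::finite) laurent \<Rightarrow> ('k, 'n) laurent" where
  "D_ind i u = xpow (- theta + axis i 1) * part_deriv i u"

definition coord_space :: "('k::field, 'k ^ 'm) module" where
  "coord_space = type_space (*s)"

end

theory Submission
  imports Defs "HOL-Computational_Algebra.Polynomial"
begin

text \<open>
On monomials the Jacobian is \<open>Jac(x\<^sup>\<beta>\<^sup>1, \<dots>, x\<^sup>\<beta>\<^sup>n) = det(\<beta>) x\<^sup>\<Sigma>\<^sup>\<beta>\<^sup>-\<^sup>\<theta>\<close>, so every derivation splits into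
homogeneous components \<open>x\<^sup>\<beta> \<mapsto> f(\<beta>) x\<^sup>\<beta>\<^sup>+\<^sup>\<sigma>\<close>. The derivation identity on tuples consisting of two generic
exponents and \<open>n - 2\<close> basis vectors makes \<open>f\<close> generically additive. Hence \<open>f\<close> is a linear form
\<open>\<lambda>\<close> plus, if \<open>\<sigma> = 0\<close>, a constant \<open>k\<close>, with \<open>\<lambda>(\<sigma> + \<theta>) = (1 - n) k\<close>; only for \<open>\<sigma> = \<theta>\<close> may the value at
\<open>-\<theta>\<close> differ, which gives \<open>D\<^sub>-\<^sub>\<theta>\<close>, and the constant gives \<open>\<Delta>\<close>. A linear form with \<open>k = 0\<close> vanishes on
\<open>w = \<sigma> + \<theta>\<close>. If \<open>w\<^sub>i \<noteq> 0\<close>, it is the combination \<open>\<Sum>\<^sub>j (\<lambda>\<^sub>j / w\<^sub>i) (w\<^sub>i \<epsilon>\<^sub>j - w\<^sub>j \<epsilon>\<^sub>i)\<close> of \<open>2 \<times> 2\<close> minors, so the derivation is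
interior; if \<open>w = 0\<close>, it is a combination of the \<open>D\<^sub>i\<close>. The outer derivations are independent because certain
coefficient functionals vanish on all interior derivations.

A derivation of the factor algebra lifts, component by component, to one of the same kind. In a nonzero
ideal of the factor algebra, brackets with generic monomials reduce an element of minimal support to a monomial,
and a monomial generates everything.
\<close>

text \<open>A determinant in the derivation identity can be cancelled only where it is nonzero, so
  additivity is proved along generic translates and read off at one large parameter. In the factor
  algebra two exponents are invisible: coefficients at 0 are lost modulo constants, and
  x^(-\<theta>) has no class. The classification is therefore proved once for functions whose
  identity is known only off a finite set, which is empty for \<open>U\<close> and {0, -\<theta>}
  for the factor algebra. The relation between \<lambda> and k is Cramer's rule: the sum over j of
  \<lambda>(\<beta>_j) times det(\<beta> with row j replaced by \<sigma>) equals \<lambda>(\<sigma>)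
  det(\<beta>). Comparing constants gives k - \<lambda>(\<theta>) = n k + \<lambda>(\<sigma>). For
  \<sigma> = 0 and \<lambda> = (1,...,1), where \<lambda>(\<theta>) = n, this forces k = n/(1-n),
  the constant in \<open>Delta\<close>. Among the derivations of the Jacobian, those of the product
  are the common kernel of two functionals; this is the source of the K^2. The map
  \<open>D_mtheta\<close> vanishes on \<open>laurent_bar\<close>, hence n+1 classes instead of n+2
  in the factor algebra.\<close>

lemma scalars_simps [simp]:
  "carrier scalars = UNIV" "a \<otimes>\<^bsub>scalars\<^esub> b = a * b" "a \<oplus>\<^bsub>scalars\<^esub> b = a + b"
  "\<zero>\<^bsub>scalars\<^esub> = 0" "\<one>\<^bsub>scalars\<^esub> = 1"
  by (simp_all add: scalars_def)

lemma cring_scalars: "cring (scalars :: 'k::field ring)"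
proof (rule cringI)
  show "abelian_group (scalars :: 'k ring)"
  proof (rule abelian_groupI)
    fix x :: 'k assume "x \<in> carrier scalars"
    show "\<exists>y\<in>carrier scalars. y \<oplus>\<^bsub>scalars\<^esub> x = \<zero>\<^bsub>scalars\<^esub>"
      by (rule bexI[of _ "- x"]) auto
  qed (auto simp: ac_simps)
  show "Group.comm_monoid (scalars :: 'k ring)"
    by (rule comm_monoidI) (auto simp: ac_simps)
qed (auto simp: algebra_simps)

section \<open>Vector spaces, subspaces and linear maps\<close>

locale vspace =
  fixes V :: "('k::field, 'v) module" (structure)
  assumes vec_space: "vec_space V"

sublocale vspace \<subseteq> Module.module "scalars :: 'k ring" V
  by (rule vec_space)

context vspace
begin

lemma smult_in [simp, intro]: "x \<in> carrier V \<Longrightarrow> c \<odot> x \<in> carrier V"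
  using smult_closed[of c x] by simp

lemma smult_add_left: "x \<in> carrier V \<Longrightarrow> (a + b) \<odot> x = a \<odot> x \<oplus> b \<odot> x"
  using smult_l_distr[of a b x] by simp

lemma smult_add_right: "x \<in> carrier V \<Longrightarrow> y \<in> carrier V \<Longrightarrow> a \<odot> (x \<oplus> y) = a \<odot> x \<oplus> a \<odot> y"
  using smult_r_distr[of a x y] by simp

lemma smult_smult: "x \<in> carrier V \<Longrightarrow> (a * b) \<odot> x = a \<odot> (b \<odot> x)"
  using smult_assoc1[of a b x] by simp

lemma smult_1 [simp]: "x \<in> carrier V \<Longrightarrow> 1 \<odot> x = x"
  using smult_one[of x] by simp

lemma smult_0_left [simp]: "x \<in> carrier V \<Longrightarrow> 0 \<odot> x = \<zero>"
  using smult_l_null[of x] by simp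

lemma smult_0_right [simp]: "a \<odot> \<zero> = \<zero>"
  using smult_r_null[of a] by simp

lemma minus_eq_smult: "x \<in> carrier V \<Longrightarrow> \<ominus> x = (-1) \<odot> x"
proof -
  assume x: "x \<in> carrier V"
  have "(-1) \<odot> x \<oplus> x = \<zero>" using x smult_add_left[of x "-1" 1] by simp
  then show ?thesis using x by (metis minus_equality smult_in)
qed

lemma subspaceI:
  assumes "H \<subseteq> carrier V" "\<zero> \<in> H" "\<And>a b. a \<in> H \<Longrightarrow> b \<in> H \<Longrightarrow> a \<oplus> b \<in> H"
    "\<And>c x. x \<in> H \<Longrightarrow> c \<odot> x \<in> H"
  shows "vec_subspace V H"
  by (rule submoduleI) (use assms minus_eq_smult in auto)

lemma subspaceD:
  assumes "vec_subspace V H"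
  shows "H \<subseteq> carrier V" "\<zero> \<in> H" "\<And>a b. a \<in> H \<Longrightarrow> b \<in> H \<Longrightarrow> a \<oplus> b \<in> H"
    "\<And>c x. x \<in> H \<Longrightarrow> c \<odot> x \<in> H" "\<And>x. x \<in> H \<Longrightarrow> \<ominus> x \<in> H"
    "\<And>a b. a \<in> H \<Longrightarrow> b \<in> H \<Longrightarrow> a \<ominus> b \<in> H"
proof -
  note E = submoduleE[OF assms]
  show 1: "H \<subseteq> carrier V" "\<And>a b. a \<in> H \<Longrightarrow> b \<in> H \<Longrightarrow> a \<oplus> b \<in> H"
    "\<And>c x. x \<in> H \<Longrightarrow> c \<odot> x \<in> H" "\<And>x. x \<in> H \<Longrightarrow> \<ominus> x \<in> H"
    using E by auto
  show "\<zero> \<in> H" using E(2) 1(1) 1(3)[of _ 0] by (metis all_not_in_conv smult_0_left subsetD)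
  show "\<And>a b. a \<in> H \<Longrightarrow> b \<in> H \<Longrightarrow> a \<ominus> b \<in> H" using 1 by (simp add: a_minus_def)
qed

lemma subspace_vec_space: "vec_subspace V H \<Longrightarrow> vec_space (V\<lparr>carrier := H\<rparr>)"
  by (rule submodule.submodule_is_module[OF _ vec_space])

lemma subspace_finsum:
  assumes "vec_subspace V H" "f \<in> I \<rightarrow> H"
  shows "finsum V f I \<in> H"
  using assms(2)
proof (induction I rule: infinite_finite_induct)
  case (insert i I)
  then have "f \<in> I \<rightarrow> carrier V" "f i \<in> carrier V" using subspaceD(1)[OF assms(1)] by auto
  then show ?case using insert subspaceD(3)[OF assms(1)] by auto
qed (use subspaceD[OF assms(1)] in auto)

end

lemma lin_mapD:
  assumes "lin_map V W f"
  shows "vec_space V" "vec_space W" "x \<in> carrier V \<Longrightarrow> f x \<in> carrier W"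
    "x \<in> carrier V \<Longrightarrow> y \<in> carrier V \<Longrightarrow> f (x \<oplus>\<^bsub>V\<^esub> y) = f x \<oplus>\<^bsub>W\<^esub> f y"
    "x \<in> carrier V \<Longrightarrow> f (c \<odot>\<^bsub>V\<^esub> x) = c \<odot>\<^bsub>W\<^esub> f x"
    "f \<zero>\<^bsub>V\<^esub> = \<zero>\<^bsub>W\<^esub>"
proof -
  show *: "vec_space V" "vec_space W" "x \<in> carrier V \<Longrightarrow> f x \<in> carrier W"
    "x \<in> carrier V \<Longrightarrow> y \<in> carrier V \<Longrightarrow> f (x \<oplus>\<^bsub>V\<^esub> y) = f x \<oplus>\<^bsub>W\<^esub> f y"
    "x \<in> carrier V \<Longrightarrow> f (c \<odot>\<^bsub>V\<^esub> x) = c \<odot>\<^bsub>W\<^esub> f x"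
    using assms by (simp_all add: lin_map_def Pi_iff)
  interpret V: vspace V by (rule vspace.intro) fact
  interpret W: vspace W by (rule vspace.intro) fact
  have "f (0 \<odot>\<^bsub>V\<^esub> \<zero>\<^bsub>V\<^esub>) = 0 \<odot>\<^bsub>W\<^esub> f \<zero>\<^bsub>V\<^esub>" "f \<zero>\<^bsub>V\<^esub> \<in> carrier W"
    using assms V.zero_closed unfolding lin_map_def by blast+
  then show "f \<zero>\<^bsub>V\<^esub> = \<zero>\<^bsub>W\<^esub>" by simp
qed

lemma lin_map_finsum:
  assumes "lin_map V W f" "b \<in> I \<rightarrow> carrier V"
  shows "f (finsum V b I) = finsum W (\<lambda>i. f (b i)) I"
  using assms(2)
proof (induction I rule: infinite_finite_induct)
  case (insert i I)
  interpret V: vspace V by (rule vspace.intro[OF lin_mapD(1)[OF assms(1)]])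
  interpret W: vspace W by (rule vspace.intro[OF lin_mapD(2)[OF assms(1)]])
  have "b \<in> I \<rightarrow> carrier V" "b i \<in> carrier V" using insert by auto
  moreover have "(\<lambda>i. f (b i)) \<in> I \<rightarrow> carrier W" "f (b i) \<in> carrier W"
    using lin_mapD(3)[OF assms(1)] calculation by auto
  ultimately show ?case
    using insert lin_mapD(4)[OF assms(1)] by simp
next
  \<comment> \<open>A \<open>finsum\<close> over an infinite set is zero by convention, so only f(0)
    = 0 matters here.\<close>
  case (infinite I)
  interpret V: vspace V by (rule vspace.intro[OF lin_mapD(1)[OF assms(1)]])
  interpret W: vspace W by (rule vspace.intro[OF lin_mapD(2)[OF assms(1)]])
  show ?case using infinite lin_mapD(6)[OF assms(1)] by simp
next
  case empty
  interpret V: vspace V by (rule vspace.intro[OF lin_mapD(1)[OF assms(1)]])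
  interpret W: vspace W by (rule vspace.intro[OF lin_mapD(2)[OF assms(1)]])
  show ?case using lin_mapD(6)[OF assms(1)] by simp
qed

lemma lin_map_combination:
  assumes "lin_map V W f" "b \<in> I \<rightarrow> carrier V"
  shows "f (\<Oplus>\<^bsub>V\<^esub>i\<in>I. c i \<odot>\<^bsub>V\<^esub> b i) = (\<Oplus>\<^bsub>W\<^esub>i\<in>I. c i \<odot>\<^bsub>W\<^esub> f (b i))"
proof -
  interpret V: vspace V by (rule vspace.intro[OF lin_mapD(1)[OF assms(1)]])
  interpret W: vspace W by (rule vspace.intro[OF lin_mapD(2)[OF assms(1)]])
  have "f (\<Oplus>\<^bsub>V\<^esub>i\<in>I. c i \<odot>\<^bsub>V\<^esub> b i) = (\<Oplus>\<^bsub>W\<^esub>i\<in>I. f (c i \<odot>\<^bsub>V\<^esub> b i))"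
    by (rule lin_map_finsum[OF assms(1)]) (use assms(2) in auto)
  also have "\<dots> = (\<Oplus>\<^bsub>W\<^esub>i\<in>I. c i \<odot>\<^bsub>W\<^esub> f (b i))"
    by (rule W.finsum_cong')
      (use assms(2) lin_mapD(3,5)[OF assms(1)] in \<open>auto simp: Pi_iff\<close>)
  finally show ?thesis .
qed

lemma lin_map_subspace_incl:
  assumes "vec_space V" "vec_subspace V H"
  shows "lin_map (V\<lparr>carrier := H\<rparr>) V (\<lambda>x. x)"
proof -
  interpret vspace V by (rule vspace.intro) fact
  show ?thesis using assms subspace_vec_space[OF assms(2)] subspaceD[OF assms(2)]
    by (simp add: lin_map_def Pi_iff subset_iff)
qed

lemma subspace_of_subspace:
  assumes "vec_space V" "vec_subspace V T" "vec_subspace V S" "S \<subseteq> T"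
  shows "vec_subspace (V\<lparr>carrier := T\<rparr>) S"
proof -
  interpret V: vspace V by (rule vspace.intro) fact
  interpret T: vspace "V\<lparr>carrier := T\<rparr>" by (rule vspace.intro[OF V.subspace_vec_space[OF assms(2)]])
  show ?thesis
    by (rule T.subspaceI) (use V.subspaceD[OF assms(3)] assms(4) in auto)
qed

text \<open>The inclusion is linear and so commutes with sums. The transfer has to be stated because
  \<open>finsum\<close> refers to the carrier of the record.\<close>

lemma finsum_subspace:
  assumes "vec_space V" "vec_subspace V H" "b \<in> I \<rightarrow> H"
  shows "finsum (V\<lparr>carrier := H\<rparr>) b I = finsum V b I"
  using lin_map_finsum[OF lin_map_subspace_incl[OF assms(1,2)], of b I] assms(3) by simp

subsection \<open>Spans and bases\<close>

context vspace
begin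

lemma combination_in: "b \<in> I \<rightarrow> carrier V \<Longrightarrow> (\<Oplus>i\<in>I. c i \<odot> b i) \<in> carrier V"
  by (rule finsum_closed) auto

lemma combination_insert:
  assumes "finite I" "i \<notin> I" "b \<in> I \<rightarrow> carrier V" "b i \<in> carrier V"
  shows "(\<Oplus>j\<in>insert i I. c j \<odot> b j) = c i \<odot> b i \<oplus> (\<Oplus>j\<in>I. c j \<odot> b j)"
  by (rule finsum_insert) (use assms in auto)

lemma combination_add:
  assumes "finite I" "b \<in> I \<rightarrow> carrier V"
  shows "(\<Oplus>i\<in>I. (c i + d i) \<odot> b i) = (\<Oplus>i\<in>I. c i \<odot> b i) \<oplus> (\<Oplus>i\<in>I. d i \<odot> b i)"
proof -
  have "(\<Oplus>i\<in>I. (c i + d i) \<odot> b i) = (\<Oplus>i\<in>I. c i \<odot> b i \<oplus> d i \<odot> b i)"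
    by (rule finsum_cong') (use assms in \<open>auto simp: smult_add_left Pi_iff\<close>)
  also have "\<dots> = (\<Oplus>i\<in>I. c i \<odot> b i) \<oplus> (\<Oplus>i\<in>I. d i \<odot> b i)"
    by (rule finsum_addf) (use assms in auto)
  finally show ?thesis .
qed

lemma combination_smult:
  assumes "finite I" "b \<in> I \<rightarrow> carrier V"
  shows "(\<Oplus>i\<in>I. (a * c i) \<odot> b i) = a \<odot> (\<Oplus>i\<in>I. c i \<odot> b i)"
proof -
  have "a \<odot> (\<Oplus>i\<in>I. c i \<odot> b i) = (\<Oplus>i\<in>I. a \<odot> (c i \<odot> b i))"
    by (rule finsum_smult_ldistr) (use assms in auto)
  also have "\<dots> = (\<Oplus>i\<in>I. (a * c i) \<odot> b i)"
    by (rule finsum_cong') (use assms in \<open>auto simp: smult_smult Pi_iff\<close>)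
  finally show ?thesis by simp
qed

text \<open>Padding with zero coefficients brings two combinations to a common index set before they
  are added.\<close>

lemma combination_mono:
  assumes "finite J" "I \<subseteq> J" "b \<in> J \<rightarrow> carrier V"
  shows "(\<Oplus>i\<in>J. (if i \<in> I then c i else 0) \<odot> b i) = (\<Oplus>i\<in>I. c i \<odot> b i)"
  by (rule add.finprod_mono_neutral_cong_right)
    (use assms in \<open>auto simp: Pi_iff subset_iff\<close>)

lemma lin_span_subspace:
  assumes "S \<subseteq> carrier V"
  shows "vec_subspace V (lin_span V S)"
proof (rule subspaceI)
  have *: "F \<subseteq> S \<Longrightarrow> (\<lambda>x. x) \<in> F \<rightarrow> carrier V" for F using assms by auto
  show "lin_span V S \<subseteq> carrier V"
    using combination_in[OF *] by (auto simp: lin_span_def)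
  show "\<zero> \<in> lin_span V S"
    unfolding lin_span_def by (auto intro!: exI[of _ "{}"])
  show "a \<oplus> b \<in> lin_span V S" if ab: "a \<in> lin_span V S" "b \<in> lin_span V S" for a b
  proof -
    obtain F c where F: "finite F" "F \<subseteq> S" "a = (\<Oplus>v\<in>F. c v \<odot> v)"
      using ab(1) by (auto simp: lin_span_def)
    obtain G d where G: "finite G" "G \<subseteq> S" "b = (\<Oplus>v\<in>G. d v \<odot> v)"
      using ab(2) by (auto simp: lin_span_def)
    have FG: "(\<lambda>x. x) \<in> F \<union> G \<rightarrow> carrier V" using *[of "F \<union> G"] F G by auto
    have "a = (\<Oplus>v\<in>F \<union> G. (if v \<in> F then c v else 0) \<odot> v)"
      using combination_mono[of "F \<union> G" F "\<lambda>x. x" c] F G FG by auto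
    moreover have "b = (\<Oplus>v\<in>F \<union> G. (if v \<in> G then d v else 0) \<odot> v)"
      using combination_mono[of "F \<union> G" G "\<lambda>x. x" d] F G FG by auto
    ultimately have "a \<oplus> b = (\<Oplus>v\<in>F \<union> G. ((if v \<in> F then c v else 0) + (if v \<in> G then d v else 0)) \<odot> v)"
      using combination_add[OF _ FG] F(1) G(1) by simp
    then show ?thesis
      unfolding lin_span_def using F(1,2) G(1,2) by (intro CollectI exI[of _ "F \<union> G"] exI conjI) auto
  qed
  show "a \<odot> x \<in> lin_span V S" if x: "x \<in> lin_span V S" for a x
  proof -
    obtain F c where F: "finite F" "F \<subseteq> S" "x = (\<Oplus>v\<in>F. c v \<odot> v)"
      using x by (auto simp: lin_span_def)
    have "a \<odot> x = (\<Oplus>v\<in>F. (a * c v) \<odot> v)"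
      using combination_smult[OF F(1) *[OF F(2)]] F(3) by simp
    then show ?thesis
      unfolding lin_span_def using F(1,2) by (intro CollectI exI[of _ F] exI conjI)
  qed
qed

lemma lin_span_superset: "S \<subseteq> carrier V \<Longrightarrow> S \<subseteq> lin_span V S"
proof
  fix x assume "S \<subseteq> carrier V" "x \<in> S"
  moreover have "(\<Oplus>v\<in>{x}. 1 \<odot> v) = x"
    using calculation finsum_insert[of "{}" x "\<lambda>v. 1 \<odot> v"] by auto
  ultimately show "x \<in> lin_span V S"
    unfolding lin_span_def by (intro CollectI exI[of _ "{x}"] exI[of _ "\<lambda>_. 1"]) auto
qed

lemma lin_span_minimal:
  assumes "vec_subspace V H" "S \<subseteq> H"
  shows "lin_span V S \<subseteq> H"
proof
  fix x assume "x \<in> lin_span V S"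
  then obtain F c where F: "finite F" "F \<subseteq> S" "x = (\<Oplus>v\<in>F. c v \<odot> v)"
    by (auto simp: lin_span_def)
  show "x \<in> H" unfolding F(3)
    by (rule subspace_finsum[OF assms(1)]) (use F assms subspaceD[OF assms(1)] in auto)
qed

text \<open>The family may repeat values, so the indexed sum is not literally of the form used in
  \<open>lin_span\<close>; closure of the span under sums settles it.\<close>

lemma combination_in_span:
  assumes "b \<in> I \<rightarrow> carrier V"
  shows "(\<Oplus>i\<in>I. c i \<odot> b i) \<in> lin_span V (b ` I)"
proof -
  have *: "b ` I \<subseteq> carrier V" using assms by auto
  show ?thesis
    by (rule subspace_finsum[OF lin_span_subspace[OF *]])
      (use lin_span_superset[OF *] subspaceD(4)[OF lin_span_subspace[OF *]] in auto)
qed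

lemma fin_basisI:
  assumes "finite I" "b \<in> I \<rightarrow> carrier V"
    and span: "\<And>v. v \<in> carrier V \<Longrightarrow> \<exists>c. v = (\<Oplus>i\<in>I. c i \<odot> b i)"
    and indep: "\<And>c i. (\<Oplus>i\<in>I. c i \<odot> b i) = \<zero> \<Longrightarrow> i \<in> I \<Longrightarrow> c i = 0"
  shows "fin_basis V I b"
proof -
  have "carrier V \<subseteq> lin_span V (b ` I)"
    using span combination_in_span[OF assms(2)] by (metis subsetI)
  moreover have "lin_span V (b ` I) \<subseteq> carrier V"
    by (rule subspaceD(1), rule lin_span_subspace) (use assms in auto)
  ultimately show ?thesis
    unfolding fin_basis_def lin_indep_def using assms vec_space by blast
qed

lemma fin_basis_has_dim:
  assumes "fin_basis V I b" "card I = d"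
  shows "has_dim V d"
proof -
  have I: "finite I" "b \<in> I \<rightarrow> carrier V" "lin_indep V I b" "lin_span V (b ` I) = carrier V"
    using assms(1) by (auto simp: fin_basis_def)
  obtain h where h: "bij_betw h {..<d} I"
    using ex_bij_betw_nat_finite[OF I(1)] assms(2) by (auto simp: lessThan_atLeast0)
  have inj: "inj_on h {..<d}" and im: "h ` {..<d} = I" using h by (auto simp: bij_betw_def)
  have "lin_indep V {..<d} (b \<circ> h)"
    unfolding lin_indep_def
  proof (intro allI impI ballI)
    fix c and i :: nat
    assume 0: "(\<Oplus>i\<in>{..<d}. c i \<odot> (b \<circ> h) i) = \<zero>" and i: "i \<in> {..<d}"
    \<comment> \<open>Coefficients indexed by numbers are carried back to \<open>I\<close> along the
      inverse of the enumeration.\<close>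
    define g where "g = the_inv_into {..<d} h"
    have g: "g (h i) = i" if "i \<in> {..<d}" for i
      using that inj by (simp add: g_def the_inv_into_f_f)
    have "(\<Oplus>j\<in>h ` {..<d}. c (g j) \<odot> b j) = (\<Oplus>i\<in>{..<d}. c (g (h i)) \<odot> b (h i))"
      by (rule finsum_reindex) (use I im inj in auto)
    also have "\<dots> = (\<Oplus>i\<in>{..<d}. c i \<odot> (b \<circ> h) i)"
      by (rule finsum_cong') (use I im g in \<open>auto simp: Pi_iff\<close>)
    finally have "\<forall>j\<in>I. c (g j) = 0"
      using 0 I(3) im unfolding lin_indep_def by metis
    then show "c i = 0" using i im g by fastforce
  qed
  moreover have "(b \<circ> h) ` {..<d} = b ` I" unfolding im[symmetric] by (rule image_comp[symmetric])
  ultimately have "fin_basis V {..<d} (b \<circ> h)"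
    unfolding fin_basis_def using I im vec_space by (simp add: Pi_iff, blast)
  then show ?thesis unfolding has_dim_def by blast
qed

end

subsection \<open>Quotients\<close>

locale quotient_space = vspace V for V :: "('k::field, 'v) module" (structure) +
  fixes S
  assumes S: "vec_subspace V S"

lemma quotient_spaceI: "vec_space V \<Longrightarrow> vec_subspace V S \<Longrightarrow> quotient_space V S"
  by (intro quotient_space.intro vspace.intro quotient_space_axioms.intro)

context quotient_space
begin

lemma abelian_sub: "abelian_subgroup S V"
  by (rule abelian_subgroupI3)
    (use S abelian_group_axioms in \<open>auto simp: additive_subgroup_def submodule_def\<close>)

lemma coset_eq_iff:
  assumes "x \<in> carrier V" "y \<in> carrier V"
  shows "S +> x = S +> y \<longleftrightarrow> x \<ominus> y \<in> S"
  using abelian_subgroup.a_rcos_module[OF abelian_sub assms(2,1)]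
    abelian_subgroup.a_repr_independence'[OF abelian_sub _ assms(2), of x]
    abelian_subgroup.a_rcos_self[OF abelian_sub assms(1)] assms
  by (auto simp: a_minus_def)

lemma coset_self: "x \<in> carrier V \<Longrightarrow> x \<in> S +> x"
  by (rule abelian_subgroup.a_rcos_self[OF abelian_sub])

lemma in_coset: "x \<in> carrier V \<Longrightarrow> y \<in> S +> x \<Longrightarrow> y \<in> carrier V \<and> S +> y = S +> x"
  using abelian_subgroup.a_repr_independence'[OF abelian_sub]
    abelian_subgroup.a_elemrcos_carrier[OF abelian_sub] by metis

text \<open>\<open>quot\<close>, \<open>quot_map\<close> and \<open>quot_op\<close> take unions over
  all representatives; such a union collapses once the value does not depend on the
  representative.\<close>

lemma coset_Union:
  assumes "x \<in> carrier V" "\<And>y. y \<in> S +> x \<Longrightarrow> g y = g x"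
  shows "(\<Union>y\<in>S +> x. g y) = g x"
proof -
  have "g ` (S +> x) = {g x}" using assms coset_self[OF assms(1)] by blast
  then show ?thesis by (metis ccpo_Sup_singleton)
qed

lemma quot_sel [simp]:
  "\<zero>\<^bsub>quot V S\<^esub> = S" "X \<oplus>\<^bsub>quot V S\<^esub> Y = X <+> Y"
  by (auto simp: quot_def)

lemma quot_carrier: "carrier (quot V S) = (\<lambda>x. S +> x) ` carrier V"
  by (auto simp: quot_def A_RCOSETS_def')

lemma coset_in [simp, intro]: "x \<in> carrier V \<Longrightarrow> S +> x \<in> carrier (quot V S)"
  by (auto simp: quot_carrier)

lemma quot_cases:
  assumes "X \<in> carrier (quot V S)"
  obtains x where "x \<in> carrier V" "X = S +> x"
  using assms by (auto simp: quot_carrier)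

lemma coset_add:
  assumes "x \<in> carrier V" "y \<in> carrier V"
  shows "(S +> x) \<oplus>\<^bsub>quot V S\<^esub> (S +> y) = S +> (x \<oplus> y)"
  using abelian_subgroup.a_rcos_sum[OF abelian_sub assms] by simp

lemma coset_smult:
  assumes "x \<in> carrier V"
  shows "c \<odot>\<^bsub>quot V S\<^esub> (S +> x) = S +> (c \<odot> x)"
proof -
  have "S +> (c \<odot> y) = S +> (c \<odot> x)" if y: "y \<in> S +> x" for y
  proof -
    have yV: "y \<in> carrier V" and "y \<ominus> x \<in> S"
      using in_coset[OF assms y] coset_eq_iff assms by auto
    then have "c \<odot> (y \<ominus> x) \<in> S" using subspaceD(4)[OF S] by auto
    moreover have "c \<odot> (y \<ominus> x) = c \<odot> y \<ominus> c \<odot> x"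
      using yV assms smult_r_minus[of c x] by (simp add: a_minus_def smult_add_right)
    ultimately show ?thesis using coset_eq_iff yV assms by auto
  qed
  then show ?thesis
    using coset_Union[OF assms, of "\<lambda>y. S +> (c \<odot> y)"] by (simp add: quot_def)
qed

lemma coset_zero: "S +> \<zero> = S"
  using a_coset_add_zero[OF subspaceD(1)[OF S]] by simp

lemma coset_eq_zero_iff: "x \<in> carrier V \<Longrightarrow> S +> x = S \<longleftrightarrow> x \<in> S"
  using coset_eq_iff[of x \<zero>] by (simp add: coset_zero a_minus_def minus_eq_smult)

lemma quot_vec_space: "vec_space (quot V S)"
proof (rule moduleI)
  show "cring (scalars :: 'k ring)" by (rule cring_scalars)
  show "abelian_group (quot V S)"
  proof (rule abelian_groupI)
    show "\<zero>\<^bsub>quot V S\<^esub> \<in> carrier (quot V S)" using coset_in[OF zero_closed] coset_zero by simp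
  next
    fix X Y assume "X \<in> carrier (quot V S)" "Y \<in> carrier (quot V S)"
    then obtain x y where "x \<in> carrier V" "X = S +> x" "y \<in> carrier V" "Y = S +> y"
      by (metis quot_cases)
    then show "X \<oplus>\<^bsub>quot V S\<^esub> Y \<in> carrier (quot V S)" "X \<oplus>\<^bsub>quot V S\<^esub> Y = Y \<oplus>\<^bsub>quot V S\<^esub> X"
      by (simp_all add: coset_add a_comm del: quot_sel)
  next
    fix X Y Z assume "X \<in> carrier (quot V S)" "Y \<in> carrier (quot V S)" "Z \<in> carrier (quot V S)"
    then obtain x y z where "x \<in> carrier V" "X = S +> x" "y \<in> carrier V" "Y = S +> y"
      "z \<in> carrier V" "Z = S +> z"
      by (metis quot_cases)
    then show "X \<oplus>\<^bsub>quot V S\<^esub> Y \<oplus>\<^bsub>quot V S\<^esub> Z = X \<oplus>\<^bsub>quot V S\<^esub> (Y \<oplus>\<^bsub>quot V S\<^esub> Z)"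
      by (simp add: coset_add a_assoc del: quot_sel)
  next
    fix X assume "X \<in> carrier (quot V S)"
    then obtain x where x: "x \<in> carrier V" "X = S +> x" by (metis quot_cases)
    have z: "\<zero>\<^bsub>quot V S\<^esub> = S +> \<zero>" by (simp add: coset_zero)
    show "\<zero>\<^bsub>quot V S\<^esub> \<oplus>\<^bsub>quot V S\<^esub> X = X" unfolding z x using x by (simp add: coset_add del: quot_sel)
    show "\<exists>Y\<in>carrier (quot V S). Y \<oplus>\<^bsub>quot V S\<^esub> X = \<zero>\<^bsub>quot V S\<^esub>"
      unfolding z x using x by (intro bexI[of _ "S +> \<ominus> x"]) (simp_all add: coset_add l_neg del: quot_sel)
  qed
next
  fix c d X assume "X \<in> carrier (quot V S)"
  then obtain x where x: "x \<in> carrier V" "X = S +> x" by (metis quot_cases)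
  then show "c \<odot>\<^bsub>quot V S\<^esub> X \<in> carrier (quot V S)"
    "(c \<oplus>\<^bsub>scalars\<^esub> d) \<odot>\<^bsub>quot V S\<^esub> X = c \<odot>\<^bsub>quot V S\<^esub> X \<oplus>\<^bsub>quot V S\<^esub> d \<odot>\<^bsub>quot V S\<^esub> X"
    "(c \<otimes>\<^bsub>scalars\<^esub> d) \<odot>\<^bsub>quot V S\<^esub> X = c \<odot>\<^bsub>quot V S\<^esub> (d \<odot>\<^bsub>quot V S\<^esub> X)"
    "\<one>\<^bsub>scalars\<^esub> \<odot>\<^bsub>quot V S\<^esub> X = X"
    by (simp_all add: coset_add coset_smult smult_add_left smult_smult del: quot_sel)
next
  fix c X Y assume "X \<in> carrier (quot V S)" "Y \<in> carrier (quot V S)"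
  then obtain x y where "x \<in> carrier V" "X = S +> x" "y \<in> carrier V" "Y = S +> y"
    by (metis quot_cases)
  then show "c \<odot>\<^bsub>quot V S\<^esub> (X \<oplus>\<^bsub>quot V S\<^esub> Y) = c \<odot>\<^bsub>quot V S\<^esub> X \<oplus>\<^bsub>quot V S\<^esub> c \<odot>\<^bsub>quot V S\<^esub> Y"
    by (simp add: coset_add coset_smult smult_add_right del: quot_sel)
qed

lemma lin_map_coset: "lin_map V (quot V S) (\<lambda>x. S +> x)"
  unfolding lin_map_def using vec_space quot_vec_space coset_add coset_smult by (simp add: Pi_iff)

lemma coset_combination:
  assumes "b \<in> I \<rightarrow> carrier V"
  shows "(\<Oplus>\<^bsub>quot V S\<^esub>i\<in>I. c i \<odot>\<^bsub>quot V S\<^esub> (S +> b i)) = S +> (\<Oplus>i\<in>I. c i \<odot> b i)"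
  using lin_map_combination[OF lin_map_coset assms, of c] by simp

text \<open>Every basis of a space of outer derivations below is obtained from this criterion, which
  replaces computation with cosets by computation modulo \<open>S\<close>.\<close>

lemma quot_basis:
  assumes "finite I" "b \<in> I \<rightarrow> carrier V"
    and span: "\<And>v. v \<in> carrier V \<Longrightarrow> \<exists>c. v \<ominus> (\<Oplus>i\<in>I. c i \<odot> b i) \<in> S"
    and indep: "\<And>c i. (\<Oplus>i\<in>I. c i \<odot> b i) \<in> S \<Longrightarrow> i \<in> I \<Longrightarrow> c i = 0"
  shows "fin_basis (quot V S) I (\<lambda>i. S +> b i)"
proof -
  interpret Q: vspace "quot V S" by (rule vspace.intro[OF quot_vec_space])
  show ?thesis
  proof (rule Q.fin_basisI)
    fix X assume "X \<in> carrier (quot V S)"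
    then obtain x where x: "x \<in> carrier V" "X = S +> x" by (metis quot_cases)
    obtain c where "x \<ominus> (\<Oplus>i\<in>I. c i \<odot> b i) \<in> S" using span x by blast
    then show "\<exists>c. X = (\<Oplus>\<^bsub>quot V S\<^esub>i\<in>I. c i \<odot>\<^bsub>quot V S\<^esub> (S +> b i))"
      unfolding coset_combination[OF assms(2)] using x coset_eq_iff combination_in[OF assms(2)]
      by metis
  next
    fix c i assume "(\<Oplus>\<^bsub>quot V S\<^esub>i\<in>I. c i \<odot>\<^bsub>quot V S\<^esub> (S +> b i)) = \<zero>\<^bsub>quot V S\<^esub>" "i \<in> I"
    then show "c i = 0"
      unfolding coset_combination[OF assms(2)]
      using indep[of c i] coset_eq_zero_iff[OF combination_in[OF assms(2)]] by simp
  qed (use assms in auto)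
qed

end

subsection \<open>Quotients of quotients and exact sequences\<close>

text \<open>Abstract form of the chain of interior derivations, derivations of both structures, and
  all derivations of the Jacobian. \<open>image_TS\<close> is T/S as a subset of V/S, and
  \<open>incl\<close> is the canonical map onto it.\<close>

locale quotient_chain = quotient_space V S for V :: "('k::field, 'v) module" (structure) and S +
  fixes T
  assumes T: "vec_subspace V T" and ST: "S \<subseteq> T"
begin

abbreviation VT where "VT \<equiv> V\<lparr>carrier := T\<rparr>"

definition incl where "incl = quot_map VT S V S (\<lambda>x. x)"

definition image_TS where "image_TS = {S +> t | t. t \<in> T}"

sublocale T: quotient_space VT S
  by (rule quotient_spaceI[OF subspace_vec_space[OF T] subspace_of_subspace[OF vec_space T S ST]])

lemma coset_VT [simp]: "S +>\<^bsub>VT\<^esub> x = S +> x"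
  by (simp add: a_r_coset_def r_coset_def)

lemma T_carrier: "x \<in> T \<Longrightarrow> x \<in> carrier V"
  using subspaceD(1)[OF T] by auto

lemma incl_coset:
  assumes "t \<in> T"
  shows "incl (S +> t) = S +> t"
proof -
  have "S +> t \<in> a_rcosets\<^bsub>VT\<^esub> S"
    using assms T.coset_in[of t] by (simp add: quot_def)
  then have "incl (S +> t) = (\<Union>x\<in>S +> t. S +> x)"
    by (simp add: incl_def quot_map_def)
  also have "\<dots> = S +> t"
    by (rule coset_Union) (use in_coset T_carrier assms in blast)+
  finally show ?thesis .
qed

text \<open>Two representatives of a coset differ by an element of \<open>S\<close>, which lies in
  \<open>T\<close>, so membership in \<open>T\<close> is a property of the coset.\<close>

lemma coset_in_image_iff:
  assumes "x \<in> carrier V"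
  shows "S +> x \<in> image_TS \<longleftrightarrow> x \<in> T"
proof
  assume "S +> x \<in> image_TS"
  then obtain t where t: "t \<in> T" "S +> x = S +> t" by (auto simp: image_TS_def)
  then have "x \<ominus> t \<in> T" using coset_eq_iff assms T_carrier ST by blast
  then have "(x \<ominus> t) \<oplus> t \<in> T" using t subspaceD(3)[OF T] by blast
  then show "x \<in> T"
    using assms T_carrier t by (simp add: a_minus_def a_assoc l_neg)
qed (auto simp: image_TS_def)

lemma incl_image: "incl ` carrier (quot VT S) = image_TS"
  by (auto simp: image_TS_def T.quot_carrier incl_coset image_iff)

lemma image_subspace: "vec_subspace (quot V S) image_TS"
proof -
  interpret Q: vspace "quot V S" by (rule vspace.intro[OF quot_vec_space])
  show ?thesis
  proof (rule Q.subspaceI)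
    show "image_TS \<subseteq> carrier (quot V S)" using T_carrier by (auto simp: image_TS_def)
    show "\<zero>\<^bsub>quot V S\<^esub> \<in> image_TS"
      using coset_zero subspaceD(2)[OF T] by (auto simp: image_TS_def intro!: exI[of _ \<zero>])
    show "X \<oplus>\<^bsub>quot V S\<^esub> Y \<in> image_TS" if XY: "X \<in> image_TS" "Y \<in> image_TS" for X Y
    proof -
      obtain x y where "x \<in> T" "y \<in> T" "X = S +> x" "Y = S +> y"
        using XY by (auto simp: image_TS_def)
      then show ?thesis
        using subspaceD(3)[OF T] T_carrier coset_add[of x y] by (auto simp: image_TS_def)
    qed
    show "c \<odot>\<^bsub>quot V S\<^esub> X \<in> image_TS" if XY: "X \<in> image_TS" for c X
    proof -
      obtain x where "x \<in> T" "X = S +> x"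
        using XY by (auto simp: image_TS_def)
      then show ?thesis
        using subspaceD(4)[OF T] T_carrier coset_smult[of x] by (auto simp: image_TS_def)
    qed
  qed
qed

lemma quot_quot_basis:
  assumes "finite I" "b \<in> I \<rightarrow> carrier V"
    and span: "\<And>v. v \<in> carrier V \<Longrightarrow> \<exists>c. v \<ominus> (\<Oplus>i\<in>I. c i \<odot> b i) \<in> T"
    and indep: "\<And>c i. (\<Oplus>i\<in>I. c i \<odot> b i) \<in> T \<Longrightarrow> i \<in> I \<Longrightarrow> c i = 0"
  shows "fin_basis (quot (quot V S) image_TS) I (\<lambda>i. image_TS +>\<^bsub>quot V S\<^esub> (S +> b i))"
proof -
  interpret Q: quotient_space "quot V S" image_TS
    by (rule quotient_spaceI[OF quot_vec_space image_subspace])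
  show ?thesis
  proof (rule Q.quot_basis)
    fix X assume "X \<in> carrier (quot V S)"
    then obtain x where x: "x \<in> carrier V" "X = S +> x" by (metis quot_cases)
    obtain c where c: "x \<ominus> (\<Oplus>i\<in>I. c i \<odot> b i) \<in> T" using span x by blast
    have "X \<ominus>\<^bsub>quot V S\<^esub> (S +> (\<Oplus>i\<in>I. c i \<odot> b i)) = S +> (x \<ominus> (\<Oplus>i\<in>I. c i \<odot> b i))"
      using combination_in[OF assms(2)] x(1)
      by (simp add: x(2) a_minus_def Q.minus_eq_smult minus_eq_smult coset_smult coset_add del: quot_sel)
    then show "\<exists>c. X \<ominus>\<^bsub>quot V S\<^esub> (\<Oplus>\<^bsub>quot V S\<^esub>i\<in>I. c i \<odot>\<^bsub>quot V S\<^esub> (S +> b i)) \<in> image_TS"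
      unfolding coset_combination[OF assms(2)] using c by (auto simp: image_TS_def)
  next
    fix c i assume "(\<Oplus>\<^bsub>quot V S\<^esub>i\<in>I. c i \<odot>\<^bsub>quot V S\<^esub> (S +> b i)) \<in> image_TS" "i \<in> I"
    then show "c i = 0"
      unfolding coset_combination[OF assms(2)]
      using indep[of c i] coset_in_image_iff[OF combination_in[OF assms(2)]] by simp
  qed (use assms in auto)
qed

text \<open>A linear surjection with kernel \<open>T\<close> kills \<open>S\<close>, hence factors
  through V/S; the kernel of the factored map is T/S, the image of \<open>incl\<close>.\<close>

lemma short_exact_quot:
  assumes \<phi>: "lin_map V W \<phi>" and ker: "\<And>x. x \<in> carrier V \<Longrightarrow> \<phi> x = \<zero>\<^bsub>W\<^esub> \<longleftrightarrow> x \<in> T"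
    and onto: "\<phi> ` carrier V = carrier W"
  shows "\<exists>g. short_exact (quot VT S) (quot V S) W incl g"
proof -
  interpret W: vspace W by (rule vspace.intro[OF lin_mapD(2)[OF \<phi>]])
  \<comment> \<open>The factored map evaluates \<phi> at a chosen representative; the choice is
    harmless since \<phi> vanishes on \<open>S\<close>.\<close>
  define g where "g X = \<phi> (SOME x. x \<in> X)" for X
  have g: "g (S +> x) = \<phi> x" if x: "x \<in> carrier V" for x
  proof -
    define y where "y = (SOME y. y \<in> S +> x)"
    have "y \<in> S +> x" unfolding y_def by (rule someI[of _ x]) (rule coset_self[OF x])
    then have y: "y \<in> carrier V" and "S +> y = S +> x" using in_coset[OF x] by blast+
    then have y: "y \<in> carrier V" "y \<ominus> x \<in> T" using coset_eq_iff x ST by blast+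
    have "\<phi> (y \<ominus> x) = \<zero>\<^bsub>W\<^esub>" using ker y x by auto
    moreover have "y = (y \<ominus> x) \<oplus> x" using y x by (simp add: a_minus_def a_assoc l_neg)
    ultimately have "\<phi> y = \<phi> x"
      using lin_mapD(4)[OF \<phi>, of "y \<ominus> x" x] lin_mapD(3)[OF \<phi>, of x] y x by auto
    then show ?thesis by (simp add: g_def y_def)
  qed
  have "lin_map (quot V S) W g"
    unfolding lin_map_def
    using quot_vec_space W.vec_space lin_mapD[OF \<phi>]
    by (simp add: quot_carrier coset_add coset_smult g Pi_iff del: quot_sel)
  moreover have "lin_map (quot VT S) (quot V S) incl"
    unfolding lin_map_def
  proof (intro conjI ballI allI)
    show "vec_space (quot VT S)" by (rule T.quot_vec_space)
    show "vec_space (quot V S)" by (rule quot_vec_space)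
    show "incl \<in> carrier (quot VT S) \<rightarrow> carrier (quot V S)"
      using T_carrier by (auto simp: T.quot_carrier incl_coset)
    fix X Y assume "X \<in> carrier (quot VT S)" "Y \<in> carrier (quot VT S)"
    then obtain x y where "x \<in> T" "X = S +> x" "y \<in> T" "Y = S +> y"
      by (auto simp: T.quot_carrier)
    then show "incl (X \<oplus>\<^bsub>quot VT S\<^esub> Y) = incl X \<oplus>\<^bsub>quot V S\<^esub> incl Y"
      using T.coset_add[of x y] subspaceD(3)[OF T] T_carrier
      by (simp add: incl_coset coset_add del: quot_sel T.quot_sel)
  next
    fix c X assume "X \<in> carrier (quot VT S)"
    then obtain x where "x \<in> T" "X = S +> x" by (auto simp: T.quot_carrier)
    then show "incl (c \<odot>\<^bsub>quot VT S\<^esub> X) = c \<odot>\<^bsub>quot V S\<^esub> incl X"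
      using T.coset_smult[of x c] subspaceD(4)[OF T] T_carrier
      by (simp add: incl_coset coset_smult)
  qed
  moreover have "inj_on incl (carrier (quot VT S))"
    by (rule inj_onI) (auto simp: T.quot_carrier incl_coset)
  moreover have "incl ` carrier (quot VT S) = {v \<in> carrier (quot V S). g v = \<zero>\<^bsub>W\<^esub>}"
    unfolding incl_image using g ker T_carrier by (auto simp: image_TS_def quot_carrier)
  moreover have "g ` carrier (quot V S) = carrier W"
    using onto g by (auto simp: quot_carrier image_image)
  ultimately show ?thesis unfolding short_exact_def by blast
qed

end

subsection \<open>Determinants of tuples of vectors\<close>

text \<open>The determinant as a function of a tuple of rows, so that multilinearity can be phrased
  with function updates.\<close>

definition rdet :: "('n \<Rightarrow> 'k::field ^ 'n::finite) \<Rightarrow> 'k" where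
  "rdet u = det (\<chi> i. u i)"

lemma rdet_add: "rdet (u(k := x + y)) = rdet (u(k := x)) + rdet (u(k := y))"
  using det_row_add[of k "\<lambda>_. x" "\<lambda>_. y" u] by (simp add: rdet_def fun_upd_def)

lemma rdet_scale: "rdet (u(k := c *s x)) = c * rdet (u(k := x))"
  using det_row_mul[of k c "\<lambda>_. x" u] by (simp add: rdet_def fun_upd_def)

lemma rdet_zero: "rdet (u(k := 0)) = 0"
  using rdet_scale[of u k 0 0] by simp

lemma rdet_sum: "rdet (u(k := sum g A)) = (\<Sum>a\<in>A. rdet (u(k := g a)))"
  by (rule sum_comp_morphism[of "\<lambda>x. rdet (u(k := x))" g A, unfolded comp_def, symmetric])
    (rule rdet_zero rdet_add)+

lemma rdet_equal: "i \<noteq> j \<Longrightarrow> u i = u j \<Longrightarrow> rdet u = 0"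
  unfolding rdet_def by (rule det_identical_rows[of i j]) (auto simp: row_def vec_eq_iff)

lemma rdet_proportional:
  assumes "i \<noteq> j" "u i = c *s u j"
  shows "rdet u = 0"
proof -
  have "rdet u = rdet (u(i := c *s u j))" using assms(2) by (metis fun_upd_triv)
  also have "\<dots> = 0" using rdet_equal[of i j "u(i := u j)"] assms(1) by (simp add: rdet_scale)
  finally show ?thesis .
qed

lemma rdet_permute:
  fixes u :: "'n::finite \<Rightarrow> 'k::field ^ 'n"
  assumes "p permutes UNIV"
  shows "rdet (u \<circ> p) = of_int (sign p) * rdet u"
  using det_permute_rows[OF assms, of "\<chi> i. u i"] by (simp add: rdet_def)

lemma rdet_swap:
  assumes "i \<noteq> j"
  shows "rdet (u(i := x, j := y)) = - rdet (u(i := y, j := x))"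
proof -
  have "(u(i := y, j := x)) \<circ> Transposition.transpose i j = u(i := x, j := y)"
    using assms by (auto simp: fun_eq_iff Transposition.transpose_def)
  moreover have "Transposition.transpose i j permutes UNIV" by (rule permutes_swap_id) auto
  ultimately show ?thesis
    using rdet_permute[of "Transposition.transpose i j" "u(i := y, j := x)"] assms
    by (simp add: sign_swap_id)
qed

lemma vec_expand: "(\<Sum>m\<in>UNIV. x $ m *s axis m 1) = (x :: 'k::comm_ring_1 ^ 'n::finite)"
  by (rule basis_expansion)

lemma rdet_axis: "rdet (\<lambda>k::'n::finite. axis k (1 :: 'k::field)) = 1"
proof -
  have *: "(\<chi> k. axis k 1) = (mat 1 :: 'k ^ 'n ^ 'n)"
    by (auto simp: vec_eq_iff mat_def axis_def)
  show ?thesis unfolding rdet_def * by simp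
qed

lemma rdet_axis_upd:
  fixes x :: "'k::field ^ 'n::finite"
  shows "rdet ((\<lambda>k. axis k 1)(i := x)) = x $ i"
proof -
  have "rdet ((\<lambda>k. axis k 1)(i := x)) = (\<Sum>m\<in>UNIV. x $ m * rdet ((\<lambda>k. axis k 1)(i := axis m 1)))"
    by (subst vec_expand[of x, symmetric], subst rdet_sum) (simp add: rdet_scale)
  also have "\<dots> = (\<Sum>m\<in>UNIV. if m = i then x $ i else 0)"
  proof (rule sum.cong)
    fix m
    have "(\<lambda>k. axis k (1::'k))(i := axis i 1) = (\<lambda>k. axis k 1)" by auto
    moreover have "m \<noteq> i \<Longrightarrow> rdet ((\<lambda>k. axis k (1::'k))(i := axis m 1)) = 0"
      by (rule rdet_equal[of i m]) auto
    ultimately show "x $ m * rdet ((\<lambda>k. axis k 1)(i := axis m 1)) = (if m = i then x $ i else 0)"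
      using rdet_axis[where 'k='k and 'n='n] by auto
  qed simp
  finally show ?thesis by simp
qed

text \<open>When \<open>x\<close> is expanded in the standard basis, every vector other than the
  i-th and j-th repeats a row, so a 2 x 2 minor is all that survives.\<close>

lemma rdet_axis_upd2:
  fixes x :: "'k::field ^ 'n::finite"
  assumes "i \<noteq> j"
  shows "rdet ((\<lambda>k. axis k 1)(i := x, j := y)) = x $ i * y $ j - x $ j * y $ i"
proof -
  let ?E = "\<lambda>k. axis k (1::'k)"
  have "rdet (?E(i := x, j := y)) = rdet ((?E(j := y))(i := x))"
    using assms by (simp add: fun_upd_twist)
  also have "\<dots> = (\<Sum>m\<in>UNIV. x $ m * rdet (?E(j := y, i := axis m 1)))"
    by (subst vec_expand[of x, symmetric], subst rdet_sum) (simp add: rdet_scale)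
  also have "\<dots> = (\<Sum>m\<in>UNIV. (if m = i then x $ i * y $ j else 0) - (if m = j then x $ j * y $ i else 0))"
  proof (rule sum.cong)
    fix m
    have "rdet (?E(j := y, i := axis i 1)) = y $ j"
    proof -
      have "?E(j := y, i := axis i 1) = ?E(j := y)" using assms by auto
      then show ?thesis by (simp add: rdet_axis_upd)
    qed
    moreover have "rdet (?E(j := y, i := axis j 1)) = - y $ i"
    proof -
      have "rdet (?E(j := y, i := axis j 1)) = - rdet (?E(j := axis j 1, i := y))"
        by (rule rdet_swap) (use assms in auto)
      also have "?E(j := axis j 1, i := y) = ?E(i := y)" using assms by auto
      also have "rdet (?E(i := y)) = y $ i" by (rule rdet_axis_upd)
      finally show ?thesis .
    qed
    moreover have "m \<noteq> i \<Longrightarrow> m \<noteq> j \<Longrightarrow> rdet (?E(j := y, i := axis m 1)) = 0"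
      by (rule rdet_equal[of i m]) auto
    ultimately show "x $ m * rdet (?E(j := y, i := axis m 1)) =
      (if m = i then x $ i * y $ j else 0) - (if m = j then x $ j * y $ i else 0)"
      using assms by auto
  qed simp
  finally show ?thesis by (simp add: sum_subtractf)
qed

text \<open>Both sides are the cofactor at (i, p). They agree permutation by permutation: a
  permutation contributes only if it sends i to p, and then the special factor is 1 on both
  sides.\<close>

lemma det_cofactor_row_column:
  fixes B :: "'k::comm_ring_1 ^ 'n ^ 'n"
  shows "det (\<chi> r c. if r = i then axis p 1 $ c else B $ r $ c) =
    det (\<chi> r c. if c = p then axis i 1 $ r else B $ r $ c)"
  unfolding det_def
proof (rule sum.cong)
  fix \<pi> :: "'n \<Rightarrow> 'n" assume "\<pi> \<in> {p. p permutes UNIV}"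
  then have bij: "bij \<pi>" by (auto simp: permutes_bij)
  have "(\<Prod>r\<in>UNIV. if r = i then axis p 1 $ \<pi> r else B $ r $ \<pi> r) =
    (\<Prod>r\<in>UNIV. if \<pi> r = p then axis i 1 $ r else B $ r $ \<pi> r)"
  proof (cases "\<pi> i = p")
    case True
    then have "\<pi> r = p \<longleftrightarrow> r = i" for r using bij by (metis bij_pointE)
    then show ?thesis by (intro prod.cong) (auto simp: axis_def)
  next
    case False
    obtain r where r: "\<pi> r = p" using bij by (metis bij_pointE)
    have "(\<Prod>r\<in>UNIV. if r = i then axis p 1 $ \<pi> r else B $ r $ \<pi> r) = 0"
      by (rule prod_zero) (use False in \<open>auto intro!: bexI[of _ i] simp: axis_def\<close>)
    moreover have "(\<Prod>r\<in>UNIV. if \<pi> r = p then axis i 1 $ r else B $ r $ \<pi> r) = 0"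
      by (rule prod_zero) (use False r in \<open>auto intro!: bexI[of _ r] simp: axis_def\<close>)
    ultimately show ?thesis by simp
  qed
  then show "of_int (sign \<pi>) * (\<Prod>r\<in>UNIV. (\<chi> r c. if r = i then axis p 1 $ c else B $ r $ c) $ r $ \<pi> r) =
    of_int (sign \<pi>) * (\<Prod>r\<in>UNIV. (\<chi> r c. if c = p then axis i 1 $ r else B $ r $ c) $ r $ \<pi> r)"
    by (simp cong: if_cong)
qed simp

text \<open>Cramer's rule in the division-free form that also covers singular tuples.\<close>

lemma cramer_sum:
  fixes u :: "'n::finite \<Rightarrow> 'k::field ^ 'n"
  shows "(\<Sum>i\<in>UNIV. u i $ m * rdet (u(i := x))) = rdet u * x $ m"
proof -
  \<comment> \<open>The cofactor is rewritten with a replaced column, so that the sum over i becomes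
    linear in that column.\<close>
  have C: "rdet (u(i := axis p 1)) = rdet (\<lambda>c. if c = p then axis i 1 else (\<chi> r. u r $ c))" for i p
  proof -
    have "rdet (u(i := axis p 1)) = det (\<chi> r c. if r = i then axis p 1 $ c else (\<chi> i. u i) $ r $ c)"
      unfolding rdet_def by (rule arg_cong[of _ _ det]) (auto simp: vec_eq_iff)
    also have "\<dots> = det (transpose (\<chi> r c. if c = p then axis i 1 $ r else (\<chi> i. u i) $ r $ c))"
      unfolding det_cofactor_row_column by simp
    also have "\<dots> = rdet (\<lambda>c. if c = p then axis i 1 else (\<chi> r. u r $ c))"
      unfolding rdet_def by (rule arg_cong[of _ _ det]) (auto simp: vec_eq_iff transpose_def)
    finally show ?thesis .
  qed
  \<comment> \<open>The sum puts column m in place of column p: the original determinant if p = m,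
    two equal columns otherwise.\<close>
  have col: "(\<Sum>i\<in>UNIV. u i $ m * rdet (u(i := axis p 1))) = (if p = m then rdet u else 0)" for p
  proof -
    let ?W = "\<lambda>c. (\<chi> r. u r $ c)"
    have "(\<Sum>i\<in>UNIV. u i $ m * rdet (u(i := axis p 1))) =
      (\<Sum>i\<in>UNIV. ?W m $ i * rdet (?W(p := axis i 1)))"
      unfolding C by (simp add: fun_upd_def)
    also have "\<dots> = rdet (?W(p := (\<Sum>i\<in>UNIV. ?W m $ i *s axis i 1)))"
      by (simp add: rdet_sum rdet_scale)
    also have "\<dots> = rdet (?W(p := ?W m))" by (simp only: vec_expand)
    also have "\<dots> = (if p = m then rdet u else 0)"
    proof (cases "p = m")
      case True
      have "rdet ?W = det (transpose (\<chi> i. u i))"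
        unfolding rdet_def by (rule arg_cong[of _ _ det]) (auto simp: vec_eq_iff transpose_def)
      moreover have "?W(p := ?W m) = ?W" using True by auto
      ultimately show ?thesis using True by (simp add: rdet_def)
    next
      case False
      then show ?thesis using rdet_equal[of p m "?W(p := ?W m)"] by auto
    qed
    finally show ?thesis .
  qed
  have "(\<Sum>i\<in>UNIV. u i $ m * rdet (u(i := x))) =
    (\<Sum>i\<in>UNIV. \<Sum>p\<in>UNIV. x $ p * (u i $ m * rdet (u(i := axis p 1))))"
  proof (rule sum.cong)
    fix i
    have "rdet (u(i := x)) = rdet (u(i := (\<Sum>p\<in>UNIV. x $ p *s axis p 1)))"
      by (simp only: vec_expand)
    then show "u i $ m * rdet (u(i := x)) = (\<Sum>p\<in>UNIV. x $ p * (u i $ m * rdet (u(i := axis p 1))))"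
      by (simp add: rdet_sum rdet_scale sum_distrib_left mult.left_commute)
  qed simp
  also have "\<dots> = (\<Sum>p\<in>UNIV. x $ p * (\<Sum>i\<in>UNIV. u i $ m * rdet (u(i := axis p 1))))"
    by (subst sum.swap) (simp add: sum_distrib_left)
  also have "\<dots> = (\<Sum>p\<in>UNIV. if p = m then x $ m * rdet u else 0)"
    unfolding col by (rule sum.cong) auto
  finally show ?thesis by (simp add: mult.commute)
qed

subsection \<open>Integer vectors\<close>

definition emb :: "int ^ 'n \<Rightarrow> 'k::field ^ 'n::finite" where
  "emb v = (\<chi> i. of_int (v $ i))"

lemma emb_simps [simp]:
  "emb v $ i = of_int (v $ i)" "emb 0 = 0" "emb (v + w) = emb v + emb w"
  "emb (v - w) = emb v - emb w" "emb (- v) = - emb v" "emb (axis k 1) = axis k 1"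
  "emb (c *s v) = of_int c *s emb v"
  by (auto simp: emb_def vec_eq_iff axis_def)

definition idet :: "('n \<Rightarrow> int ^ 'n) \<Rightarrow> 'k::field" where
  "idet \<beta> = rdet (\<lambda>k::'n::finite. emb (\<beta> k))"

lemma emb_upd: "(\<lambda>k. emb ((\<beta>(i := x)) k)) = (\<lambda>k. emb (\<beta> k))(i := emb x)"
  by auto

lemma idet_add: "idet (\<beta>(k := x + y)) = idet (\<beta>(k := x)) + idet (\<beta>(k := y))"
  unfolding idet_def emb_upd by (simp add: rdet_add)

lemma idet_double: "idet (\<beta>(k := x + x)) = 2 * idet (\<beta>(k := x))"
  by (simp only: idet_add mult_2)

lemma idet_zero: "idet (\<beta>(k := 0)) = 0"
  unfolding idet_def emb_upd by (simp add: rdet_zero)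

lemma idet_sum: "idet (\<beta>(k := sum g A)) = (\<Sum>a\<in>A. idet (\<beta>(k := g a)))"
  by (rule sum_comp_morphism[of "\<lambda>x. idet (\<beta>(k := x))" g A, unfolded comp_def, symmetric])
    (rule idet_zero idet_add)+

lemma idet_equal: "i \<noteq> j \<Longrightarrow> \<beta> i = \<beta> j \<Longrightarrow> idet \<beta> = 0"
  unfolding idet_def by (rule rdet_equal[of i j]) auto

text \<open>In the expansion by row k every summand other than \<beta> k itself repeats a
  row.\<close>

lemma idet_upd_sum: "idet (\<beta>(k := sum \<beta> UNIV)) = idet \<beta>"
proof -
  have *: "idet (\<beta>(k := \<beta> i)) = (if i = k then idet \<beta> else 0)" for i
    using idet_equal[of k i "\<beta>(k := \<beta> i)"] by auto
  show ?thesis unfolding idet_sum * by simp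
qed

text \<open>This is why x^(-\<theta>) never occurs in a value of the Jacobian: that exponent forces
  the rows to sum to zero.\<close>

lemma idet_sum_zero: "sum \<beta> UNIV = 0 \<Longrightarrow> idet \<beta> = 0"
  using idet_upd_sum[of \<beta>] by (metis idet_zero)

definition bracket :: "'n \<Rightarrow> 'n \<Rightarrow> int ^ 'n \<Rightarrow> int ^ 'n \<Rightarrow> 'k::field" where
  "bracket i j a b = of_int (a $ i * b $ j - a $ j * b $ (i::'n::finite))"

text \<open>The test tuples of the whole proof: two free exponents among standard basis vectors, so
  that the determinant is the minor \<open>bracket\<close>.\<close>

definition pair_tuple :: "'n \<Rightarrow> 'n \<Rightarrow> int ^ 'n \<Rightarrow> int ^ 'n \<Rightarrow> 'n \<Rightarrow> int ^ 'n::finite" where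
  "pair_tuple i j a b = (\<lambda>k. axis k 1)(i := a, j := b)"

definition pair_rest :: "'n \<Rightarrow> 'n \<Rightarrow> int ^ 'n::finite" where
  "pair_rest i j = theta - axis i 1 - axis j 1"

lemma idet_axis_upd: "idet ((\<lambda>k. axis k 1)(i := x)) = of_int (x $ i)"
  unfolding idet_def emb_upd by (simp add: rdet_axis_upd)

lemma idet_pair_tuple: "i \<noteq> j \<Longrightarrow> idet (pair_tuple i j a b) = bracket i j a b"
  unfolding idet_def pair_tuple_def emb_upd by (simp add: rdet_axis_upd2 bracket_def)

lemma sum_axis: "(\<Sum>k\<in>UNIV. axis k 1) = (theta :: int ^ 'n::finite)"
  by (simp add: vec_eq_iff theta_def axis_def)

lemma sum_fun_upd:
  fixes u :: "'n::finite \<Rightarrow> 'a::ab_group_add"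
  shows "sum (u(k := x)) UNIV = sum u UNIV - u k + x"
  using sum.remove[of UNIV k "u(k := x)"] sum.remove[of UNIV k u] by simp

lemma sum_pair_tuple: "i \<noteq> j \<Longrightarrow> sum (pair_tuple i j a b) UNIV = a + b + pair_rest i j"
  unfolding pair_tuple_def pair_rest_def sum_fun_upd sum_axis by simp

text \<open>For i different from j, \<open>pair_rest i j\<close> is the sum of the remaining
  standard vectors and vanishes in the coordinates i and j. Subtracting it prescribes the total
  exponent of a test tuple without changing its determinant.\<close>

lemma bracket_rest:
  "i \<noteq> j \<Longrightarrow> bracket i j (a - b - pair_rest i j) b = bracket i j a b"
  "i \<noteq> j \<Longrightarrow> bracket i j (a - pair_rest i j) b = bracket i j a b"
  by (simp_all add: bracket_def pair_rest_def theta_def axis_def algebra_simps)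

definition pairing :: "'k::field ^ 'n \<Rightarrow> int ^ 'n::finite \<Rightarrow> 'k" where
  "pairing l v = (\<Sum>i\<in>UNIV. l $ i * of_int (v $ i))"

lemma pairing_simps [simp]:
  "pairing l 0 = 0" "pairing l (v + w) = pairing l v + pairing l w"
  "pairing l (v - w) = pairing l v - pairing l w" "pairing l (- v) = - pairing l v"
  "pairing l (axis k 1) = l $ k" "pairing 0 v = 0"
  by (simp_all add: pairing_def algebra_simps sum.distrib sum_subtractf sum_negf axis_def
      if_distrib[of of_int] if_distrib[of "\<lambda>x. _ * x"] cong: if_cong)

lemma pairing_sum: "pairing l (sum g A) = (\<Sum>a\<in>A. pairing l (g a))"
  by (induction A rule: infinite_finite_induct) simp_all

text \<open>Additivity alone gives linearity over the integers, so the values at the standard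
  vectors determine the map.\<close>

lemma additive_pairing:
  fixes c :: "int ^ 'n::finite \<Rightarrow> 'k::field"
  assumes add: "\<And>v w. c (v + w) = c v + c w"
  shows "c v = pairing (\<chi> i. c (axis i 1)) v"
proof -
  have c0: "c 0 = 0" by (metis add add.right_neutral add_left_cancel)
  have cm: "c (- v) = - c v" for v using add[of v "- v"] c0 by (simp add: eq_neg_iff_add_eq_0 add.commute)
  have nat: "c (int m *s v) = of_nat m * c v" for m v
  proof (induction m)
    case (Suc m)
    have "int (Suc m) *s v = v + int m *s v" by (simp add: vec_eq_iff algebra_simps)
    then show ?case using Suc add by (simp add: algebra_simps)
  qed (simp add: c0)
  have int: "c (m *s v) = of_int m * c v" for m v
  proof (cases m rule: int_cases2)
    case (nonneg k) then show ?thesis using nat by simp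
  next
    case (nonpos k)
    then have "m *s v = - (int k *s v)" by (simp add: vec_eq_iff)
    then show ?thesis using nat cm nonpos by simp
  qed
  have sum: "c (sum g A) = (\<Sum>a\<in>A. c (g a))" for g :: "'n \<Rightarrow> _" and A
    by (induction A rule: infinite_finite_induct) (simp_all add: c0 add)
  have "c v = c (\<Sum>m\<in>UNIV. v $ m *s axis m 1)" by (simp only: vec_expand)
  also have "\<dots> = pairing (\<chi> i. c (axis i 1)) v"
    unfolding sum int pairing_def by (simp add: mult.commute)
  finally show ?thesis .
qed

text \<open>The coordinates of \<open>cramer_sum\<close>, weighted by \<open>l\<close>. This
  produces the term \<lambda>(\<sigma>) in the derivation identity of a linear form.\<close>

lemma cramer_pairing:
  "(\<Sum>k\<in>UNIV. pairing l (\<beta> k) * idet (\<beta>(k := x))) = idet \<beta> * pairing l x"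
proof -
  have "(\<Sum>k\<in>UNIV. pairing l (\<beta> k) * idet (\<beta>(k := x))) =
    (\<Sum>k\<in>UNIV. \<Sum>m\<in>UNIV. l $ m * (of_int (\<beta> k $ m) * idet (\<beta>(k := x))))"
    by (simp add: pairing_def sum_distrib_right mult.assoc)
  also have "\<dots> = (\<Sum>m\<in>UNIV. l $ m * (\<Sum>k\<in>UNIV. of_int (\<beta> k $ m) * idet (\<beta>(k := x))))"
    by (subst sum.swap) (simp add: sum_distrib_left)
  also have "\<dots> = (\<Sum>m\<in>UNIV. l $ m * (idet \<beta> * of_int (x $ m)))"
    unfolding idet_def emb_upd
    by (rule sum.cong[OF refl], rule arg_cong[of _ _ "(*) _"])
      (rule cramer_sum[where u="\<lambda>k. emb (\<beta> k)" and x="emb x", unfolded emb_simps])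
  also have "\<dots> = idet \<beta> * pairing l x"
    by (simp add: pairing_def sum_distrib_left algebra_simps)
  finally show ?thesis .
qed

subsection \<open>Generic integer vectors\<close>

text \<open>Points of the moment curve avoid, from some parameter on, any given proper affine subspace.\<close>

definition coord_index :: "'n::finite \<Rightarrow> nat" where
  "coord_index = (SOME e. inj e)"

text \<open>Distinct positive exponents make an affine form along the curve a polynomial in N with
  the same coefficients, its constant term staying separate.\<close>

definition moment :: "nat \<Rightarrow> int ^ 'n::finite" where
  "moment N = (\<chi> k. int N ^ Suc (coord_index k))"

lemma inj_coord_index: "inj (coord_index :: 'n::finite \<Rightarrow> nat)"
proof -
  have "\<exists>e :: 'n \<Rightarrow> nat. inj e"
    using finite_imp_inj_to_nat_seg[of "UNIV :: 'n set"] by auto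
  then show ?thesis unfolding coord_index_def by (rule someI_ex)
qed

text \<open>Along the curve the affine form is a nonzero polynomial with finitely many roots; in
  characteristic 0 distinct parameters are distinct points of the field.\<close>

lemma generic_affine:
  fixes a :: "'k::field_char_0 ^ 'n::finite"
  assumes "a \<noteq> 0"
  shows "\<forall>\<^sub>F N in sequentially. c + pairing a (moment N) \<noteq> 0"
proof -
  define p where "p = [:c:] + (\<Sum>k\<in>UNIV. monom (a $ k) (Suc (coord_index k)))"
  obtain m where m: "a $ m \<noteq> 0" using assms by (auto simp: vec_eq_iff)
  have "coeff p (Suc (coord_index m)) = (\<Sum>k\<in>UNIV. if k = m then a $ k else 0)"
    using inj_eq[OF inj_coord_index[where 'n='n]] by (simp add: p_def coeff_sum)
  then have "p \<noteq> 0" using m by auto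
  then have "finite {x. poly p x = 0}" by (rule poly_roots_finite)
  then have "finite ((of_nat :: nat \<Rightarrow> 'k) -` {x. poly p x = 0})"
    by (rule finite_vimageI) (simp add: inj_on_def)
  then have "\<forall>\<^sub>F N in sequentially. poly p (of_nat N) \<noteq> 0"
    unfolding cofinite_eq_sequentially[symmetric] eventually_cofinite by (simp add: vimage_def)
  moreover have "poly p (of_nat N) = c + pairing a (moment N)" for N
    by (simp add: p_def pairing_def moment_def poly_sum poly_monom)
  ultimately show ?thesis by simp
qed

lemma generic_neq:
  fixes v w :: "int ^ 'n::finite"
  assumes "m \<noteq> 0"
  shows "\<forall>\<^sub>F N in sequentially. v + m *s moment N \<noteq> w"
proof -
  fix i :: 'n
  \<comment> \<open>One coordinate suffices; the comparison is made over the rationals, a field of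
    characteristic 0 in which the integers embed.\<close>
  have "\<forall>\<^sub>F N in sequentially. of_int (v $ i - w $ i) + pairing (axis i (of_int m) :: rat ^ 'n) (moment N) \<noteq> 0"
    by (rule generic_affine) (use assms in \<open>auto simp: axis_eq_0_iff\<close>)
  then show ?thesis
  proof (rule eventually_mono)
    fix N assume *: "of_int (v $ i - w $ i) + pairing (axis i (of_int m) :: rat ^ 'n) (moment N) \<noteq> 0"
    have "pairing (axis i (of_int m) :: rat ^ 'n) (moment N) = of_int (m * moment N $ i)"
      by (simp add: pairing_def axis_def if_distrib[of "\<lambda>x. x * _"] cong: if_cong)
    then have "rat_of_int (v $ i - w $ i + m * moment N $ i) \<noteq> 0" using * by simp
    then have "v $ i - w $ i + m * moment N $ i \<noteq> 0" by (simp only: of_int_eq_0_iff not_False_eq_True)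
    then have "(v + m *s moment N) $ i \<noteq> w $ i" by simp
    then show "v + m *s moment N \<noteq> w" by metis
  qed
qed

lemma generic_notin:
  fixes v :: "int ^ 'n::finite"
  assumes "m \<noteq> 0" "finite S"
  shows "\<forall>\<^sub>F N in sequentially. v + m *s moment N \<notin> S"
proof -
  have "\<forall>\<^sub>F N in sequentially. \<forall>w\<in>S. v + m *s moment N \<noteq> w"
    by (rule eventually_ball_finite[OF assms(2)]) (use generic_neq[OF assms(1)] in blast)
  then show ?thesis by (rule eventually_mono) auto
qed

lemma generic_bracket:
  fixes w v :: "int ^ 'n::finite"
  assumes "i \<noteq> j" "w $ i \<noteq> 0"
  shows "\<forall>\<^sub>F N in sequentially. c + bracket i j w (v + moment N) \<noteq> (0 :: 'k::field_char_0)"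
proof -
  \<comment> \<open>The coefficient vector of the linear form \<open>bracket i j w\<close>; its j-th
    entry is w_i, which is nonzero.\<close>
  define a :: "'k ^ 'n" where "a = axis j (of_int (w $ i)) - axis i (of_int (w $ j))"
  have "a $ j \<noteq> 0" using assms by (simp add: a_def axis_def)
  then have "a \<noteq> 0" by auto
  then have "\<forall>\<^sub>F N in sequentially. (c + bracket i j w v) + pairing a (moment N) \<noteq> 0"
    by (rule generic_affine)
  moreover have "pairing a (moment N) = bracket i j w (moment N)" for N
    by (simp add: a_def pairing_def bracket_def axis_def algebra_simps sum_subtractf
        if_distrib[of "\<lambda>x. x * _"] if_distrib[of "\<lambda>x. _ * x"] cong: if_cong)
  moreover have "bracket i j w (v + moment N) = (bracket i j w v + bracket i j w (moment N) :: 'k)" for N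
    by (simp add: bracket_def algebra_simps)
  ultimately show ?thesis by (simp add: add.assoc)
qed

lemma ex_other_index:
  assumes "CARD('n::finite) > 1"
  shows "\<exists>j. j \<noteq> (i :: 'n)"
proof (rule ccontr)
  assume "\<not> ?thesis"
  then have "(UNIV :: 'n set) = {i}" by auto
  then have "CARD('n) = card {i}" by (rule arg_cong)
  then show False using assms by simp
qed

lemma eventually_sequentially_ex: "\<forall>\<^sub>F N in sequentially. P N \<Longrightarrow> \<exists>N. P N"
  by (rule eventually_happens'[OF sequentially_bot])

subsection \<open>Homogeneous derivations\<close>

text \<open>For the homogeneous map sending x^b to f(b) x^(b+\<sigma>), this is the derivation
  identity on the monomials x^(\<beta> k), read at its only possible exponent
  \<open>sum \<beta> UNIV - theta + \<sigma>\<close>.\<close>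

definition hom_der :: "(int ^ 'n::finite \<Rightarrow> 'k::field) \<Rightarrow> int ^ 'n \<Rightarrow> ('n \<Rightarrow> int ^ 'n) \<Rightarrow> bool" where
  "hom_der f \<sigma> \<beta> \<longleftrightarrow>
    f (sum \<beta> UNIV - theta) * idet \<beta> = (\<Sum>k\<in>UNIV. f (\<beta> k) * idet (\<beta>(k := \<beta> k + \<sigma>)))"

text \<open>Row i of each determinant splits into \<beta> i and \<sigma>. The \<sigma> parts
  weighted by \<lambda> are summed by \<open>cramer_pairing\<close>; those weighted by k vanish
  because \<sigma> = 0 or k = 0.\<close>

lemma affine_sum:
  fixes l :: "'k::field_char_0 ^ 'n::finite"
  assumes "\<sigma> \<noteq> 0 \<Longrightarrow> k = 0"
  shows "(\<Sum>i\<in>UNIV. (pairing l (\<beta> i) + k) * idet (\<beta>(i := \<beta> i + \<sigma>))) =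
    (pairing l (sum \<beta> UNIV) + of_nat CARD('n) * k + pairing l \<sigma>) * idet \<beta>"
proof -
  have "(\<Sum>i\<in>UNIV. (pairing l (\<beta> i) + k) * idet (\<beta>(i := \<beta> i + \<sigma>))) =
    (\<Sum>i\<in>UNIV. (pairing l (\<beta> i) + k) * idet \<beta>) + (\<Sum>i\<in>UNIV. pairing l (\<beta> i) * idet (\<beta>(i := \<sigma>)))
      + k * (\<Sum>i\<in>UNIV. idet (\<beta>(i := \<sigma>)))"
    by (simp add: idet_add algebra_simps sum.distrib sum_distrib_left)
  moreover have "k * (\<Sum>i\<in>UNIV. idet (\<beta>(i := \<sigma>))) = 0"
    using assms(1) by (cases "\<sigma> = 0") (auto simp: idet_zero)
  moreover have "(\<Sum>i\<in>UNIV. (pairing l (\<beta> i) + k) * idet \<beta>) =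
      (pairing l (sum \<beta> UNIV) + of_nat CARD('n) * k) * idet \<beta>"
    by (simp add: sum_distrib_right[symmetric] sum.distrib pairing_sum)
  ultimately show ?thesis by (simp add: cramer_pairing algebra_simps)
qed

text \<open>By \<open>affine_sum\<close> the identity reduces to k - \<lambda>(\<theta>) = n k +
  \<lambda>(\<sigma>), which is the second hypothesis.\<close>

lemma hom_der_affine:
  fixes l :: "'k::field_char_0 ^ 'n::finite"
  assumes "\<sigma> \<noteq> 0 \<Longrightarrow> k = 0" "pairing l (\<sigma> + theta) = (1 - of_nat CARD('n)) * k"
  shows "hom_der (\<lambda>v. pairing l v + k) \<sigma> \<beta>"
proof -
  have "pairing l (sum \<beta> UNIV - theta) + k = pairing l (sum \<beta> UNIV) + of_nat CARD('n) * k + pairing l \<sigma>"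
    using assms(2) by (simp add: algebra_simps)
  moreover have "(\<Sum>i\<in>UNIV. (pairing l (\<beta> i) + k) * idet (\<beta>(i := \<beta> i + \<sigma>))) =
    (pairing l (sum \<beta> UNIV) + of_nat CARD('n) * k + pairing l \<sigma>) * idet \<beta>"
    by (rule affine_sum) (rule assms(1))
  ultimately show ?thesis unfolding hom_der_def by simp
qed

text \<open>Both sides vanish. On the left the value is nonzero only if the rows sum to zero, so the
  determinant is zero; on the right a row equal to -\<theta> becomes zero after the shift by
  \<theta>.\<close>

lemma hom_der_delta:
  "hom_der (\<lambda>v. if v = - theta then z else 0) theta (\<beta> :: 'n::finite \<Rightarrow> int ^ 'n)"
proof -
  have "(\<Sum>k\<in>UNIV. (if \<beta> k = - theta then z else 0) * idet (\<beta>(k := \<beta> k + theta))) = 0"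
    by (rule sum.neutral) (auto simp: idet_zero)
  then show ?thesis using idet_sum_zero[of \<beta>] by (auto simp: hom_der_def)
qed

lemma generic_notin_1: "finite S \<Longrightarrow> \<forall>\<^sub>F N in sequentially. v + moment N \<notin> (S :: (int ^ 'n::finite) set)"
  using generic_notin[of 1 S v] by simp

lemma generic_notin_uminus: "finite S \<Longrightarrow> \<forall>\<^sub>F N in sequentially. v - moment N \<notin> (S :: (int ^ 'n::finite) set)"
proof -
  have "v + (-1) *s moment N = v - moment N" for N by (simp add: vec_eq_iff)
  then show "finite S \<Longrightarrow> ?thesis" using generic_notin[of "-1" S v] by simp
qed

lemma generic_notin_double:
  assumes "finite S"
  shows "\<forall>\<^sub>F N in sequentially. v + (moment N + moment N) \<notin> (S :: (int ^ 'n::finite) set)"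
proof -
  have "v + 2 *s moment N = v + (moment N + moment N)" for N by (simp add: vec_eq_iff)
  then show ?thesis using generic_notin[of 2 S v] assms by simp
qed

lemma generic_notin_triple:
  assumes "finite S"
  shows "\<forall>\<^sub>F N in sequentially. v + (moment N + moment N + moment N) \<notin> (S :: (int ^ 'n::finite) set)"
proof -
  have "v + 3 *s moment N = v + (moment N + moment N + moment N)" for N by (simp add: vec_eq_iff)
  then show ?thesis using generic_notin[of 3 S v] assms by simp
qed

lemma generic_bracket_0:
  assumes "i \<noteq> j" "w $ i \<noteq> 0"
  shows "\<forall>\<^sub>F N in sequentially. bracket i j w (v + moment N) \<noteq> (0 :: 'k::field_char_0)"
  using generic_bracket[OF assms, of 0] by simp

text \<open>A function that is generically additive in its first argument agrees with a linear one up to a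
  constant along generic translates; exceptional first arguments are sums of two ordinary ones.\<close>

lemma generic_additive_extension:
  fixes f :: "int ^ 'n::finite \<Rightarrow> 'k::field_char_0"
  assumes S: "finite S"
    and H: "\<And>v. v \<notin> S \<Longrightarrow> \<exists>c. \<forall>u. \<forall>\<^sub>F N in sequentially. f (v + (u + moment N)) = c + f (u + moment N)"
  shows "\<exists>l. \<forall>v u. \<forall>\<^sub>F N in sequentially. f (v + (u + moment N)) = pairing l v + f (u + moment N)"
proof -
  have all: "\<exists>c. \<forall>u. \<forall>\<^sub>F N in sequentially. f (v + (u + moment N)) = c + f (u + moment N)" for v
  proof -
    have "\<forall>\<^sub>F N in sequentially. 0 + moment N \<notin> S \<and> v - moment N \<notin> S"
      using generic_notin_1[OF S] generic_notin_uminus[OF S] by (rule eventually_conj)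
    then obtain M where M: "moment M \<notin> S" "v - moment M \<notin> S"
      using eventually_sequentially_ex by fastforce
    obtain c where c: "\<And>u. \<forall>\<^sub>F N in sequentially. f (moment M + (u + moment N)) = c + f (u + moment N)"
      using H[OF M(1)] by blast
    obtain d where d: "\<And>u. \<forall>\<^sub>F N in sequentially. f (v - moment M + (u + moment N)) = d + f (u + moment N)"
      using H[OF M(2)] by blast
    have "\<forall>\<^sub>F N in sequentially. f (v + (u + moment N)) = (c + d) + f (u + moment N)" for u
      using c[of "v - moment M + u"] d[of u]
      by eventually_elim (simp add: algebra_simps)
    then show ?thesis by blast
  qed
  then obtain c where c: "\<And>v u. \<forall>\<^sub>F N in sequentially. f (v + (u + moment N)) = c v + f (u + moment N)"
    by metis
  \<comment> \<open>Shifting by w and then by v is shifting by v + w; a single N past all three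
    thresholds compares the constants.\<close>
  have "c (v + w) = c v + c w" for v w
  proof -
    have "\<forall>\<^sub>F N in sequentially. c (v + w) = c v + c w"
      using c[of "v + w" 0] c[of v w] c[of w 0]
      by eventually_elim (simp add: algebra_simps)
    then show ?thesis using eventually_sequentially_ex by blast
  qed
  then have "c v = pairing (\<chi> i. c (axis i 1)) v" for v by (rule additive_pairing)
  then show ?thesis using c by metis
qed

text \<open>\<open>S0\<close> collects the exponents about which nothing is known, both as arguments
  and as output exponents of the identity. The standard vectors must stay outside it because they
  fill the test tuples.\<close>

locale homogeneous_derivation =
  fixes f :: "int ^ 'n::finite \<Rightarrow> 'k::field_char_0" and \<sigma> :: "int ^ 'n" and S0 :: "(int ^ 'n) set"
  assumes n: "CARD('n) > 1"
    and S0: "finite S0"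
    and axis_S0: "axis k 1 \<notin> S0"
    and derivation: "(\<And>k. \<beta> k \<notin> S0) \<Longrightarrow> sum \<beta> UNIV - theta + \<sigma> \<notin> S0 \<Longrightarrow> hom_der f \<sigma> \<beta>"
begin

lemma pair_tuple_notin:
  "a \<notin> S0 \<Longrightarrow> b \<notin> S0 \<Longrightarrow> pair_tuple i j a b k \<notin> S0"
  using axis_S0 by (auto simp: pair_tuple_def)

lemma derivation_pair:
  assumes "i \<noteq> j" "a \<notin> S0" "b \<notin> S0" "a + b + pair_rest i j - theta + \<sigma> \<notin> S0"
  shows "hom_der f \<sigma> (pair_tuple i j a b)"
  by (rule derivation) (use assms pair_tuple_notin sum_pair_tuple[OF assms(1)] in auto)

text \<open>With entries 2b and b the determinant is zero, so the left side of the identity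
  vanishes. On the right only the indices i and j remain and give (f(2b) - 2 f(b)) times the minor
  of \<sigma> and b, which is generically nonzero as \<sigma> is.\<close>

lemma doubling:
  assumes "\<sigma> \<noteq> 0"
  shows "\<forall>\<^sub>F N in sequentially. f ((u + moment N) + (u + moment N)) = 2 * f (u + moment N)"
proof -
  obtain i where i: "\<sigma> $ i \<noteq> 0" using assms by (auto simp: vec_eq_iff)
  obtain j where j: "j \<noteq> i" using ex_other_index[OF n] by blast
  show ?thesis
    using generic_bracket_0[where 'k='k, OF j[symmetric] i, of u] generic_notin_1[OF S0, of u]
      generic_notin_double[OF S0, of "u + u"]
      generic_notin_triple[OF S0, of "u + u + u + pair_rest i j - theta + \<sigma>"]
  proof eventually_elim
    case (elim N)
    define b where "b = u + moment N"
    let ?\<beta> = "pair_tuple i j (b + b) b"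
    have hd: "hom_der f \<sigma> ?\<beta>"
      by (rule derivation_pair) (use elim j in \<open>auto simp: b_def algebra_simps\<close>)
    have "idet ?\<beta> = (0 :: 'k)" using j by (simp add: idet_pair_tuple bracket_def algebra_simps)
    then have 0: "(\<Sum>k\<in>UNIV. f (?\<beta> k) * idet (?\<beta>(k := ?\<beta> k + \<sigma>))) = 0"
      using hd by (simp add: hom_der_def)
    \<comment> \<open>For the remaining indices the rows i and j are still proportional.\<close>
    have other: "idet (?\<beta>(k := ?\<beta> k + \<sigma>)) = (0 :: 'k)" if "k \<noteq> i" "k \<noteq> j" for k
      unfolding idet_def
      by (rule rdet_proportional[of i j _ 2]) (use that j in \<open>auto simp: pair_tuple_def vec_eq_iff\<close>)
    have "(\<Sum>k\<in>UNIV. f (?\<beta> k) * idet (?\<beta>(k := ?\<beta> k + \<sigma>))) =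
      (\<Sum>k\<in>{i, j}. f (?\<beta> k) * idet (?\<beta>(k := ?\<beta> k + \<sigma>)))"
      by (rule sum.mono_neutral_right) (use other in auto)
    also have "\<dots> = f (b + b) * idet (?\<beta>(i := b + b + \<sigma>)) + f b * idet (?\<beta>(j := b + \<sigma>))"
      using j by (simp add: pair_tuple_def)
    also have "?\<beta>(i := b + b + \<sigma>) = pair_tuple i j (b + b + \<sigma>) b"
      using j by (auto simp: pair_tuple_def)
    also have "?\<beta>(j := b + \<sigma>) = pair_tuple i j (b + b) (b + \<sigma>)"
      by (auto simp: pair_tuple_def)
    also have "f (b + b) * idet (pair_tuple i j (b + b + \<sigma>) b) + f b * idet (pair_tuple i j (b + b) (b + \<sigma>)) =
      (f (b + b) - 2 * f b) * bracket i j \<sigma> b"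
      using j by (simp add: idet_pair_tuple bracket_def algebra_simps)
    finally have "(f (b + b) - 2 * f b) * bracket i j \<sigma> b = 0"
      using 0 by (rule trans[OF sym])
    then show ?case using elim(1) by (simp add: b_def)
  qed
qed

text \<open>Doubling row j doubles every term of the identity except the j-th. By f(2b) = 2 f(b) the
  j-th term exceeds twice its old value by 2 f(b) det(\<beta>); cancelling twice the determinant
  leaves additivity.\<close>

lemma add_step:
  assumes b: "f (\<beta> j + \<beta> j) = 2 * f (\<beta> j)" and D: "idet \<beta> \<noteq> (0 :: 'k)"
    and 1: "hom_der f \<sigma> \<beta>" and 2: "hom_der f \<sigma> (\<beta>(j := \<beta> j + \<beta> j))"
  shows "f (sum \<beta> UNIV + \<beta> j - theta) = f (sum \<beta> UNIV - theta) + f (\<beta> j)"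
proof -
  define b where "b = \<beta> j"
  define D :: 'k where "D = idet \<beta>"
  define T where "T k = f (\<beta> k) * idet (\<beta>(k := \<beta> k + \<sigma>))" for k
  let ?\<beta> = "\<beta>(j := b + b)"
  define T' where "T' k = f (?\<beta> k) * idet (?\<beta>(k := ?\<beta> k + \<sigma>))" for k
  have idb: "idet (\<beta>(j := b)) = D" by (simp add: b_def D_def)
  have "f (sum \<beta> UNIV - theta) * D = sum T UNIV"
    using 1 by (simp add: hom_der_def D_def T_def)
  then have e1: "f (sum \<beta> UNIV - theta) * D = T j + sum T (UNIV - {j})"
    using sum.remove[of UNIV j T] by simp
  have "sum ?\<beta> UNIV = sum \<beta> UNIV + b" unfolding sum_fun_upd by (simp add: b_def)
  moreover have "idet ?\<beta> = 2 * D" unfolding idb[symmetric] by (rule idet_double)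
  moreover note idet_upd = calculation(2)
  ultimately have "f (sum \<beta> UNIV + b - theta) * (2 * D) = sum T' UNIV"
    using 2 unfolding hom_der_def T'_def b_def[symmetric] by simp
  then have e2: "f (sum \<beta> UNIV + b - theta) * (2 * D) = T' j + sum T' (UNIV - {j})"
    using sum.remove[of UNIV j T'] by simp
  have "T' k = 2 * T k" if "k \<noteq> j" for k
  proof -
    have "?\<beta>(k := ?\<beta> k + \<sigma>) = (\<beta>(k := \<beta> k + \<sigma>))(j := b + b)" using that by auto
    then have "idet (?\<beta>(k := ?\<beta> k + \<sigma>)) = 2 * (idet ((\<beta>(k := \<beta> k + \<sigma>))(j := b)) :: 'k)"
      using idet_double by metis
    also have "(\<beta>(k := \<beta> k + \<sigma>))(j := b) = \<beta>(k := \<beta> k + \<sigma>)" using that by (auto simp: b_def)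
    finally have e: "idet (?\<beta>(k := ?\<beta> k + \<sigma>)) = 2 * (idet (\<beta>(k := \<beta> k + \<sigma>)) :: 'k)" .
    show ?thesis unfolding T_def T'_def e using that by simp
  qed
  then have v1: "sum T' (UNIV - {j}) = 2 * sum T (UNIV - {j})"
    by (simp add: sum_distrib_left)
  have v2: "T j = f b * (D + idet (\<beta>(j := \<sigma>)))"
    by (simp add: T_def b_def[symmetric] idet_add idb)
  have v3: "T' j = 2 * f b * (2 * D + idet (\<beta>(j := \<sigma>)))"
    using b idet_upd by (simp add: T'_def b_def[symmetric] idet_add)
  have "2 * D * f (sum \<beta> UNIV + b - theta) = T' j + sum T' (UNIV - {j})"
    using e2 by (simp add: mult_ac)
  also have "\<dots> = 2 * (T j + sum T (UNIV - {j})) + 2 * D * f b"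
    unfolding v1 v2 v3 by (simp add: algebra_simps)
  also have "\<dots> = 2 * D * (f (sum \<beta> UNIV - theta) + f b)"
    unfolding e1[symmetric] by (simp add: algebra_simps)
  finally have "2 * D * f (sum \<beta> UNIV + b - theta) = 2 * D * (f (sum \<beta> UNIV - theta) + f b)" .
  then show ?thesis using D by (simp add: D_def b_def)
qed

definition exceptional where "exceptional = insert (- theta) ((\<lambda>s. s - \<sigma>) ` S0)"

lemma exceptional_iff: "v \<notin> exceptional \<longleftrightarrow> v \<noteq> - theta \<and> v + \<sigma> \<notin> S0"
proof -
  have "v \<in> (\<lambda>s. s - \<sigma>) ` S0 \<longleftrightarrow> v + \<sigma> \<in> S0"
    by (auto simp: image_iff intro!: bexI[of _ "v + \<sigma>"])
  then show ?thesis by (auto simp: exceptional_def)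
qed

lemma finite_exceptional: "finite exceptional"
  using S0 by (simp add: exceptional_def)

lemma shift_index:
  fixes v :: "int ^ 'n"
  assumes "v \<noteq> - theta"
  obtains i j where "i \<noteq> j" "(v + theta) $ i \<noteq> 0"
proof -
  have "v + theta \<noteq> 0" using assms by (simp add: add_eq_0_iff2)
  then obtain i where "(v + theta) $ i \<noteq> 0" by (auto simp: vec_eq_iff)
  moreover obtain j where "j \<noteq> i" using ex_other_index[OF n] by blast
  ultimately show ?thesis using that[of i j] by simp
qed

text \<open>The entry beside b is chosen so that the tuple sums to v + \<theta>; the left side of
  the identity then concerns f(v), and \<open>add_step\<close> compares it with f(v + b). The
  determinant is the minor of v + \<theta> and b, generically nonzero because v is not
  -\<theta>.\<close>

lemma shift_nonzero:
  assumes \<sigma>: "\<sigma> \<noteq> 0" and v: "v \<notin> exceptional"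
  shows "\<forall>\<^sub>F N in sequentially. f (v + (u + moment N)) = f v + f (u + moment N)"
proof -
  have v: "v \<noteq> - theta" "v + \<sigma> \<notin> S0" using v by (auto simp: exceptional_iff)
  obtain i j where ij: "i \<noteq> j" "(v + theta) $ i \<noteq> 0" using shift_index[OF v(1)] .
  show ?thesis
    using doubling[OF \<sigma>, of u] generic_bracket_0[where 'k='k, OF ij, of u]
      generic_notin_1[OF S0, of u] generic_notin_double[OF S0, of "u + u"]
      generic_notin_uminus[OF S0, of "v + theta - u - pair_rest i j"]
      generic_notin_1[OF S0, of "v + u + \<sigma>"]
  proof eventually_elim
    case (elim N)
    define b where "b = u + moment N"
    define \<beta> where "\<beta> = pair_tuple i j (v + theta - b - pair_rest i j) b"
    have \<beta>j: "\<beta> j = b" by (simp add: \<beta>_def pair_tuple_def)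
    have sum: "sum \<beta> UNIV = v + theta" unfolding \<beta>_def sum_pair_tuple[OF ij(1)] by simp
    have upd: "\<beta>(j := b + b) = pair_tuple i j (v + theta - b - pair_rest i j) (b + b)"
      by (auto simp: \<beta>_def pair_tuple_def)
    have "f (sum \<beta> UNIV + \<beta> j - theta) = f (sum \<beta> UNIV - theta) + f (\<beta> j)"
    proof (rule add_step)
      show "f (\<beta> j + \<beta> j) = 2 * f (\<beta> j)" using elim by (simp add: \<beta>j b_def)
      show "idet \<beta> \<noteq> (0 :: 'k)"
        unfolding \<beta>_def idet_pair_tuple[OF ij(1)] bracket_rest(1)[OF ij(1)] b_def by (rule elim(2))
      show "hom_der f \<sigma> \<beta>"
        unfolding \<beta>_def by (rule derivation_pair) (use elim ij v in \<open>auto simp: b_def algebra_simps\<close>)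
      show "hom_der f \<sigma> (\<beta>(j := \<beta> j + \<beta> j))"
        unfolding \<beta>j upd by (rule derivation_pair) (use elim ij v in \<open>auto simp: b_def algebra_simps\<close>)
    qed
    then show ?case unfolding sum \<beta>j by (simp add: b_def algebra_simps)
  qed
qed

text \<open>In degree 0 all determinants of the identity coincide and cancel, leaving a plain sum of
  values of f.\<close>

lemma degree_zero_pair:
  assumes "\<sigma> = 0" "i \<noteq> j" "a - pair_rest i j \<notin> S0" "b \<notin> S0" "a + b - theta \<notin> S0"
    and "bracket i j a b \<noteq> (0 :: 'k)"
  shows "f (a + b - theta) = f (a - pair_rest i j) + f b + (\<Sum>k\<in>UNIV - {i, j}. f (axis k 1))"
proof -
  let ?\<beta> = "pair_tuple i j (a - pair_rest i j) b"
  have D: "idet ?\<beta> \<noteq> (0 :: 'k)" using assms by (simp add: idet_pair_tuple bracket_rest)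
  have "hom_der f \<sigma> ?\<beta>" by (rule derivation_pair) (use assms in \<open>auto simp: algebra_simps\<close>)
  then have "f (sum ?\<beta> UNIV - theta) * idet ?\<beta> = (\<Sum>k\<in>UNIV. f (?\<beta> k) * idet ?\<beta>)"
    unfolding hom_der_def assms(1) by simp
  then have "f (sum ?\<beta> UNIV - theta) = (\<Sum>k\<in>UNIV. f (?\<beta> k))"
    using D by (simp add: sum_distrib_right[symmetric])
  also have "\<dots> = f (?\<beta> i) + (f (?\<beta> j) + (\<Sum>k\<in>UNIV - {i} - {j}. f (?\<beta> k)))"
    using assms(2) by (subst sum.remove[of _ i], simp_all, subst sum.remove[of _ j], simp_all)
  also have "(\<Sum>k\<in>UNIV - {i} - {j}. f (?\<beta> k)) = (\<Sum>k\<in>UNIV - {i, j}. f (axis k 1))"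
    by (rule sum.cong) (auto simp: pair_tuple_def)
  finally show ?thesis
    unfolding sum_pair_tuple[OF assms(2)] using assms(2) by (simp add: pair_tuple_def algebra_simps)
qed

lemma shift_zero:
  assumes \<sigma>: "\<sigma> = 0" and ij: "i \<noteq> j" "(v + theta) $ i \<noteq> 0" "v + theta - pair_rest i j \<notin> S0"
  shows "\<forall>\<^sub>F N in sequentially. f (v + (u + moment N)) =
    (f (v + theta - pair_rest i j) + (\<Sum>k\<in>UNIV - {i, j}. f (axis k 1))) + f (u + moment N)"
  using generic_bracket_0[where 'k='k, OF ij(1,2), of u]
    generic_notin_1[OF S0, of u] generic_notin_1[OF S0, of "v + u"]
proof eventually_elim
  case (elim N)
  have "v + theta + (u + moment N) - theta = v + (u + moment N)" by simp
  then show ?case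
    using degree_zero_pair[OF \<sigma> ij(1), of "v + theta" "u + moment N"] ij elim
    by (simp add: algebra_simps)
qed

lemma ex_affine:
  "\<exists>l k. (\<forall>v. v \<notin> exceptional \<longrightarrow> f v = pairing l v + k) \<and> (\<sigma> \<noteq> 0 \<longrightarrow> k = 0)"
proof (cases "\<sigma> = 0")
  case False
  have "\<exists>l. \<forall>v u. \<forall>\<^sub>F N in sequentially. f (v + (u + moment N)) = pairing l v + f (u + moment N)"
    by (rule generic_additive_extension[OF finite_exceptional]) (use shift_nonzero[OF False] in blast)
  then obtain l where l: "\<And>v u. \<forall>\<^sub>F N in sequentially. f (v + (u + moment N)) = pairing l v + f (u + moment N)"
    by blast
  \<comment> \<open>The value at v + \<open>moment N\<close> has two descriptions, one with
    \<lambda>(v) and one with f(v).\<close>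
  have "f v = pairing l v + 0" if "v \<notin> exceptional" for v
  proof -
    have "\<forall>\<^sub>F N in sequentially. f v = pairing l v + 0"
      using l[of v 0] shift_nonzero[OF False that, of 0] by eventually_elim auto
    then show ?thesis using eventually_sequentially_ex by blast
  qed
  then show ?thesis by blast
next
  case True
  \<comment> \<open>The index pair depends on v, so every v is excluded for which some pair would
    put the first entry of the test tuple into \<open>S0\<close>.\<close>
  define X where "X = insert (- theta) (\<Union>s\<in>S0. \<Union>i. \<Union>j. {s - theta + pair_rest i j})"
  have "finite X" using S0 by (auto simp: X_def)
  moreover have "\<exists>c. \<forall>u. \<forall>\<^sub>F N in sequentially. f (v + (u + moment N)) = c + f (u + moment N)"
    if v: "v \<notin> X" for v
  proof -
    obtain i j where ij: "i \<noteq> j" "(v + theta) $ i \<noteq> 0" using shift_index[of v] v by (auto simp: X_def)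
    have "v + theta - pair_rest i j \<notin> S0"
    proof
      assume "v + theta - pair_rest i j \<in> S0"
      then have "(v + theta - pair_rest i j) - theta + pair_rest i j \<in> X" unfolding X_def by blast
      then show False using v by simp
    qed
    then show ?thesis using shift_zero[OF True ij] by blast
  qed
  ultimately have "\<exists>l. \<forall>v u. \<forall>\<^sub>F N in sequentially. f (v + (u + moment N)) = pairing l v + f (u + moment N)"
    by (rule generic_additive_extension)
  then obtain l where l: "\<And>v u. \<forall>\<^sub>F N in sequentially. f (v + (u + moment N)) = pairing l v + f (u + moment N)"
    by blast
  \<comment> \<open>The difference f - \<lambda> is compared with its value at m =
    \<open>moment N\<close>, which does not involve v. Entries built from \<theta> - m and v + m
    express f(v) by f(v + m), and the remaining terms turn out to be -\<lambda>(m).\<close>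
  have const: "\<forall>\<^sub>F N in sequentially. f v - pairing l v = f (moment N) - pairing l (moment N)"
    if "v \<notin> exceptional" for v
  proof -
    have v: "v \<noteq> - theta" "v \<notin> S0" using that[unfolded exceptional_iff] True by auto
    obtain i j where ij: "i \<noteq> j" "(v + theta) $ i \<noteq> 0" using shift_index[OF v(1)] .
    \<comment> \<open>This is the nonvanishing premise of \<open>shift_zero\<close> for the shift by
      -\<open>moment N\<close>.\<close>
    have inf: "\<forall>\<^sub>F N in sequentially. of_int ((theta - moment N) $ i) \<noteq> (0 :: rat)"
    proof -
      have a: "axis i (-1) \<noteq> (0 :: rat ^ 'n)" by (simp add: axis_eq_0_iff)
      have "pairing (axis i (-1) :: rat ^ 'n) (moment N) = - of_int (moment N $ i)" for N
        by (simp add: pairing_def axis_def if_distrib[of "\<lambda>x. x * _"] cong: if_cong)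
      then show ?thesis using generic_affine[OF a, of 1] by (simp add: theta_def)
    qed
    have e1: "bracket i j (theta - w) (v + w) = (bracket i j theta v + bracket i j (v + theta) w :: 'k)" for w
      by (simp add: bracket_def algebra_simps)
    show ?thesis
      using inf generic_bracket[OF ij, of "bracket i j theta v :: 'k" 0]
        generic_notin_uminus[OF S0, of "theta - pair_rest i j"] generic_notin_1[OF S0, of v]
        l[of v 0]
    proof eventually_elim
      case (elim N)
      have 1: "f v = f (theta - moment N - pair_rest i j) + f (v + moment N) + (\<Sum>k\<in>UNIV - {i, j}. f (axis k 1))"
        using degree_zero_pair[OF True ij(1), of "theta - moment N" "v + moment N"] elim v
        unfolding e1 by (simp add: algebra_simps)
      \<comment> \<open>The same remaining terms are the shift constant of -\<open>moment N\<close>,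
        which must agree with the linear form at that vector.\<close>
      have "\<forall>\<^sub>F M in sequentially. f (- moment N + (0 + moment M)) =
          (f (- moment N + theta - pair_rest i j) + (\<Sum>k\<in>UNIV - {i, j}. f (axis k 1))) + f (0 + moment M)"
        by (rule shift_zero[OF True ij(1)]) (use elim in \<open>auto simp: algebra_simps\<close>)
      with l[of "- moment N" 0] have "\<forall>\<^sub>F M in sequentially. pairing l (- moment N) =
          f (- moment N + theta - pair_rest i j) + (\<Sum>k\<in>UNIV - {i, j}. f (axis k 1))"
        by eventually_elim auto
      then have "- pairing l (moment N) =
          f (- moment N + theta - pair_rest i j) + (\<Sum>k\<in>UNIV - {i, j}. f (axis k 1))"
        using eventually_sequentially_ex by fastforce
      also have "- moment N + theta - pair_rest i j = theta - moment N - pair_rest i j" by simp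
      finally have "pairing l (moment N) =
          - (f (theta - moment N - pair_rest i j) + (\<Sum>k\<in>UNIV - {i, j}. f (axis k 1)))"
        by (metis minus_minus)
      then show ?case unfolding 1 using elim(5) by simp
    qed
  qed
  obtain v0 where v0: "v0 \<notin> exceptional"
    using eventually_sequentially_ex[OF generic_notin_1[OF finite_exceptional, of 0]] by blast
  have "f v = pairing l v + (f v0 - pairing l v0)" if "v \<notin> exceptional" for v
  proof -
    have "\<forall>\<^sub>F N in sequentially. f v - pairing l v = f v0 - pairing l v0"
      using const[OF that] const[OF v0] by eventually_elim simp
    then have "f v - pairing l v = f v0 - pairing l v0" using eventually_sequentially_ex by blast
    then show ?thesis by (simp add: algebra_simps)
  qed
  then show ?thesis using True by blast
qed

text \<open>\<open>ex_affine\<close> gives the affine shape; one nondegenerate tuple avoiding all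
  exceptional exponents then forces the relation between \<open>l\<close> and \<open>k\<close> by
  \<open>affine_sum\<close>.\<close>

theorem classification:
  obtains l k where "\<And>v. v \<noteq> - theta \<Longrightarrow> v + \<sigma> \<notin> S0 \<Longrightarrow> f v = pairing l v + k"
    "\<sigma> \<noteq> 0 \<Longrightarrow> k = 0" "pairing l (\<sigma> + theta) = (1 - of_nat CARD('n)) * k"
proof -
  obtain l k where lk: "\<And>v. v \<notin> exceptional \<Longrightarrow> f v = pairing l v + k" "\<sigma> \<noteq> 0 \<Longrightarrow> k = 0"
    using ex_affine by blast
  \<comment> \<open>An arithmetic progression with nonzero difference meets a finite set only
    finitely often.\<close>
  have ev: "\<forall>\<^sub>F t in sequentially. a + int t *s w \<notin> S" if "finite S" "w \<noteq> 0" for a w and S :: "(int ^ 'n) set"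
  proof -
    have "inj (\<lambda>t. a + int t *s w)" using that(2) by (auto simp: inj_def vec_eq_iff)
    then have "finite ((\<lambda>t. a + int t *s w) -` S)" using finite_vimageI that(1) by blast
    then show ?thesis
      unfolding cofinite_eq_sequentially[symmetric] eventually_cofinite by (simp add: vimage_def)
  qed
  let ?S = "exceptional \<union> S0"
  have fin: "finite ?S" using finite_exceptional S0 by simp
  have ax: "axis k 1 \<noteq> (0 :: int ^ 'n)" for k :: 'n by (simp add: axis_eq_0_iff)
  have th: "theta \<noteq> (0 :: int ^ 'n)" by (simp add: theta_def vec_eq_iff)
  have "\<forall>\<^sub>F t in sequentially. \<forall>k::'n\<in>UNIV. 0 + int t *s axis k 1 \<notin> ?S"
    by (rule eventually_ball_finite) (use ev[OF fin ax, of 0] in simp_all)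
  moreover have "\<forall>\<^sub>F t in sequentially. - theta + int t *s theta \<notin> ?S"
    using ev[OF fin th] .
  moreover have "\<forall>\<^sub>F t in sequentially. \<sigma> - theta + int t *s theta \<notin> ?S"
    using ev[OF fin th] .
  moreover have "\<forall>\<^sub>F t::nat in sequentially. t > 0" by (rule eventually_gt_at_top)
  ultimately have "\<forall>\<^sub>F t in sequentially. (\<forall>k::'n. int t *s axis k 1 \<notin> ?S) \<and>
    - theta + int t *s theta \<notin> ?S \<and> \<sigma> - theta + int t *s theta \<notin> ?S \<and> t > 0"
    by eventually_elim auto
  then obtain t where t: "\<And>k::'n. int t *s axis k 1 \<notin> ?S" "- theta + int t *s theta \<notin> ?S"
    "\<sigma> - theta + int t *s theta \<notin> ?S" "t > 0"
    using eventually_sequentially_ex by blast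
  \<comment> \<open>Multiples of the standard vectors are used because the standard vectors
    themselves may be exceptional; the determinant is t^n.\<close>
  define \<beta> where "\<beta> k = int t *s axis k 1" for k :: 'n
  have sum: "sum \<beta> UNIV = int t *s theta"
    by (simp add: \<beta>_def vec_eq_iff theta_def axis_def if_distrib[of "(*) _"] cong: if_cong)
  have "idet \<beta> = (of_nat t :: 'k) ^ CARD('n)"
    unfolding idet_def rdet_def
    by (subst det_diagonal) (auto simp: \<beta>_def axis_def)
  then have D: "idet \<beta> \<noteq> (0 :: 'k)" using t(4) by simp
  have hd: "hom_der f \<sigma> \<beta>"
  proof (rule derivation)
    show "\<beta> k \<notin> S0" for k using t(1) by (simp add: \<beta>_def)
    have *: "sum \<beta> UNIV - theta + \<sigma> = \<sigma> - theta + int t *s theta" unfolding sum by simp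
    show "sum \<beta> UNIV - theta + \<sigma> \<notin> S0" unfolding * using t(3) by blast
  qed
  have "f (- theta + int t *s theta) * idet \<beta> = (\<Sum>k\<in>UNIV. f (\<beta> k) * idet (\<beta>(k := \<beta> k + \<sigma>)))"
    using hd unfolding hom_der_def sum by (simp add: algebra_simps)
  also have "\<dots> = (\<Sum>i\<in>UNIV. (pairing l (\<beta> i) + k) * idet (\<beta>(i := \<beta> i + \<sigma>)))"
    by (rule sum.cong) (use t lk(1) in \<open>auto simp: \<beta>_def\<close>)
  also have "\<dots> = (pairing l (sum \<beta> UNIV) + of_nat CARD('n) * k + pairing l \<sigma>) * idet \<beta>"
    by (rule affine_sum) (rule lk(2))
  finally have "f (- theta + int t *s theta) = pairing l (int t *s theta) + of_nat CARD('n) * k + pairing l \<sigma>"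
    using D unfolding sum by simp
  then have "pairing l (\<sigma> + theta) = (1 - of_nat CARD('n)) * k"
    using lk(1)[of "- theta + int t *s theta"] t(2) by (simp add: algebra_simps)
  with lk show thesis by (intro that[of l k]) (auto simp: exceptional_iff)
qed

end

text \<open>With no exponent excluded only the value at -\<theta> escapes the affine description. A
  tuple containing -\<theta> shows that this value is free only in degree \<theta>.\<close>

lemma classification_full:
  fixes f :: "int ^ 'n::finite \<Rightarrow> 'k::field_char_0"
  assumes n: "CARD('n) > 1" and hd: "\<And>\<beta>. hom_der f \<sigma> \<beta>"
  obtains l k z where "\<And>v. f v = pairing l v + k + (if v = - theta then z else 0)"
    "\<sigma> \<noteq> 0 \<Longrightarrow> k = 0" "pairing l (\<sigma> + theta) = (1 - of_nat CARD('n)) * k" "\<sigma> \<noteq> theta \<Longrightarrow> z = 0"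
proof -
  interpret homogeneous_derivation f \<sigma> "{}"
    by unfold_locales (use n hd in auto)
  obtain l k where lk: "\<And>v. v \<noteq> - theta \<Longrightarrow> f v = pairing l v + k"
    "\<sigma> \<noteq> 0 \<Longrightarrow> k = 0" "pairing l (\<sigma> + theta) = (1 - of_nat CARD('n)) * k"
    using classification by (metis empty_iff)
  define z where "z = f (- theta) - (pairing l (- theta) + k)"
  have fz: "f v = pairing l v + k + (if v = - theta then z else 0)" for v
    using lk(1) by (simp add: z_def)
  have "z = 0" if \<sigma>: "\<sigma> \<noteq> theta"
  proof -
    have "\<sigma> - theta \<noteq> 0" using \<sigma> by simp
    then obtain j where j: "(\<sigma> - theta) $ j \<noteq> 0" by (auto simp: vec_eq_iff)
    \<comment> \<open>The entry -\<theta> occurs once, and the sum of the tuple is minus a standard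
      vector, so the left side does not involve the free value.\<close>
    define \<beta> where "\<beta> = (\<lambda>k::'n. axis k 1)(j := - theta)"
    have sum: "sum \<beta> UNIV - theta \<noteq> - theta"
    proof -
      have "sum \<beta> UNIV = - axis j 1" unfolding \<beta>_def sum_fun_upd sum_axis by simp
      then show ?thesis by (simp add: axis_eq_0_iff)
    qed
    have ax: "axis k 1 \<noteq> (- theta :: int ^ 'n)" for k
    proof
      assume *: "axis k 1 = (- theta :: int ^ 'n)"
      have "axis k 1 $ k = (- theta :: int ^ 'n) $ k" unfolding * ..
      then show False by (simp add: theta_def)
    qed
    have hf: "f (sum \<beta> UNIV - theta) * idet \<beta> = (\<Sum>k\<in>UNIV. f (\<beta> k) * idet (\<beta>(k := \<beta> k + \<sigma>)))"
      using hd[of \<beta>] by (simp add: hom_der_def)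
    have ha: "(pairing l (sum \<beta> UNIV - theta) + k) * idet \<beta> =
        (\<Sum>i\<in>UNIV. (pairing l (\<beta> i) + k) * idet (\<beta>(i := \<beta> i + \<sigma>)))"
      using hom_der_affine[of \<sigma> k l \<beta>] lk(2,3) by (auto simp: hom_der_def)
    \<comment> \<open>Subtracting the identity of the affine part isolates the defect z, multiplied
      by the determinant of the tuple whose j-th row is \<sigma> - \<theta>.\<close>
    have "0 = (\<Sum>i\<in>UNIV. (f (\<beta> i) - (pairing l (\<beta> i) + k)) * idet (\<beta>(i := \<beta> i + \<sigma>)))"
      using hf ha lk(1)[OF sum] by (simp add: left_diff_distrib sum_subtractf)
    also have "\<dots> = (\<Sum>i\<in>UNIV. if i = j then z * of_int ((\<sigma> - theta) $ j) else 0)"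
    proof (rule sum.cong)
      fix i :: 'n
      have "\<beta>(j := - theta + \<sigma>) = (\<lambda>k::'n. axis k 1)(j := \<sigma> - theta)" by (auto simp: \<beta>_def)
      then have "idet (\<beta>(j := - theta + \<sigma>)) = (of_int ((\<sigma> - theta) $ j) :: 'k)"
        by (simp only: idet_axis_upd)
      moreover have "\<beta> j = - theta" "i \<noteq> j \<Longrightarrow> \<beta> i = axis i 1" by (auto simp: \<beta>_def)
      ultimately show "(f (\<beta> i) - (pairing l (\<beta> i) + k)) * idet (\<beta>(i := \<beta> i + \<sigma>)) =
        (if i = j then z * of_int ((\<sigma> - theta) $ j) else 0)"
        using ax[of i] fz by auto
    qed simp
    also have "\<dots> = z * of_int ((\<sigma> - theta) $ j)" by simp
    finally show ?thesis using j by simp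
  qed
  with fz lk(2,3) show thesis using that by blast
qed

subsection \<open>The space of Laurent polynomials\<close>

abbreviation coef :: "('a \<Rightarrow>\<^sub>0 'b::zero) \<Rightarrow> 'a \<Rightarrow> 'b" where
  "coef \<equiv> Poly_Mapping.lookup"

abbreviation supp :: "('a \<Rightarrow>\<^sub>0 'b::zero) \<Rightarrow> 'a set" where
  "supp \<equiv> Poly_Mapping.keys"

lemma lookup_single_mult:
  fixes u :: "'a::comm_monoid_add \<Rightarrow>\<^sub>0 'k::field"
  shows "coef (Poly_Mapping.single 0 c * u) g = c * coef u g"
proof -
  have "coef (Poly_Mapping.map ((*) c) u) g = c * coef u g"
    by (simp add: Poly_Mapping.map.rep_eq when_def)
  then show ?thesis unfolding mult_map_scale_conv_mult .
qed

lemma lookup_lscale [simp]: "coef (lscale c u) g = c * coef u g"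
  by (simp add: lscale_def lookup_single_mult)

lemma lookup_single_if: "coef (Poly_Mapping.single a c) b = (if a = b then c else 0)"
  by (simp add: lookup_single when_def)

lemma lookup_xpow: "coef (xpow a) b = (if a = b then 1 else 0)"
  by (simp add: xpow_def lookup_single_if)

lemma lscale_simps [simp]:
  "lscale c (u + v) = lscale c u + lscale c v" "lscale c (u - v) = lscale c u - lscale c v"
  "lscale (c + d) u = lscale c u + lscale d u" "lscale (c * d) u = lscale c (lscale d u)"
  "lscale 1 u = u" "lscale 0 u = 0" "lscale c 0 = 0" "lscale (- 1) u = - u"
  by (rule poly_mapping_eqI; simp add: lookup_add lookup_minus algebra_simps)+

lemma lscale_sum: "lscale c (sum g A) = (\<Sum>a\<in>A. lscale c (g a))"
  by (induction A rule: infinite_finite_induct) simp_all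

lemma lscale_single: "lscale c (Poly_Mapping.single a d) = Poly_Mapping.single a (c * d)"
  by (rule poly_mapping_eqI) (simp add: lookup_single_if)

lemma single_eq_lscale: "Poly_Mapping.single a c = lscale c (xpow a)"
  by (simp add: xpow_def lscale_single)

lemma lscale_mult: "lscale c u * v = lscale c (u * v)" "u * lscale c v = lscale c (u * v)"
  by (simp_all add: lscale_def ac_simps)

lemma xpow_mult: "xpow a * xpow b = xpow (a + b)"
  by (simp add: xpow_def mult_single)

lemma xpow_0: "xpow 0 = 1"
  by (simp add: xpow_def)

lemma laurent_expand: "u = (\<Sum>g\<in>supp u. lscale (coef u g) (xpow g))"
proof (rule poly_mapping_eqI)
  fix h
  have "coef (\<Sum>g\<in>supp u. lscale (coef u g) (xpow g)) h = (\<Sum>g\<in>supp u. if g = h then coef u h else 0)"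
    by (simp add: lookup_sum lookup_xpow if_distrib cong: if_cong)
  also have "\<dots> = coef u h" by (simp add: in_keys_iff)
  finally show "coef u h = coef (\<Sum>g\<in>supp u. lscale (coef u g) (xpow g)) h" by simp
qed

lemma laurent_induct [case_names xpow add scale]:
  assumes "\<And>a. P (xpow a)" "\<And>u v. P u \<Longrightarrow> P v \<Longrightarrow> P (u + v)" "\<And>c u. P u \<Longrightarrow> P (lscale c u)"
  shows "P u"
proof -
  have P0: "P 0" using assms(3)[OF assms(1)[of 0], of 0] by simp
  have "P (\<Sum>g\<in>A. lscale (coef u g) (xpow g))" for A
    by (induction A rule: infinite_finite_induct) (use assms P0 in auto)
  then show ?thesis by (subst laurent_expand)
qed

lemma laurent_space_simps [simp]:
  "carrier laurent_space = UNIV" "u \<oplus>\<^bsub>laurent_space\<^esub> v = u + v" "c \<odot>\<^bsub>laurent_space\<^esub> u = lscale c u"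
  "\<zero>\<^bsub>laurent_space\<^esub> = 0" "u \<otimes>\<^bsub>laurent_space\<^esub> v = u * v"
  by (simp_all add: laurent_space_def type_space_def)

lemma vec_space_type_space:
  fixes s :: "'k::field \<Rightarrow> 'v::ring_1 \<Rightarrow> 'v"
  assumes "\<And>c u v. s c (u + v) = s c u + s c v" "\<And>c d u. s (c + d) u = s c u + s d u"
    "\<And>c d u. s (c * d) u = s c (s d u)" "\<And>u. s 1 u = u"
  shows "vec_space (type_space s)"
proof (rule moduleI)
  show "abelian_group (type_space s)"
  proof (rule abelian_groupI)
    fix x assume "x \<in> carrier (type_space s)"
    show "\<exists>y\<in>carrier (type_space s). y \<oplus>\<^bsub>type_space s\<^esub> x = \<zero>\<^bsub>type_space s\<^esub>"
      by (rule bexI[of _ "- x"]) (auto simp: type_space_def)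
  qed (auto simp: type_space_def ac_simps)
qed (use assms cring_scalars in \<open>auto simp: type_space_def\<close>)

lemma vec_space_laurent: "vec_space laurent_space"
  unfolding laurent_space_def by (rule vec_space_type_space) auto

interpretation laurent: vspace laurent_space
  by (rule vspace.intro) (rule vec_space_laurent)

lemma finsum_laurent [simp]: "finsum laurent_space f A = sum f A"
  by (induction A rule: infinite_finite_induct) simp_all

subsection \<open>The Jacobian\<close>

lemma lookup_part_deriv: "coef (part_deriv i u) g = of_int (g $ i + 1) * coef u (g + axis i 1)"
proof -
  have "coef (part_deriv i u) g = (\<Sum>a\<in>supp u. if a - axis i 1 = g then of_int (a $ i) * coef u a else 0)"
    by (simp add: part_deriv_def lookup_sum lookup_single_if)
  also have "\<dots> = (\<Sum>a\<in>supp u. if a = g + axis i 1 then of_int (a $ i) * coef u a else 0)"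
    by (rule sum.cong) (auto simp: algebra_simps)
  also have "\<dots> = of_int ((g + axis i 1) $ i) * coef u (g + axis i 1)"
    by (simp add: in_keys_iff)
  finally show ?thesis by (simp add: axis_def)
qed

lemma part_deriv_linear:
  "part_deriv i (u + v) = part_deriv i u + part_deriv i v" "part_deriv i (lscale c u) = lscale c (part_deriv i u)"
  by (rule poly_mapping_eqI; simp add: lookup_add lookup_part_deriv algebra_simps)+

lemma part_deriv_xpow: "part_deriv i (xpow a) = Poly_Mapping.single (a - axis i 1) (of_int (a $ i))"
  by (simp add: part_deriv_def xpow_def)

text \<open>\<open>Jac\<close> has its arguments as columns; transposing makes the row lemmas of the
  determinant library applicable.\<close>

lemma Jac_rows: "Jac u = det (\<chi> j. (\<chi> i. part_deriv i (u j)))"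
proof -
  have "(\<chi> i j. part_deriv i (u j)) = transpose (\<chi> j. (\<chi> i. part_deriv i (u j)))"
    by (simp add: vec_eq_iff transpose_def)
  then show ?thesis unfolding Jac_def by (simp only: det_transpose)
qed

lemma Jac_rows_upd: "Jac (u(k := z)) =
    det (\<chi> j. if j = k then (\<chi> i. part_deriv i z) else (\<chi> i. part_deriv i (u j)))"
  unfolding Jac_rows by (rule arg_cong[of _ _ det]) (simp add: vec_eq_iff)

lemma Jac_add: "Jac (u(k := x + y)) = Jac (u(k := x)) + Jac (u(k := y))"
proof -
  have *: "(\<chi> i. part_deriv i (x + y)) = (\<chi> i. part_deriv i x) + (\<chi> i. part_deriv i y)"
    by (simp add: vec_eq_iff part_deriv_linear)
  show ?thesis unfolding Jac_rows_upd * by (rule det_row_add)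
qed

lemma Jac_lscale: "Jac (u(k := lscale c x)) = lscale c (Jac (u(k := x)))"
proof -
  have *: "(\<chi> i. part_deriv i (lscale c x)) = Poly_Mapping.single 0 c *s (\<chi> i. part_deriv i x)"
    unfolding part_deriv_linear by (simp add: vec_eq_iff lscale_def)
  show ?thesis unfolding Jac_rows_upd * det_row_mul by (simp add: lscale_def)
qed

lemma Jac_permute:
  fixes u :: "'n::finite \<Rightarrow> ('k::field, 'n) laurent"
  assumes "p permutes UNIV"
  shows "Jac (u \<circ> p) = lscale (of_int (sign p)) (Jac u)"
  unfolding Jac_rows
  using det_permute_rows[OF assms, of "\<chi> j. (\<chi> i. part_deriv i (u j))"]
  by (simp add: lscale_def single_of_int)

lemma prod_single:
  "(\<Prod>i\<in>A. Poly_Mapping.single (a i) (c i)) =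
    Poly_Mapping.single (\<Sum>i\<in>A. a i :: 'a::comm_monoid_add) (\<Prod>i\<in>A. c i :: 'k::comm_ring_1)"
  by (induction A rule: infinite_finite_induct) (simp_all add: mult_single)

lemma sum_single: "(\<Sum>i\<in>A. Poly_Mapping.single a (c i)) = Poly_Mapping.single a (\<Sum>i\<in>A. c i)"
  by (induction A rule: infinite_finite_induct) (simp_all add: single_add)

text \<open>Every permutation term of the determinant is a monomial with the same exponent, because
  each row is used once and each partial derivative lowers one coordinate. The coefficients add up
  to the determinant of the exponents.\<close>

lemma Jac_xpow:
  fixes \<beta> :: "'n::finite \<Rightarrow> int ^ 'n"
  shows "Jac (\<lambda>k. xpow (\<beta> k) :: ('k::field, 'n) laurent) = Poly_Mapping.single (sum \<beta> UNIV - theta) (idet \<beta>)"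
proof -
  have e: "(\<Sum>i\<in>UNIV. \<beta> (p i) - axis i 1) = sum \<beta> UNIV - theta" if "p permutes UNIV" for p
    by (simp add: sum_subtractf sum_axis sum.permute[OF that, symmetric, unfolded comp_def])
  have "Jac (\<lambda>k. xpow (\<beta> k) :: ('k, 'n) laurent) = (\<Sum>p\<in>{p. p permutes UNIV}. of_int (sign p) *
      (\<Prod>i\<in>UNIV. Poly_Mapping.single (\<beta> (p i) - axis i 1) (of_int (\<beta> (p i) $ i))))"
    by (simp add: Jac_def det_def part_deriv_xpow)
  also have "\<dots> = (\<Sum>p\<in>{p. p permutes UNIV}. Poly_Mapping.single (sum \<beta> UNIV - theta)
      (of_int (sign p) * (\<Prod>i\<in>UNIV. of_int (\<beta> (p i) $ i))))"
  proof (rule sum.cong)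
    fix p :: "'n \<Rightarrow> 'n" assume "p \<in> {p. p permutes UNIV}"
    then have p: "p permutes UNIV" by simp
    show "of_int (sign p) * (\<Prod>i\<in>UNIV. Poly_Mapping.single (\<beta> (p i) - axis i 1) (of_int (\<beta> (p i) $ i))) =
      Poly_Mapping.single (sum \<beta> UNIV - theta) (of_int (sign p) * (\<Prod>i\<in>UNIV. of_int (\<beta> (p i) $ i) :: 'k))"
      unfolding prod_single e[OF p] single_of_int[symmetric] mult_single by simp
  qed simp
  also have "\<dots> = Poly_Mapping.single (sum \<beta> UNIV - theta) (det (transpose (\<chi> k. emb (\<beta> k))))"
    by (simp add: sum_single det_def transpose_def)
  finally show ?thesis by (simp add: idet_def rdet_def)
qed

lemma Jac_xpow_upd: "Jac ((\<lambda>k. xpow (\<beta> k))(j := xpow g)) =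
    Poly_Mapping.single (sum \<beta> UNIV - \<beta> j + g - theta) (idet (\<beta>(j := g)))"
proof -
  have *: "(\<lambda>k. xpow (\<beta> k))(j := xpow g) = (\<lambda>k. xpow ((\<beta>(j := g)) k))" by auto
  show ?thesis unfolding sum_fun_upd[symmetric] * by (rule Jac_xpow)
qed

text \<open>With all other arguments monomials, exactly one monomial of \<open>w\<close>, of
  exponent \<beta> j + \<sigma>, can reach the given output exponent.\<close>

lemma lookup_Jac_upd:
  "coef (Jac ((\<lambda>k. xpow (\<beta> k))(j := w))) (sum \<beta> UNIV - theta + \<sigma>) =
    coef w (\<beta> j + \<sigma>) * idet (\<beta>(j := \<beta> j + \<sigma>))"
proof (induction w rule: laurent_induct)
  case (xpow a)
  have "sum \<beta> UNIV - \<beta> j + a - theta = sum \<beta> UNIV - theta + \<sigma> \<longleftrightarrow> a = \<beta> j + \<sigma>"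
    by (auto simp: algebra_simps)
  then show ?case unfolding Jac_xpow_upd by (auto simp: lookup_single_if lookup_xpow simp del: fun_upd_apply)
next
  case (add u v)
  then show ?case by (simp only: Jac_add lookup_add distrib_right)
next
  case (scale c u)
  then show ?case by (simp only: Jac_lscale lookup_lscale mult.assoc)
qed

text \<open>The induction runs over a finite set of positions in which the argument is arbitrary;
  outside it the arguments are monomials.\<close>

lemma multilinear_induct [case_names xpow add scale]:
  fixes u :: "'n::finite \<Rightarrow> ('k::field, 'm::finite) laurent"
  assumes mono: "\<And>\<beta>. P (\<lambda>k. xpow (\<beta> k))"
    and add: "\<And>u k x y. P (u(k := x)) \<Longrightarrow> P (u(k := y)) \<Longrightarrow> P (u(k := x + y))"
    and scale: "\<And>u k c x. P (u(k := x)) \<Longrightarrow> P (u(k := lscale c x))"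
  shows "P u"
proof -
  have "\<forall>u. (\<forall>k. k \<notin> T \<longrightarrow> (\<exists>b. u k = xpow b)) \<longrightarrow> P u" if "finite T" for T
    using that
  proof (induction T)
    case empty
    show ?case
    proof (intro allI impI)
      fix u :: "'n \<Rightarrow> ('k, 'm) laurent"
      assume "\<forall>k. k \<notin> {} \<longrightarrow> (\<exists>b. u k = xpow b)"
      then obtain \<beta> where "\<And>k. u k = xpow (\<beta> k)" by (metis empty_iff)
      then have "u = (\<lambda>k. xpow (\<beta> k))" by auto
      then show "P u" using mono by simp
    qed
  next
    case (insert k T)
    show ?case
    proof (intro allI impI)
      fix u :: "'n \<Rightarrow> ('k, 'm) laurent"
      assume u: "\<forall>j. j \<notin> insert k T \<longrightarrow> (\<exists>b. u j = xpow b)"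
      have "P (u(k := w))" for w
      proof (induction w rule: laurent_induct)
        case (xpow a)
        have "\<forall>j. j \<notin> T \<longrightarrow> (\<exists>b. (u(k := xpow a)) j = xpow b)" using u by auto
        then show ?case using insert.IH by blast
      qed (use add scale in blast)+
      then show "P u" by (metis fun_upd_triv)
    qed
  qed
  from this[of UNIV] show ?thesis by simp
qed

subsection \<open>Linear maps and derivations of Laurent polynomials\<close>

definition linear_map :: "(('k::field, 'n::finite) laurent \<Rightarrow> ('k, 'n) laurent) \<Rightarrow> bool" where
  "linear_map D \<longleftrightarrow> (\<forall>u v. D (u + v) = D u + D v) \<and> (\<forall>c u. D (lscale c u) = lscale c (D u))"

lemma linear_mapD:
  assumes "linear_map D"
  shows "D (u + v) = D u + D v" "D (lscale c u) = lscale c (D u)" "D 0 = 0"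
    "D (sum g A) = (\<Sum>a\<in>A. D (g a))" "D (Poly_Mapping.single a c) = lscale c (D (xpow a))"
proof -
  show *: "D (u + v) = D u + D v" "D (lscale c u) = lscale c (D u)" for u v c
    using assms by (auto simp: linear_map_def)
  show 0: "D 0 = 0" using *(2)[of 0 0] by simp
  show "D (sum g A) = (\<Sum>a\<in>A. D (g a))"
    by (induction A rule: infinite_finite_induct) (simp_all add: 0 *)
  show "D (Poly_Mapping.single a c) = lscale c (D (xpow a))" by (simp add: single_eq_lscale *)
qed

lemma linear_map_eqI:
  assumes "linear_map D" "linear_map E" "\<And>a. D (xpow a) = E (xpow a)"
  shows "D = E"
proof
  fix u show "D u = E u"
    by (induction u rule: laurent_induct) (simp_all add: assms linear_mapD(1,2)[OF assms(1)] linear_mapD(1,2)[OF assms(2)])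
qed

lemma gl_laurent_simps [simp]:
  "D \<in> carrier (gl laurent_space) \<longleftrightarrow> linear_map D"
  "D \<oplus>\<^bsub>gl laurent_space\<^esub> E = (\<lambda>u. D u + E u)" "c \<odot>\<^bsub>gl laurent_space\<^esub> D = (\<lambda>u. lscale c (D u))"
  "\<zero>\<^bsub>gl laurent_space\<^esub> = (\<lambda>u. 0)"
  using vec_space_laurent by (auto simp add: gl_def lin_map_def linear_map_def restrict_def)

lemma derivations_laurent:
  "D \<in> derivations laurent_space Jac \<longleftrightarrow>
    linear_map D \<and> (\<forall>u. D (Jac u) = (\<Sum>k\<in>UNIV. Jac (u(k := D (u k)))))"
  by (simp add: derivations_def)

lemma comm_derivations_laurent:
  "D \<in> comm_derivations laurent_space \<longleftrightarrow> linear_map D \<and> (\<forall>u v. D (u * v) = D u * v + u * D v)"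
  by (simp add: comm_derivations_def)

lemma derivationI:
  assumes D: "linear_map D"
    and mono: "\<And>\<beta>. D (Jac (\<lambda>k. xpow (\<beta> k))) = (\<Sum>j\<in>UNIV. Jac ((\<lambda>k. xpow (\<beta> k))(j := D (xpow (\<beta> j)))))"
  shows "D \<in> derivations laurent_space Jac"
proof -
  \<comment> \<open>Separating the k-th summand makes the right side visibly linear in the k-th
    argument.\<close>
  have upd: "(\<Sum>j\<in>UNIV. Jac ((u(k := x))(j := D ((u(k := x)) j)))) =
      Jac (u(k := D x)) + (\<Sum>j\<in>UNIV - {k}. Jac ((u(j := D (u j)))(k := x)))" for u k x
  proof -
    have "(\<Sum>j\<in>UNIV - {k}. Jac ((u(k := x))(j := D ((u(k := x)) j)))) =
      (\<Sum>j\<in>UNIV - {k}. Jac ((u(j := D (u j)))(k := x)))"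
      by (rule sum.cong) (auto simp: fun_upd_twist)
    then show ?thesis by (subst sum.remove[of _ k]) auto
  qed
  have "D (Jac u) = (\<Sum>k\<in>UNIV. Jac (u(k := D (u k))))" for u
  proof (induction u rule: multilinear_induct)
    case (xpow \<beta>)
    show ?case by (rule mono)
  next
    case (add u k x y)
    then show ?case
      unfolding upd Jac_add linear_mapD[OF D] by (simp add: sum.distrib del: fun_upd_apply)
  next
    case (scale u k c x)
    then show ?case
      unfolding upd Jac_lscale linear_mapD[OF D] by (simp add: lscale_sum del: fun_upd_apply)
  qed
  then show ?thesis using D by (simp add: derivations_laurent)
qed

text \<open>The homogeneous map of degree \<sigma> with weight \<open>f\<close>: it sends x^b to
  f(b) x^(b+\<sigma>).\<close>

definition hmap :: "(int ^ 'n \<Rightarrow> 'k) \<Rightarrow> int ^ 'n \<Rightarrow> ('k::field, 'n::finite) laurent \<Rightarrow> ('k, 'n) laurent" where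
  "hmap f \<sigma> u = (\<Sum>b\<in>supp u. Poly_Mapping.single (b + \<sigma>) (f b * coef u b))"

lemma lookup_hmap: "coef (hmap f \<sigma> u) g = f (g - \<sigma>) * coef u (g - \<sigma>)"
proof -
  have "coef (hmap f \<sigma> u) g = (\<Sum>b\<in>supp u. if b + \<sigma> = g then f b * coef u b else 0)"
    by (simp add: hmap_def lookup_sum lookup_single_if)
  also have "\<dots> = (\<Sum>b\<in>supp u. if b = g - \<sigma> then f b * coef u b else 0)"
    by (rule sum.cong) (auto simp: algebra_simps)
  also have "\<dots> = f (g - \<sigma>) * coef u (g - \<sigma>)" by (simp add: in_keys_iff)
  finally show ?thesis .
qed

lemma linear_hmap: "linear_map (hmap f \<sigma>)"
  unfolding linear_map_def
  by (intro conjI allI; rule poly_mapping_eqI; simp add: lookup_hmap lookup_add algebra_simps)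

lemma hmap_xpow: "hmap f \<sigma> (xpow b) = Poly_Mapping.single (b + \<sigma>) (f b)"
  by (simp add: hmap_def xpow_def)

lemma hmap_derivation:
  fixes f :: "int ^ 'n::finite \<Rightarrow> 'k::field"
  assumes "\<And>\<beta>. hom_der f \<sigma> \<beta>"
  shows "hmap f \<sigma> \<in> derivations laurent_space Jac"
proof (rule derivationI[OF linear_hmap])
  fix \<beta> :: "'n \<Rightarrow> int ^ 'n"
  have "hmap f \<sigma> (Jac (\<lambda>k. xpow (\<beta> k))) =
      Poly_Mapping.single (sum \<beta> UNIV - theta + \<sigma>) (f (sum \<beta> UNIV - theta) * idet \<beta>)"
    unfolding Jac_xpow linear_mapD(5)[OF linear_hmap] hmap_xpow by (simp add: lscale_single mult.commute)
  also have "\<dots> = Poly_Mapping.single (sum \<beta> UNIV - theta + \<sigma>) (\<Sum>k\<in>UNIV. f (\<beta> k) * idet (\<beta>(k := \<beta> k + \<sigma>)))"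
    using assms[of \<beta>] by (simp add: hom_der_def)
  also have "\<dots> = (\<Sum>j\<in>UNIV. Jac ((\<lambda>k. xpow (\<beta> k))(j := hmap f \<sigma> (xpow (\<beta> j)))))"
  proof -
    have "Jac ((\<lambda>k. xpow (\<beta> k))(j := hmap f \<sigma> (xpow (\<beta> j)))) =
        Poly_Mapping.single (sum \<beta> UNIV - theta + \<sigma>) (f (\<beta> j) * idet (\<beta>(j := \<beta> j + \<sigma>)))" for j
      unfolding hmap_xpow single_eq_lscale[of "\<beta> j + \<sigma>"] Jac_lscale Jac_xpow_upd
      by (simp add: lscale_single algebra_simps)
    then show ?thesis by (simp only: sum_single)
  qed
  finally show "hmap f \<sigma> (Jac (\<lambda>k. xpow (\<beta> k))) =
      (\<Sum>j\<in>UNIV. Jac ((\<lambda>k. xpow (\<beta> k))(j := hmap f \<sigma> (xpow (\<beta> j)))))" .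
qed

lemma comm_derivationI:
  assumes D: "linear_map D" and mono: "\<And>a b. D (xpow a * xpow b) = D (xpow a) * xpow b + xpow a * D (xpow b)"
  shows "D \<in> comm_derivations laurent_space"
proof -
  have 1: "D (xpow a * v) = D (xpow a) * v + xpow a * D v" for a v
    by (induction v rule: laurent_induct)
      (simp_all only: mono distrib_left lscale_mult linear_mapD(1,2)[OF D] lscale_simps, simp add: algebra_simps)
  have "D (u * v) = D u * v + u * D v" for u v
    by (induction u rule: laurent_induct)
      (simp_all only: 1 distrib_right lscale_mult linear_mapD(1,2)[OF D] lscale_simps, simp add: algebra_simps)
  then show ?thesis using D by (simp add: comm_derivations_laurent)
qed

text \<open>On monomials the Leibniz rule for the product says exactly that the weight is
  additive.\<close>

lemma hmap_pairing_comm: "hmap (pairing l) \<sigma> \<in> comm_derivations laurent_space"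
proof (rule comm_derivationI[OF linear_hmap])
  fix a b
  show "hmap (pairing l) \<sigma> (xpow a * xpow b) =
    hmap (pairing l) \<sigma> (xpow a) * xpow b + xpow a * hmap (pairing l) \<sigma> (xpow b)"
    unfolding xpow_mult hmap_xpow by (simp add: xpow_def mult_single single_add algebra_simps)
qed

text \<open>Only two equalities of single coefficients are assumed, not that D is a linear
  derivation: for the factor algebra this is applied to a choice of representatives, which respects
  the operations only up to constants.\<close>

lemma coefficient_hom_der:
  fixes D :: "('k::field, 'n::finite) laurent \<Rightarrow> ('k, 'n) laurent"
  assumes "coef (D (Jac (\<lambda>k. xpow (\<beta> k)))) (sum \<beta> UNIV - theta + \<sigma>) =
      coef (\<Sum>j\<in>UNIV. Jac ((\<lambda>k. xpow (\<beta> k))(j := D (xpow (\<beta> j))))) (sum \<beta> UNIV - theta + \<sigma>)"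
    and "coef (D (lscale (idet \<beta>) (xpow (sum \<beta> UNIV - theta)))) (sum \<beta> UNIV - theta + \<sigma>) =
      idet \<beta> * coef (D (xpow (sum \<beta> UNIV - theta))) (sum \<beta> UNIV - theta + \<sigma>)"
  shows "hom_der (\<lambda>b. coef (D (xpow b)) (b + \<sigma>)) \<sigma> \<beta>"
  using assms unfolding Jac_xpow single_eq_lscale hom_der_def lookup_sum lookup_Jac_upd
  by (simp add: mult.commute)

subsection \<open>Linear endomorphisms and derivations of an operation\<close>

context vspace
begin

lemma gl_mem: "f \<in> carrier (gl V) \<longleftrightarrow> f \<in> extensional (carrier V) \<and> lin_map V V f"
  by (simp add: gl_def)

lemma gl_sel [simp]:
  "f \<oplus>\<^bsub>gl V\<^esub> g = (\<lambda>x\<in>carrier V. f x \<oplus> g x)" "c \<odot>\<^bsub>gl V\<^esub> f = (\<lambda>x\<in>carrier V. c \<odot> f x)"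
  "\<zero>\<^bsub>gl V\<^esub> = (\<lambda>x\<in>carrier V. \<zero>)"
  by (simp_all add: gl_def)

lemma gl_closed: "f \<in> carrier (gl V) \<Longrightarrow> x \<in> carrier V \<Longrightarrow> f x \<in> carrier V"
  using lin_mapD(3) by (fastforce simp: gl_mem)

lemma lin_mapI:
  assumes "\<And>x. x \<in> carrier V \<Longrightarrow> f x \<in> carrier V"
    "\<And>x y. x \<in> carrier V \<Longrightarrow> y \<in> carrier V \<Longrightarrow> f (x \<oplus> y) = f x \<oplus> f y"
    "\<And>c x. x \<in> carrier V \<Longrightarrow> f (c \<odot> x) = c \<odot> f x"
  shows "lin_map V V f"
  using assms vec_space by (simp add: lin_map_def Pi_iff)

lemma smult_commute: "x \<in> carrier V \<Longrightarrow> a \<odot> (b \<odot> x) = b \<odot> (a \<odot> x)"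
  by (metis smult_smult mult.commute)

lemma gl_I:
  assumes "f \<in> extensional (carrier V)" "\<And>x. x \<in> carrier V \<Longrightarrow> f x \<in> carrier V"
    "\<And>x y. x \<in> carrier V \<Longrightarrow> y \<in> carrier V \<Longrightarrow> f (x \<oplus> y) = f x \<oplus> f y"
    "\<And>c x. x \<in> carrier V \<Longrightarrow> f (c \<odot> x) = c \<odot> f x"
  shows "f \<in> carrier (gl V)"
  using assms lin_mapI by (simp add: gl_mem)

lemma gl_hom:
  assumes "f \<in> carrier (gl V)"
  shows "x \<in> carrier V \<Longrightarrow> y \<in> carrier V \<Longrightarrow> f (x \<oplus> y) = f x \<oplus> f y"
    "x \<in> carrier V \<Longrightarrow> f (c \<odot> x) = c \<odot> f x" "f \<zero> = \<zero>"
  using assms lin_mapD(4-6) by (fastforce simp: gl_mem)+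

lemma gl_add_closed:
  assumes "f \<in> carrier (gl V)" "g \<in> carrier (gl V)"
  shows "f \<oplus>\<^bsub>gl V\<^esub> g \<in> carrier (gl V)"
  by (rule gl_I)
    (simp_all add: gl_closed[OF assms(1)] gl_closed[OF assms(2)] gl_hom[OF assms(1)] gl_hom[OF assms(2)]
      smult_add_right a_ac)

lemma gl_smult_closed:
  assumes "f \<in> carrier (gl V)"
  shows "c \<odot>\<^bsub>gl V\<^esub> f \<in> carrier (gl V)"
  by (rule gl_I) (simp_all add: gl_closed[OF assms] gl_hom[OF assms] smult_add_right smult_commute)

lemma gl_zero_closed: "\<zero>\<^bsub>gl V\<^esub> \<in> carrier (gl V)"
  by (rule gl_I) simp_all

lemma gl_eqI:
  "f \<in> extensional (carrier V) \<Longrightarrow> g \<in> extensional (carrier V) \<Longrightarrow> (\<And>x. x \<in> carrier V \<Longrightarrow> f x = g x) \<Longrightarrow> f = g"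
  by (rule extensionalityI)

lemma gl_ext: "f \<in> carrier (gl V) \<Longrightarrow> f \<in> extensional (carrier V)"
  by (simp add: gl_mem)

lemma gl_vec_space: "vec_space (gl V)"
proof (rule moduleI)
  show "abelian_group (gl V)"
  proof (rule abelian_groupI)
    fix f assume f: "f \<in> carrier (gl V)"
    have "(-1) \<odot>\<^bsub>gl V\<^esub> f \<oplus>\<^bsub>gl V\<^esub> f = \<zero>\<^bsub>gl V\<^esub>"
      by (rule gl_eqI) (simp_all add: gl_closed[OF f] minus_eq_smult[symmetric] l_neg)
    then show "\<exists>g\<in>carrier (gl V). g \<oplus>\<^bsub>gl V\<^esub> f = \<zero>\<^bsub>gl V\<^esub>"
      using gl_smult_closed[OF f] by blast
    show "\<zero>\<^bsub>gl V\<^esub> \<oplus>\<^bsub>gl V\<^esub> f = f"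
      by (rule gl_eqI) (use f in \<open>simp_all add: gl_closed gl_ext\<close>)
  next
    fix f g h assume fgh: "f \<in> carrier (gl V)" "g \<in> carrier (gl V)" "h \<in> carrier (gl V)"
    show "f \<oplus>\<^bsub>gl V\<^esub> g \<oplus>\<^bsub>gl V\<^esub> h = f \<oplus>\<^bsub>gl V\<^esub> (g \<oplus>\<^bsub>gl V\<^esub> h)"
      by (rule gl_eqI) (use fgh in \<open>simp_all add: gl_closed a_assoc\<close>)
  next
    fix f g assume fg: "f \<in> carrier (gl V)" "g \<in> carrier (gl V)"
    show "f \<oplus>\<^bsub>gl V\<^esub> g = g \<oplus>\<^bsub>gl V\<^esub> f"
      by (rule gl_eqI) (use fg in \<open>simp_all add: gl_closed a_comm\<close>)
  qed (use gl_add_closed gl_zero_closed in blast)+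
next
  fix c d f assume f: "f \<in> carrier (gl V)"
  show "(c \<oplus>\<^bsub>scalars\<^esub> d) \<odot>\<^bsub>gl V\<^esub> f = c \<odot>\<^bsub>gl V\<^esub> f \<oplus>\<^bsub>gl V\<^esub> d \<odot>\<^bsub>gl V\<^esub> f"
    by (rule gl_eqI) (use f in \<open>simp_all add: gl_closed smult_add_left\<close>)
  show "(c \<otimes>\<^bsub>scalars\<^esub> d) \<odot>\<^bsub>gl V\<^esub> f = c \<odot>\<^bsub>gl V\<^esub> (d \<odot>\<^bsub>gl V\<^esub> f)"
    by (rule gl_eqI) (use f in \<open>simp_all add: gl_closed smult_smult\<close>)
  show "\<one>\<^bsub>scalars\<^esub> \<odot>\<^bsub>gl V\<^esub> f = f"
    by (rule gl_eqI) (use f in \<open>simp_all add: gl_closed gl_ext\<close>)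
next
  fix c f g assume fg: "f \<in> carrier (gl V)" "g \<in> carrier (gl V)"
  show "c \<odot>\<^bsub>gl V\<^esub> (f \<oplus>\<^bsub>gl V\<^esub> g) = c \<odot>\<^bsub>gl V\<^esub> f \<oplus>\<^bsub>gl V\<^esub> c \<odot>\<^bsub>gl V\<^esub> g"
    by (rule gl_eqI) (use fg in \<open>simp_all add: gl_closed smult_add_right\<close>)
qed (use gl_smult_closed cring_scalars in blast)+

end

locale operation = vspace V for V :: "('k::field, 'v) module" (structure) +
  fixes \<omega> :: "('n::finite \<Rightarrow> 'v) \<Rightarrow> 'v"
  assumes multilinear: "multilinear V \<omega>"
begin

lemma operationD:
  assumes a: "a \<in> UNIV \<rightarrow> carrier V"
  shows "x \<in> carrier V \<Longrightarrow> \<omega> (a(i := x)) \<in> carrier V"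
    "x \<in> carrier V \<Longrightarrow> y \<in> carrier V \<Longrightarrow> \<omega> (a(i := x \<oplus> y)) = \<omega> (a(i := x)) \<oplus> \<omega> (a(i := y))"
    "x \<in> carrier V \<Longrightarrow> \<omega> (a(i := c \<odot> x)) = c \<odot> \<omega> (a(i := x))"
    "\<omega> (a(i := \<zero>)) = \<zero>"
    "\<omega> a \<in> carrier V"
proof -
  have l: "lin_map V V (\<lambda>x. \<omega> (a(i := x)))" for i
    using multilinear a by (simp add: multilinear_def)
  show "x \<in> carrier V \<Longrightarrow> \<omega> (a(i := x)) \<in> carrier V"
    "x \<in> carrier V \<Longrightarrow> y \<in> carrier V \<Longrightarrow> \<omega> (a(i := x \<oplus> y)) = \<omega> (a(i := x)) \<oplus> \<omega> (a(i := y))"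
    "x \<in> carrier V \<Longrightarrow> \<omega> (a(i := c \<odot> x)) = c \<odot> \<omega> (a(i := x))"
    "\<omega> (a(i := \<zero>)) = \<zero>"
    by (fact lin_mapD(3-6)[OF l])+
  fix i
  have "a i \<in> carrier V" using a by auto
  then have "\<omega> (a(i := a i)) \<in> carrier V" by (rule lin_mapD(3)[OF l])
  then show "\<omega> a \<in> carrier V" by simp
qed

lemma derivations_subspace: "vec_subspace (gl V) (derivations V \<omega>)"
proof -
  interpret gl: vspace "gl V" by (rule vspace.intro[OF gl_vec_space])
  have cl: "(\<lambda>i. \<omega> (a(i := D (a i)))) \<in> UNIV \<rightarrow> carrier V"
    if "a \<in> UNIV \<rightarrow> carrier V" "D \<in> carrier (gl V)" for a D
    using operationD(1)[OF that(1)] gl_closed[OF that(2)] that(1) by (simp add: Pi_iff)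
  show ?thesis
  proof (rule gl.subspaceI)
    show "derivations V \<omega> \<subseteq> carrier (gl V)" by (auto simp: derivations_def)
    have "(\<Oplus>i\<in>UNIV. \<omega> (a(i := \<zero>\<^bsub>gl V\<^esub> (a i)))) = \<zero>\<^bsub>gl V\<^esub> (\<omega> a)" if a: "a \<in> UNIV \<rightarrow> carrier V" for a
    proof -
      have "(\<Oplus>i\<in>UNIV. \<omega> (a(i := \<zero>\<^bsub>gl V\<^esub> (a i)))) = (\<Oplus>i\<in>(UNIV::'n set). \<zero>)"
        by (rule finsum_cong') (use operationD[OF a] a in \<open>auto simp: Pi_iff\<close>)
      then show ?thesis using operationD(5)[OF a] by simp
    qed
    then show "\<zero>\<^bsub>gl V\<^esub> \<in> derivations V \<omega>"
      using gl_zero_closed unfolding derivations_def by fastforce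
    fix D E c assume D: "D \<in> derivations V \<omega>"
    then have D': "D \<in> carrier (gl V)" by (simp add: derivations_def)
    { assume E: "E \<in> derivations V \<omega>"
      then have E': "E \<in> carrier (gl V)" by (simp add: derivations_def)
      have "(D \<oplus>\<^bsub>gl V\<^esub> E) (\<omega> a) = (\<Oplus>i\<in>UNIV. \<omega> (a(i := (D \<oplus>\<^bsub>gl V\<^esub> E) (a i))))"
        if a: "a \<in> UNIV \<rightarrow> carrier V" for a
      proof -
        have "(\<Oplus>i\<in>UNIV. \<omega> (a(i := (D \<oplus>\<^bsub>gl V\<^esub> E) (a i)))) =
            (\<Oplus>i\<in>UNIV. \<omega> (a(i := D (a i))) \<oplus> \<omega> (a(i := E (a i))))"
          by (rule finsum_cong')
            (use operationD(1,2)[OF a] a gl_closed[OF D'] gl_closed[OF E'] in \<open>simp_all add: Pi_iff\<close>)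
        also have "\<dots> = (\<Oplus>i\<in>UNIV. \<omega> (a(i := D (a i)))) \<oplus> (\<Oplus>i\<in>UNIV. \<omega> (a(i := E (a i))))"
          by (rule finsum_addf) (use cl a D' E' in auto)
        finally show ?thesis using D E a operationD(5)[OF a] by (simp add: derivations_def)
      qed
      then show "D \<oplus>\<^bsub>gl V\<^esub> E \<in> derivations V \<omega>"
        using gl_add_closed[OF D' E'] unfolding derivations_def by blast }
    have "(c \<odot>\<^bsub>gl V\<^esub> D) (\<omega> a) = (\<Oplus>i\<in>UNIV. \<omega> (a(i := (c \<odot>\<^bsub>gl V\<^esub> D) (a i))))"
      if a: "a \<in> UNIV \<rightarrow> carrier V" for a
    proof -
      have "(\<Oplus>i\<in>UNIV. \<omega> (a(i := (c \<odot>\<^bsub>gl V\<^esub> D) (a i)))) = (\<Oplus>i\<in>UNIV. c \<odot> \<omega> (a(i := D (a i))))"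
        by (rule finsum_cong')
          (use operationD(1,3)[OF a] a gl_closed[OF D'] in \<open>simp_all add: Pi_iff\<close>)
      also have "\<dots> = c \<odot> (\<Oplus>i\<in>UNIV. \<omega> (a(i := D (a i))))"
        by (rule finsum_smult_ldistr[symmetric]) (use cl[OF a D'] in auto)
      finally show ?thesis using D a operationD(5)[OF a] by (simp add: derivations_def)
    qed
    then show "c \<odot>\<^bsub>gl V\<^esub> D \<in> derivations V \<omega>"
      using gl_smult_closed[OF D'] unfolding derivations_def by blast
  qed
qed

end

locale nlie =
  fixes V :: "('k::field, 'v) module" (structure) and \<omega> :: "('n::{finite,linorder} \<Rightarrow> 'v) \<Rightarrow> 'v"
  assumes nlie: "n_lie_algebra V \<omega>"

sublocale nlie \<subseteq> operation V \<omega>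
  by (intro operation.intro vspace.intro operation_axioms.intro) (use nlie in \<open>auto simp only: n_lie_algebra_def\<close>)

context nlie
begin

lemma left_mult_in: "a \<in> UNIV \<rightarrow> carrier V \<Longrightarrow> left_mult V \<omega> a \<in> derivations V \<omega>"
  using nlie by (simp add: n_lie_algebra_def)

lemma derivations_gl: "derivations V \<omega> \<subseteq> carrier (gl V)"
  by (auto simp: derivations_def)

lemma Inn_subspace_gl: "vec_subspace (gl V) (Inn V \<omega>)"
  unfolding Inn_def
  by (rule vspace.lin_span_subspace[OF vspace.intro[OF gl_vec_space]])
    (use left_mult_in derivations_gl in blast)

lemma Inn_subset: "Inn V \<omega> \<subseteq> derivations V \<omega>"
  unfolding Inn_def
  by (rule vspace.lin_span_minimal[OF vspace.intro[OF gl_vec_space] derivations_subspace])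
    (use left_mult_in in blast)

lemma Der_vec_space: "vec_space (Der V \<omega>)"
  unfolding Der_def
  by (rule vspace.subspace_vec_space[OF vspace.intro[OF gl_vec_space] derivations_subspace])

lemma Inn_subspace: "vec_subspace (Der V \<omega>) (Inn V \<omega>)"
  unfolding Der_def
  by (rule subspace_of_subspace[OF gl_vec_space derivations_subspace Inn_subspace_gl Inn_subset])

lemma left_mult_Inn: "a \<in> UNIV \<rightarrow> carrier V \<Longrightarrow> left_mult V \<omega> a \<in> Inn V \<omega>"
  unfolding Inn_def
  using vspace.lin_span_superset[OF vspace.intro[OF gl_vec_space], of "{left_mult V \<omega> a | a. a \<in> UNIV \<rightarrow> carrier V}"]
    left_mult_in derivations_gl by blast

text \<open>\<open>left_mult\<close> singles out the last argument, ideals and the center the first.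
  A transposition moves the distinguished argument to any position at the cost of a nonzero
  sign.\<close>

lemma swap_position:
  assumes a: "a \<in> UNIV \<rightarrow> carrier V" and x: "x \<in> carrier V"
  obtains a' s where "a' \<in> UNIV \<rightarrow> carrier V" "s \<noteq> 0"
    "\<And>x. x \<in> carrier V \<Longrightarrow> \<omega> (a(j := x)) = s \<odot> \<omega> (a'(m := x))"
proof -
  let ?t = "Transposition.transpose j m"
  have t: "?t permutes UNIV" by (rule permutes_swap_id) auto
  have a': "a \<circ> ?t \<in> UNIV \<rightarrow> carrier V" using a by (auto simp: Pi_iff)
  have "\<omega> (a(j := x)) = of_int (sign ?t) \<odot> \<omega> ((a \<circ> ?t)(m := x))" if "x \<in> carrier V" for x
  proof -
    have "a(j := x) = ((a \<circ> ?t)(m := x)) \<circ> ?t"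
      by (auto simp: fun_eq_iff Transposition.transpose_def)
    moreover have "(a \<circ> ?t)(m := x) \<in> UNIV \<rightarrow> carrier V" using a' that by (auto simp: Pi_iff)
    ultimately show ?thesis
      using nlie t unfolding n_lie_algebra_def skew_symmetric_def by metis
  qed
  moreover have "(of_int (sign ?t) :: 'k) \<noteq> 0" by (simp add: sign_def)
  ultimately show ?thesis using that[OF a'] by blast
qed

lemma left_mult_position_Inn:
  assumes a: "a \<in> UNIV \<rightarrow> carrier V"
  shows "(\<lambda>x\<in>carrier V. \<omega> (a(j := x))) \<in> Inn V \<omega>"
proof -
  interpret gl: vspace "gl V" by (rule vspace.intro[OF gl_vec_space])
  obtain a' s where a': "a' \<in> UNIV \<rightarrow> carrier V" "s \<noteq> 0"
    "\<And>x. x \<in> carrier V \<Longrightarrow> \<omega> (a(j := x)) = s \<odot> \<omega> (a'(Max UNIV := x))"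
    using swap_position[OF a zero_closed, where j=j and m="Max UNIV"] by metis
  have "(\<lambda>x\<in>carrier V. \<omega> (a(j := x))) = s \<odot>\<^bsub>gl V\<^esub> left_mult V \<omega> a'"
    by (rule gl_eqI) (simp_all add: left_mult_def a'(3))
  then show ?thesis using gl.subspaceD(4)[OF Inn_subspace_gl left_mult_Inn[OF a'(1)]] by metis
qed

lemma ideal_position:
  assumes J: "n_ideal V \<omega> J" and z: "z \<in> J" and a: "a \<in> UNIV \<rightarrow> carrier V"
  shows "\<omega> (a(j := z)) \<in> J"
proof -
  have JV: "vec_subspace V J" using J by (simp add: n_ideal_def)
  have zV: "z \<in> carrier V" using subspaceD(1)[OF JV] z by blast
  obtain a' s where a': "a' \<in> UNIV \<rightarrow> carrier V" "s \<noteq> 0"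
    "\<And>x. x \<in> carrier V \<Longrightarrow> \<omega> (a(j := x)) = s \<odot> \<omega> (a'(Min UNIV := x))"
    using swap_position[OF a zero_closed, where j=j and m="Min UNIV"] by metis
  have "\<omega> (a'(Min UNIV := z)) \<in> J" using J z a' by (simp add: n_ideal_def)
  then show ?thesis using a'(3)[OF zV] subspaceD(4)[OF JV] by simp
qed

text \<open>The commutator of D with L_a is the sum, over all positions i but the last, of L_a with
  a_i replaced by D a_i. Hence interior derivations form an ideal.\<close>

lemma bracket_left_mult:
  assumes D: "D \<in> derivations V \<omega>" and E: "E \<in> Inn V \<omega>"
  shows "D \<otimes>\<^bsub>gl V\<^esub> E \<in> Inn V \<omega>"
proof -
  interpret gl: vspace "gl V" by (rule vspace.intro[OF gl_vec_space])
  have D': "D \<in> carrier (gl V)" using D derivations_gl by blast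
  then have Dl: "lin_map V V D" by (simp add: gl_mem)
  \<comment> \<open>These E form a subspace, so it suffices to treat the generators of the interior
    derivations.\<close>
  let ?H = "{E \<in> carrier (gl V). D \<otimes>\<^bsub>gl V\<^esub> E \<in> Inn V \<omega>}"
  have br: "D \<otimes>\<^bsub>gl V\<^esub> E = (\<lambda>x\<in>carrier V. D (E x) \<ominus> E (D x))" for E by (simp add: gl_def)
  have H: "vec_subspace (gl V) ?H"
  proof (rule gl.subspaceI)
    have "D \<otimes>\<^bsub>gl V\<^esub> \<zero>\<^bsub>gl V\<^esub> = \<zero>\<^bsub>gl V\<^esub>"
      unfolding br by (rule gl_eqI) (simp_all add: gl_closed[OF D'] lin_mapD(6)[OF Dl] a_minus_def minus_eq_smult)
    then show "\<zero>\<^bsub>gl V\<^esub> \<in> ?H" using gl_zero_closed gl.subspaceD(2)[OF Inn_subspace_gl] by simp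
  next
    fix E F assume E: "E \<in> ?H" and F: "F \<in> ?H"
    have "D \<otimes>\<^bsub>gl V\<^esub> (E \<oplus>\<^bsub>gl V\<^esub> F) = D \<otimes>\<^bsub>gl V\<^esub> E \<oplus>\<^bsub>gl V\<^esub> D \<otimes>\<^bsub>gl V\<^esub> F"
    proof (rule gl_eqI)
      fix x assume x: "x \<in> carrier V"
      have cl: "E x \<in> carrier V" "F x \<in> carrier V" "E (D x) \<in> carrier V" "F (D x) \<in> carrier V" "D x \<in> carrier V"
        using E F x by (auto intro: gl_closed D')
      then show "(D \<otimes>\<^bsub>gl V\<^esub> (E \<oplus>\<^bsub>gl V\<^esub> F)) x = (D \<otimes>\<^bsub>gl V\<^esub> E \<oplus>\<^bsub>gl V\<^esub> D \<otimes>\<^bsub>gl V\<^esub> F) x"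
        using x gl_closed[OF D' cl(1)] gl_closed[OF D' cl(2)]
        by (simp add: br lin_mapD(4)[OF Dl] a_minus_def minus_eq_smult smult_add_right a_ac)
    qed (simp_all add: br)
    then show "E \<oplus>\<^bsub>gl V\<^esub> F \<in> ?H"
      using E F gl.subspaceD(3)[OF Inn_subspace_gl] gl_add_closed by (metis (mono_tags, lifting) mem_Collect_eq)
  next
    fix c E assume E: "E \<in> ?H"
    have "D \<otimes>\<^bsub>gl V\<^esub> (c \<odot>\<^bsub>gl V\<^esub> E) = c \<odot>\<^bsub>gl V\<^esub> (D \<otimes>\<^bsub>gl V\<^esub> E)"
    proof (rule gl_eqI)
      fix x assume x: "x \<in> carrier V"
      have cl: "E x \<in> carrier V" "E (D x) \<in> carrier V" "D x \<in> carrier V"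
        using E x by (auto intro: gl_closed D')
      then show "(D \<otimes>\<^bsub>gl V\<^esub> (c \<odot>\<^bsub>gl V\<^esub> E)) x = (c \<odot>\<^bsub>gl V\<^esub> (D \<otimes>\<^bsub>gl V\<^esub> E)) x"
        using x gl_closed[OF D' cl(1)]
        by (simp add: br lin_mapD(5)[OF Dl] a_minus_def minus_eq_smult smult_add_right smult_commute)
    qed (simp_all add: br)
    then show "c \<odot>\<^bsub>gl V\<^esub> E \<in> ?H"
      using E gl.subspaceD(4)[OF Inn_subspace_gl] gl_smult_closed by (metis (mono_tags, lifting) mem_Collect_eq)
  qed auto
  have "left_mult V \<omega> a \<in> ?H" if a: "a \<in> UNIV \<rightarrow> carrier V" for a
  proof -
    let ?M = "Max (UNIV :: 'n set)"
    let ?L = "\<lambda>i. left_mult V \<omega> (a(i := D (a i)))"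
    have aD: "a(i := D (a i)) \<in> UNIV \<rightarrow> carrier V" for i
      using a gl_closed[OF D'] by (auto simp: Pi_iff)
    have Lgl: "?L i \<in> carrier (gl V)" for i using left_mult_in[OF aD] derivations_gl by blast
    have fs1: "finsum (gl V) ?L A \<in> carrier (gl V)" for A
      by (rule gl.finsum_closed) (use Lgl in auto)
    have fs: "\<forall>x\<in>carrier V. finsum (gl V) ?L A x = (\<Oplus>i\<in>A. \<omega> ((a(i := D (a i)))(?M := x)))" for A
    proof (induction A rule: infinite_finite_induct)
      case (insert i A)
      have "finsum (gl V) ?L (insert i A) = ?L i \<oplus>\<^bsub>gl V\<^esub> finsum (gl V) ?L A"
        by (rule gl.finsum_insert) (use insert Lgl in \<open>auto simp: Pi_iff\<close>)
      moreover have "(\<Oplus>i\<in>insert i A. \<omega> ((a(i := D (a i)))(?M := x))) =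
          \<omega> ((a(i := D (a i)))(?M := x)) \<oplus> (\<Oplus>i\<in>A. \<omega> ((a(i := D (a i)))(?M := x)))" if "x \<in> carrier V" for x
        by (rule finsum_insert) (use insert operationD(1)[OF aD] that in \<open>auto simp: Pi_iff\<close>)
      moreover have "?L i x = \<omega> ((a(i := D (a i)))(?M := x))" if "x \<in> carrier V" for x
        using that by (simp add: left_mult_def del: fun_upd_apply)
      ultimately show ?case using insert.IH by (simp del: fun_upd_apply)
    qed auto
    \<comment> \<open>In the derivation identity the term at the last position is L_a (D x), which
      the commutator subtracts.\<close>
    have "D \<otimes>\<^bsub>gl V\<^esub> left_mult V \<omega> a = finsum (gl V) ?L (UNIV - {?M})"
    proof (rule gl_eqI)
      fix x assume x: "x \<in> carrier V"
      have ax: "a(?M := x) \<in> UNIV \<rightarrow> carrier V" using a x by (auto simp: Pi_iff)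
      have cl: "(\<lambda>i. \<omega> ((a(i := D (a i)))(?M := x))) \<in> UNIV - {?M} \<rightarrow> carrier V"
        using operationD(1)[OF aD x] by (auto simp: Pi_iff)
      have "D (\<omega> (a(?M := x))) = (\<Oplus>i\<in>UNIV. \<omega> ((a(?M := x))(i := D ((a(?M := x)) i))))"
        using D ax by (simp add: derivations_def)
      also have "\<dots> = (\<Oplus>i\<in>insert ?M (UNIV - {?M}). \<omega> ((a(?M := x))(i := D ((a(?M := x)) i))))"
        by (simp add: insert_absorb)
      also have "\<dots> = \<omega> (a(?M := D x)) \<oplus> (\<Oplus>i\<in>UNIV - {?M}. \<omega> ((a(?M := x))(i := D ((a(?M := x)) i))))"
        by (subst finsum_insert) (use operationD(1)[OF ax] operationD(1)[OF a] gl_closed[OF D'] a x in \<open>auto simp: Pi_iff\<close>)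
      also have "(\<Oplus>i\<in>UNIV - {?M}. \<omega> ((a(?M := x))(i := D ((a(?M := x)) i)))) =
          (\<Oplus>i\<in>UNIV - {?M}. \<omega> ((a(i := D (a i)))(?M := x)))"
        by (rule finsum_cong') (use cl in \<open>auto simp: fun_upd_twist\<close>)
      finally have e: "D (\<omega> (a(?M := x))) = \<omega> (a(?M := D x)) \<oplus> (\<Oplus>i\<in>UNIV - {?M}. \<omega> ((a(i := D (a i)))(?M := x)))" .
      have Dx: "D x \<in> carrier V" using gl_closed[OF D' x] .
      have "(D \<otimes>\<^bsub>gl V\<^esub> left_mult V \<omega> a) x = D (\<omega> (a(?M := x))) \<ominus> \<omega> (a(?M := D x))"
        using x Dx by (simp add: br left_mult_def)
      also have "\<dots> = (\<Oplus>i\<in>UNIV - {?M}. \<omega> ((a(i := D (a i)))(?M := x)))"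
        unfolding e using operationD(1)[OF a Dx, of ?M] finsum_closed[OF cl]
        by (simp add: a_minus_def a_ac r_neg) (metis (no_types, lifting) a_assoc a_inv_closed l_zero a_comm r_neg)
      finally show "(D \<otimes>\<^bsub>gl V\<^esub> left_mult V \<omega> a) x = finsum (gl V) ?L (UNIV - {?M}) x"
        using fs[of "UNIV - {?M}"] x by simp
    next
      show "finsum (gl V) ?L (UNIV - {?M}) \<in> extensional (carrier V)" using fs1 gl_ext by blast
    qed (simp add: br)
    moreover have "finsum (gl V) ?L (UNIV - {?M}) \<in> Inn V \<omega>"
      by (rule gl.subspace_finsum[OF Inn_subspace_gl]) (use left_mult_Inn[OF aD] in auto)
    ultimately show ?thesis using left_mult_in[OF a] derivations_gl by auto
  qed
  then have "Inn V \<omega> \<subseteq> ?H"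
    unfolding Inn_def by (intro gl.lin_span_minimal[OF H[unfolded Inn_def]]) blast
  then show ?thesis using E by blast
qed

end

subsection \<open>Interior derivations of the Jacobian algebra\<close>

lemma a_minus_laurent [simp]: "u \<ominus>\<^bsub>laurent_space\<^esub> v = u - v"
  by (simp add: a_minus_def laurent.minus_eq_smult)

lemma restrict_UNIV [simp]: "restrict f UNIV = f"
  by (simp add: restrict_def)

lemma left_mult_laurent: "left_mult laurent_space Jac a = (\<lambda>u. Jac (a(Max UNIV := u)))"
  by (simp add: left_mult_def)

lemma Jac_position_xpow:
  fixes \<beta> :: "'n::finite \<Rightarrow> int ^ 'n"
  shows "(\<lambda>u :: ('k::field, 'n) laurent. Jac ((\<lambda>k. xpow (\<beta> k))(j := u))) =
    hmap (\<lambda>b. idet (\<beta>(j := b))) (sum \<beta> UNIV - \<beta> j - theta)"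
proof (rule linear_map_eqI)
  show "linear_map (\<lambda>u :: ('k, 'n) laurent. Jac ((\<lambda>k. xpow (\<beta> k))(j := u)))"
    by (simp add: linear_map_def Jac_add Jac_lscale del: fun_upd_apply)
  fix a :: "int ^ 'n"
  show "Jac ((\<lambda>k. xpow (\<beta> k) :: ('k, 'n) laurent)(j := xpow a)) =
      hmap (\<lambda>b. idet (\<beta>(j := b))) (sum \<beta> UNIV - \<beta> j - theta) (xpow a)"
    unfolding hmap_xpow Jac_xpow_upd by (rule arg_cong[of _ _ "\<lambda>x. Poly_Mapping.single x _"]) simp
qed (rule linear_hmap)

lemma idet_pairing:
  fixes \<beta> :: "'n::finite \<Rightarrow> int ^ 'n"
  obtains l where "(\<lambda>b. idet (\<beta>(j := b)) :: 'k::field) = pairing l"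
proof -
  have "idet (\<beta>(j := b)) = pairing (\<chi> i. (idet (\<beta>(j := axis i 1)) :: 'k)) b" for b
    by (rule additive_pairing) (rule idet_add)
  then show thesis using that by blast
qed

lemma idet_upd_sum_diff: "idet (\<beta>(j := sum \<beta> UNIV - \<beta> j)) = 0"
proof -
  have "idet (\<beta>(j := sum \<beta> UNIV - \<beta> j)) + idet (\<beta>(j := \<beta> j)) = idet (\<beta>(j := sum \<beta> UNIV))"
    unfolding idet_add[symmetric] by simp
  then show ?thesis unfolding idet_upd_sum by simp
qed

text \<open>Here \<sigma> + \<theta> is the sum of the rows other than j, and a determinant with
  that sum in row j vanishes. In degree -\<theta> the form is zero, so the map can be relabelled as
  the zero map of degree 0.\<close>

lemma Jac_position_cases:
  fixes \<beta> :: "'n::finite \<Rightarrow> int ^ 'n"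
  assumes n: "CARD('n) > 1"
  obtains l :: "'k::field ^ 'n" and \<sigma> where
    "(\<lambda>u :: ('k, 'n) laurent. Jac ((\<lambda>k. xpow (\<beta> k))(j := u))) = hmap (pairing l) \<sigma>"
    "pairing l (\<sigma> + theta) = 0" "\<sigma> \<noteq> - theta"
proof -
  obtain l where l: "(\<lambda>b. idet (\<beta>(j := b)) :: 'k) = pairing l" by (rule idet_pairing)
  define \<sigma> where "\<sigma> = sum \<beta> UNIV - \<beta> j - theta"
  have eq: "(\<lambda>u :: ('k, 'n) laurent. Jac ((\<lambda>k. xpow (\<beta> k))(j := u))) = hmap (pairing l) \<sigma>"
    unfolding Jac_position_xpow l \<sigma>_def ..
  have 0: "pairing l (\<sigma> + theta) = 0"
  proof -
    have "pairing l (sum \<beta> UNIV - \<beta> j) = idet (\<beta>(j := sum \<beta> UNIV - \<beta> j))" using fun_cong[OF l] by metis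
    then show ?thesis unfolding idet_upd_sum_diff \<sigma>_def by simp
  qed
  show thesis
  proof (cases "\<sigma> = - theta")
    case False
    then show ?thesis using that eq 0 by blast
  next
    case True
    \<comment> \<open>The rows other than j sum to zero. With b in row j the tuple sums to b, and
      replacing row i by this sum keeps the determinant while repeating b.\<close>
    obtain i where i: "i \<noteq> j" using ex_other_index[OF n] by blast
    have "pairing l b = 0" for b
    proof -
      let ?\<gamma> = "\<beta>(j := b)"
      have "sum \<beta> UNIV - \<beta> j - theta = - theta" using True by (simp only: \<sigma>_def)
      then have "sum \<beta> UNIV = \<beta> j" by (simp add: algebra_simps)
      then have s: "sum ?\<gamma> UNIV = b" unfolding sum_fun_upd by simp
      have "idet ?\<gamma> = (idet (?\<gamma>(i := b)) :: 'k)" by (rule idet_upd_sum[of ?\<gamma> i, unfolded s, symmetric])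
      also have "\<dots> = 0" by (rule idet_equal[of i j]) (use i in auto)
      finally show ?thesis using fun_cong[OF l] by metis
    qed
    then have "hmap (pairing l) \<sigma> = hmap (pairing 0) 0"
      by (intro ext poly_mapping_eqI) (simp add: lookup_hmap)
    moreover have "(0 :: int ^ 'n) \<noteq> - theta" by (simp add: vec_eq_iff theta_def)
    ultimately show ?thesis using that[of 0 0] eq by simp
  qed
qed

lemma linear_map_closed:
  "linear_map D \<Longrightarrow> linear_map E \<Longrightarrow> linear_map (\<lambda>u. D u + E u)"
  "linear_map D \<Longrightarrow> linear_map (\<lambda>u. lscale c (D u))"
  "(\<And>a. linear_map (F a)) \<Longrightarrow> linear_map (\<lambda>u. \<Sum>a\<in>A. F a u)"
  by (simp_all add: linear_map_def add_ac lscale_sum sum.distrib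
      lscale_simps(4)[symmetric] mult.commute del: lscale_simps(4))

lemma derivations_laurent_closed:
  "D \<in> derivations laurent_space Jac \<Longrightarrow> E \<in> derivations laurent_space Jac \<Longrightarrow> (\<lambda>u. D u + E u) \<in> derivations laurent_space Jac"
  "D \<in> derivations laurent_space Jac \<Longrightarrow> (\<lambda>u. lscale c (D u)) \<in> derivations laurent_space Jac"
  by (simp_all add: derivations_laurent linear_map_def Jac_add Jac_lscale sum.distrib lscale_sum
      add_ac lscale_simps(4)[symmetric] mult.commute del: lscale_simps(4) fun_upd_apply)

lemma hmap_pairing_derivation:
  fixes l :: "'k::field_char_0 ^ 'n::finite"
  assumes "pairing l (\<sigma> + theta) = 0"
  shows "hmap (pairing l) \<sigma> \<in> derivations laurent_space Jac"
  by (rule hmap_derivation) (use hom_der_affine[of \<sigma> 0 l] assms in auto)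

text \<open>Properties of the maps \<open>L\<close> only need to be checked for monomial parameters.\<close>

lemma left_mult_induct:
  fixes P :: "(('k::field, 'n::{finite,linorder}) laurent \<Rightarrow> ('k, 'n) laurent) \<Rightarrow> bool"
  assumes n: "CARD('n) > 1"
    and hmap: "\<And>l \<sigma>. pairing l (\<sigma> + theta) = 0 \<Longrightarrow> \<sigma> \<noteq> - theta \<Longrightarrow> P (hmap (pairing l) \<sigma>)"
    and add: "\<And>D E. P D \<Longrightarrow> P E \<Longrightarrow> P (\<lambda>u. D u + E u)"
    and scale: "\<And>c D. P D \<Longrightarrow> P (\<lambda>u. lscale c (D u))"
  shows "P (left_mult laurent_space Jac a)"
  unfolding left_mult_laurent
proof (induction a rule: multilinear_induct)
  case (xpow \<beta>)
  show ?case using Jac_position_cases[OF n, of \<beta> "Max UNIV"] hmap by metis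
next
  case (add u k x y)
  \<comment> \<open>The last entry is overwritten by the argument, so changing it leaves the map
    unchanged; at any other position linearity applies.\<close>
  show ?case
  proof (cases "k = Max UNIV")
    case True
    then have "u(k := z, Max UNIV := v) = u(Max UNIV := v)" for z v by simp
    then show ?thesis using add by (simp only:)
  next
    case False
    then have "u(k := z, Max UNIV := v) = (u(Max UNIV := v))(k := z)" for z v by (rule fun_upd_twist)
    then show ?thesis using assms(3)[OF add] by (simp only: Jac_add)
  qed
next
  case (scale u k c x)
  show ?case
  proof (cases "k = Max UNIV")
    case True
    then have "u(k := z, Max UNIV := v) = u(Max UNIV := v)" for z v by simp
    then show ?thesis using scale by (simp only:)
  next
    case False
    then have "u(k := z, Max UNIV := v) = (u(Max UNIV := v))(k := z)" for z v by (rule fun_upd_twist)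
    then show ?thesis using assms(4)[OF scale] by (simp only: Jac_lscale)
  qed
qed

text \<open>The type token pins down the field and the index type, making all notation inside the
  locale monomorphic.\<close>

locale jacobian =
  fixes ty :: "('k::field_char_0 \<times> 'n::{finite,linorder}) itself"
  assumes n: "CARD('n) > 1"
begin

abbreviation U :: "('k, ('k, 'n) laurent) module" where "U \<equiv> laurent_space"
abbreviation J :: "('n \<Rightarrow> ('k, 'n) laurent) \<Rightarrow> ('k, 'n) laurent" where "J \<equiv> Jac"

text \<open>The derivation property of \<open>left_mult\<close> follows from the affine criterion:
  for monomial parameters these maps are homogeneous with a linear weight vanishing on \<sigma> +
  \<theta>.\<close>

lemma nlie_laurent: "n_lie_algebra U J"
proof -
  have "multilinear U J"
    using vec_space_laurent by (simp add: multilinear_def lin_map_def Jac_add Jac_lscale del: fun_upd_apply)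
  moreover have "skew_symmetric U J"
    by (simp add: skew_symmetric_def Jac_permute)
  moreover have "left_mult U J a \<in> derivations U J" for a
    by (rule left_mult_induct[OF n])
      (use hmap_pairing_derivation derivations_laurent_closed in blast)+
  ultimately show ?thesis using vec_space_laurent by (simp add: n_lie_algebra_def)
qed

sublocale U: nlie U J by (rule nlie.intro[OF nlie_laurent])

lemma Inn_linear: "D \<in> Inn U J \<Longrightarrow> linear_map D"
  using U.Inn_subset derivations_laurent by blast

lemma Inn_closed:
  "D \<in> Inn U J \<Longrightarrow> E \<in> Inn U J \<Longrightarrow> (\<lambda>u. D u + E u) \<in> Inn U J"
  "D \<in> Inn U J \<Longrightarrow> (\<lambda>u. lscale c (D u)) \<in> Inn U J"
  "(\<lambda>u. 0) \<in> Inn U J"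
proof -
  note S = vspace.subspaceD[OF vspace.intro[OF laurent.gl_vec_space] U.Inn_subspace_gl]
  show "D \<in> Inn U J \<Longrightarrow> E \<in> Inn U J \<Longrightarrow> (\<lambda>u. D u + E u) \<in> Inn U J" using S(3)[of D E] by simp
  show "D \<in> Inn U J \<Longrightarrow> (\<lambda>u. lscale c (D u)) \<in> Inn U J" using S(4)[of D c] by simp
  show "(\<lambda>u. 0) \<in> Inn U J" using S(2) by simp
qed

lemma Inn_sum: "(\<And>a. a \<in> A \<Longrightarrow> F a \<in> Inn U J) \<Longrightarrow> (\<lambda>u. \<Sum>a\<in>A. F a u) \<in> Inn U J"
  by (induction A rule: infinite_finite_induct) (simp_all add: Inn_closed)

lemma Inn_induct [consumes 1, case_names hmap add scale]:
  assumes "D \<in> Inn U J"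
    and hmap: "\<And>l \<sigma>. pairing l (\<sigma> + theta) = 0 \<Longrightarrow> \<sigma> \<noteq> - theta \<Longrightarrow> P (hmap (pairing l) \<sigma>)"
    and add: "\<And>D E. P D \<Longrightarrow> P E \<Longrightarrow> P (\<lambda>u. D u + E u)"
    and scale: "\<And>c D. P D \<Longrightarrow> P (\<lambda>u. lscale c (D u))"
  shows "P D"
proof -
  interpret gl: vspace "gl U" by (rule vspace.intro[OF laurent.gl_vec_space])
  \<comment> \<open>The zero map is obtained by scaling some generator with 0.\<close>
  have "P (\<lambda>u. lscale 0 (left_mult U J undefined u))"
    by (rule scale, rule left_mult_induct[OF n]) (use hmap add scale in blast)+
  then have P0: "P (\<lambda>u. 0)" by simp
  have "vec_subspace (gl U) {D. linear_map D \<and> P D}"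
    by (rule gl.subspaceI) (use P0 add scale in \<open>auto simp: linear_map_def lscale_simps(4)[symmetric] mult.commute
        simp del: lscale_simps(4)\<close>)
  moreover have "left_mult U J a \<in> {D. linear_map D \<and> P D}" for a
    using Inn_linear[OF U.left_mult_Inn[of a]] left_mult_induct[OF n, of P a] hmap add scale by auto
  ultimately have "Inn U J \<subseteq> {D. linear_map D \<and> P D}"
    unfolding Inn_def by (intro gl.lin_span_minimal) auto
  then show ?thesis using assms(1) by blast
qed

text \<open>Monomial parameters \<open>w - pair_rest i j\<close> at i and standard vectors
  elsewhere, with j left free, give the minor of w as weight and w - \<theta> as degree.\<close>

lemma bracket_Inn:
  assumes "i \<noteq> j"
  shows "hmap (bracket i j w) (w - theta) \<in> Inn U J"
proof -
  let ?\<beta> = "pair_tuple i j (w - pair_rest i j) 0"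
  have "?\<beta>(j := b) = pair_tuple i j (w - pair_rest i j) b" for b by (simp add: pair_tuple_def)
  then have 1: "(\<lambda>b. idet (?\<beta>(j := b)) :: 'k) = bracket i j w"
    by (simp add: idet_pair_tuple[OF assms] bracket_rest(2)[OF assms])
  have 2: "sum ?\<beta> UNIV - ?\<beta> j - theta = w - theta"
    unfolding sum_pair_tuple[OF assms] by (simp add: pair_tuple_def)
  have "(\<lambda>u. J ((\<lambda>k. xpow (?\<beta> k))(j := u))) \<in> Inn U J"
    using U.left_mult_position_Inn[of "\<lambda>k. xpow (?\<beta> k)" j] by (simp add: restrict_def)
  then show ?thesis unfolding Jac_position_xpow 1 2 .
qed

lemma pairing_bracket:
  fixes l :: "('k, 'n) vec"
  assumes "pairing l w = 0" "w $ i \<noteq> 0"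
  shows "pairing l b = (\<Sum>j\<in>UNIV - {i}. l $ j / of_int (w $ i) * bracket i j w b)"
proof -
  have w: "of_int (w $ i) \<noteq> (0 :: 'k)" using assms(2) by simp
  have split: "pairing l v = l $ i * of_int (v $ i) + (\<Sum>j\<in>UNIV - {i}. l $ j * of_int (v $ j))" for v
    unfolding pairing_def by (rule sum.remove) auto
  have "(\<Sum>j\<in>UNIV - {i}. l $ j / of_int (w $ i) * bracket i j w b) =
      (\<Sum>j\<in>UNIV - {i}. l $ j * of_int (b $ j) - of_int (b $ i) / of_int (w $ i) * (l $ j * of_int (w $ j)))"
    by (rule sum.cong) (use w in \<open>auto simp: bracket_def field_simps\<close>)
  also have "\<dots> = (\<Sum>j\<in>UNIV - {i}. l $ j * of_int (b $ j)) -
      of_int (b $ i) / of_int (w $ i) * (\<Sum>j\<in>UNIV - {i}. l $ j * of_int (w $ j))"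
    by (simp add: sum_subtractf sum_distrib_left)
  \<comment> \<open>Here \<lambda>(w) = 0 is used: it recovers the missing i-th term of the
    form.\<close>
  also have "(\<Sum>j\<in>UNIV - {i}. l $ j * of_int (w $ j)) = - (l $ i * of_int (w $ i))"
    using split[of w] assms(1) by (simp add: eq_neg_iff_add_eq_0 add.commute)
  finally show ?thesis using split[of b] w by simp
qed

lemma hmap_sum: "hmap (\<lambda>b. \<Sum>j\<in>A. c j * f j b) \<sigma> u = (\<Sum>j\<in>A. lscale (c j) (hmap (f j) \<sigma> u))"
  by (rule poly_mapping_eqI) (simp add: lookup_hmap lookup_sum sum_distrib_right mult.assoc)

lemma hmap_Inn:
  fixes l :: "('k, 'n) vec"
  assumes "pairing l (\<sigma> + theta) = 0" "\<sigma> \<noteq> - theta"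
  shows "hmap (pairing l) \<sigma> \<in> Inn U J"
proof -
  define w where "w = \<sigma> + theta"
  have "w \<noteq> 0" using assms(2) by (simp add: w_def add_eq_0_iff2)
  then obtain i where i: "w $ i \<noteq> 0" by (auto simp: vec_eq_iff)
  have 1: "pairing l = (\<lambda>b. \<Sum>j\<in>UNIV - {i}. l $ j / of_int (w $ i) * bracket i j w b)"
    by (rule ext, rule pairing_bracket[OF _ i]) (use assms(1) in \<open>simp only: w_def\<close>)
  have 2: "\<sigma> = w - theta" by (simp add: w_def)
  have "hmap (pairing l) \<sigma> = (\<lambda>u. \<Sum>j\<in>UNIV - {i}. lscale (l $ j / of_int (w $ i)) (hmap (bracket i j w) (w - theta) u))"
    by (subst 1, subst 2) (simp only: hmap_sum[abs_def])
  also have "\<dots> \<in> Inn U J"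
    by (rule Inn_sum, rule Inn_closed(2), rule bracket_Inn) auto
  finally show ?thesis .
qed

subsection \<open>The outer derivations\<close>

lemma lookup_xpow_mult: "coef (xpow a * u) g = coef u (g - a)"
proof (induction u rule: laurent_induct)
  case (xpow b)
  show ?case unfolding xpow_mult by (auto simp: lookup_xpow algebra_simps)
next
  case (add u v)
  then show ?case by (simp add: distrib_left lookup_add)
next
  case (scale c u)
  then show ?case by (simp add: lscale_mult)
qed

lemma Delta_hmap: "Delta = (hmap (\<lambda>b. pairing (\<chi> i. 1) b + Delta_const TYPE('n)) 0 :: ('k, 'n) laurent \<Rightarrow> _)"
proof (intro ext poly_mapping_eqI)
  fix u :: "('k, 'n) laurent" and g
  have "(\<Sum>i\<in>UNIV. of_int (g $ i) * coef u g) = pairing (\<chi> i. 1) g * coef u g"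
    by (simp add: pairing_def sum_distrib_right)
  then show "coef (Delta u) g = coef (hmap (\<lambda>b. pairing (\<chi> i. 1) b + Delta_const TYPE('n)) 0 u) g"
    by (simp add: Delta_def lookup_hmap lookup_add lookup_sum lookup_xpow_mult lookup_part_deriv axis_def distrib_right)
qed

lemma D_mtheta_hmap: "D_mtheta = (hmap (\<lambda>b. if b = - theta then 1 else 0) theta :: ('k, 'n) laurent \<Rightarrow> _)"
  by (intro ext poly_mapping_eqI)
    (auto simp: D_mtheta_def lookup_hmap lookup_one when_def)

lemma D_ind_hmap: "D_ind i = (hmap (pairing (axis i 1)) (- theta) :: ('k, 'n) laurent \<Rightarrow> _)"
proof (intro ext poly_mapping_eqI)
  fix u :: "('k, 'n) laurent" and g
  have "pairing (axis i 1) v = (of_int (v $ i) :: 'k)" for v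
    by (simp add: pairing_def axis_def if_distrib[of "\<lambda>x. x * _"] cong: if_cong)
  moreover have "g - (- theta + axis i 1) + axis i 1 = g + theta" by simp
  moreover have "(g - (- theta + axis i 1)) $ i + 1 = (g + theta) $ i" by (simp add: axis_def)
  ultimately show "coef (D_ind i u) g = coef (hmap (pairing (axis i 1)) (- theta) u) g"
    unfolding D_ind_def lookup_hmap lookup_xpow_mult lookup_part_deriv by simp
qed

lemma n_neq_1: "of_nat CARD('n) \<noteq> (1 :: 'k)"
  using n by (metis less_irrefl of_nat_1 of_nat_eq_iff)

lemma pairing_ones_theta: "pairing (\<chi> i. 1) (theta :: (int, 'n) vec) = (of_nat CARD('n) :: 'k)"
  by (simp add: pairing_def theta_def)

text \<open>This is the condition of \<open>hom_der_affine\<close> in degree 0 for the form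
  (1,...,1), whose value at \<theta> is n.\<close>

lemma Delta_const_eq: "pairing (\<chi> i. 1) (theta :: (int, 'n) vec) = (1 - of_nat CARD('n)) * (Delta_const TYPE('n) :: 'k)"
  unfolding pairing_ones_theta Delta_const_def using n_neq_1 by simp

lemma Delta_const_neq_0: "Delta_const TYPE('n) \<noteq> (0 :: 'k)"
  unfolding Delta_const_def using n_neq_1 by auto

lemma Delta_derivation: "Delta \<in> derivations U J"
  unfolding Delta_hmap by (rule hmap_derivation, rule hom_der_affine) (simp_all add: Delta_const_eq)

lemma D_mtheta_derivation: "D_mtheta \<in> derivations U J"
  unfolding D_mtheta_hmap by (rule hmap_derivation, rule hom_der_delta)

lemma D_ind_derivation: "D_ind i \<in> derivations U J" "D_ind i \<in> comm_derivations U"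
  unfolding D_ind_hmap by (rule hmap_pairing_derivation, simp, rule hmap_pairing_comm)

text \<open>Each homogeneous component is classified separately. Only finitely many degrees occur
  because, apart from degrees 0 and \<theta>, a component is determined by the images of x_1, ...,
  x_n.\<close>

lemma Der_structure:
  assumes D: "D \<in> derivations U J"
  obtains c z F l where "finite F" "\<forall>\<sigma>. pairing (l \<sigma>) (\<sigma> + theta) = 0"
    "D = (\<lambda>u. lscale c (Delta u) + lscale z (D_mtheta u) + (\<Sum>\<sigma>\<in>F. hmap (pairing (l \<sigma>)) \<sigma> u))"
proof -
  have lin: "linear_map D" and der: "\<And>u. D (J u) = (\<Sum>k\<in>UNIV. J (u(k := D (u k))))"
    using D by (auto simp: derivations_laurent)
  define f where "f \<sigma> b = coef (D (xpow b)) (b + \<sigma>)" for \<sigma> b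
  have hd: "hom_der (f \<sigma>) \<sigma> \<beta>" for \<sigma> \<beta>
    unfolding f_def by (rule coefficient_hom_der) (simp_all add: der linear_mapD(2)[OF lin])
  have "\<exists>l k z. (\<forall>v. f \<sigma> v = pairing l v + k + (if v = - theta then z else 0)) \<and>
      (\<sigma> \<noteq> 0 \<longrightarrow> k = 0) \<and> pairing l (\<sigma> + theta) = (1 - of_nat CARD('n)) * k \<and> (\<sigma> \<noteq> theta \<longrightarrow> z = 0)" for \<sigma>
    using classification_full[OF n hd, of \<sigma>] by metis
  then obtain l k z where lkz:
    "\<And>\<sigma> v. f \<sigma> v = pairing (l \<sigma>) v + k \<sigma> + (if v = - theta then z \<sigma> else 0)"
    "\<And>\<sigma>. \<sigma> \<noteq> 0 \<Longrightarrow> k \<sigma> = 0" "\<And>\<sigma>. pairing (l \<sigma>) (\<sigma> + theta) = (1 - of_nat CARD('n)) * k \<sigma>"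
    "\<And>\<sigma>. \<sigma> \<noteq> theta \<Longrightarrow> z \<sigma> = 0"
    by metis
  \<comment> \<open>A multiple of \<open>Delta\<close> absorbs the constant of the degree 0
    component; the form that remains, \<open>m\<close>, satisfies the relation with constant
    zero.\<close>
  define c where "c = k 0 / Delta_const TYPE('n)"
  define m where "m \<sigma> = (if \<sigma> = 0 then l 0 - c *s (\<chi> i. 1) else l \<sigma>)" for \<sigma>
  have pm: "pairing (m \<sigma>) v = pairing (l \<sigma>) v - (if \<sigma> = 0 then c * pairing (\<chi> i. 1) v else 0)" for \<sigma> v
    by (simp add: m_def pairing_def left_diff_distrib sum_subtractf sum_distrib_left)
  have m0: "pairing (m \<sigma>) (\<sigma> + theta) = 0" for \<sigma>
  proof (cases "\<sigma> = 0")
    case True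
    have cd: "c * Delta_const TYPE('n) = k 0" unfolding c_def using Delta_const_neq_0 by simp
    show ?thesis unfolding pm using True lkz(3)[of 0]
      by (simp add: Delta_const_eq cd[symmetric] mult.left_commute)
  next
    case False
    then show ?thesis unfolding pm using lkz(2,3)[of \<sigma>] by simp
  qed
  \<comment> \<open>Off 0 and \<theta> a component is a pure linear form whose coefficients are its
    values at the standard vectors, so its degree shows up in the support of some D(x_i).\<close>
  define F where "F = {0, theta} \<union> (\<Union>i. (\<lambda>g. g - axis i 1) ` supp (D (xpow (axis i 1))))"
  have F: "finite F" by (simp add: F_def)
  have out: "pairing (m \<sigma>) v = 0" if "\<sigma> \<notin> F" for \<sigma> v
  proof -
    have s: "\<sigma> \<noteq> 0" "\<sigma> \<noteq> theta" using that by (auto simp: F_def)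
    have "l \<sigma> $ i = 0" for i
    proof (rule ccontr)
      assume "l \<sigma> $ i \<noteq> 0"
      then have "f \<sigma> (axis i 1) \<noteq> 0" using lkz(2,4)[of \<sigma>] s by (simp add: lkz(1))
      then have "axis i 1 + \<sigma> \<in> supp (D (xpow (axis i 1)))" by (simp add: f_def in_keys_iff)
      then have "axis i 1 + \<sigma> - axis i 1 \<in> F" unfolding F_def by blast
      then show False using that by simp
    qed
    then show ?thesis unfolding pm using s by (simp add: pairing_def)
  qed
  let ?E = "\<lambda>u. lscale c (Delta u) + lscale (z theta) (D_mtheta u) + (\<Sum>\<sigma>\<in>F. hmap (pairing (m \<sigma>)) \<sigma> u)"
  have "D = ?E"
  proof (rule linear_map_eqI[OF lin])
    show "linear_map ?E"
      unfolding Delta_hmap D_mtheta_hmap by (intro linear_map_closed linear_hmap)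
    fix b
    show "D (xpow b) = ?E (xpow b)"
    proof (rule poly_mapping_eqI)
      fix g
      define \<sigma> where "\<sigma> = g - b"
      have eqs: "\<tau> = \<sigma> \<longleftrightarrow> b = g - \<tau>" for \<tau> by (auto simp: \<sigma>_def algebra_simps)
      have "coef (\<Sum>\<tau>\<in>F. hmap (pairing (m \<tau>)) \<tau> (xpow b)) g = (\<Sum>\<tau>\<in>F. if \<tau> = \<sigma> then pairing (m \<tau>) b else 0)"
        unfolding lookup_sum by (rule sum.cong) (auto simp: hmap_xpow lookup_single_if \<sigma>_def algebra_simps)
      also have "\<dots> = pairing (m \<sigma>) b" using F out by simp
      finally have 1: "coef (\<Sum>\<tau>\<in>F. hmap (pairing (m \<tau>)) \<tau> (xpow b)) g = pairing (m \<sigma>) b" .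
      have 2: "coef (lscale c (Delta (xpow b))) g = (if \<sigma> = 0 then c * pairing (\<chi> i. 1) b + k 0 else 0)"
        using Delta_const_neq_0
        by (auto simp: Delta_hmap hmap_xpow lookup_single_if \<sigma>_def c_def field_simps)
      have 3: "coef (lscale (z theta) (D_mtheta (xpow b))) g = (if \<sigma> = theta \<and> b = - theta then z theta else 0)"
        by (auto simp: D_mtheta_hmap hmap_xpow lookup_single_if \<sigma>_def algebra_simps)
      have "coef (D (xpow b)) g = f \<sigma> b" by (simp add: f_def \<sigma>_def)
      also have "\<dots> = pairing (m \<sigma>) b + (if \<sigma> = 0 then c * pairing (\<chi> i. 1) b + k 0 else 0) +
          (if \<sigma> = theta \<and> b = - theta then z theta else 0)"
        unfolding pm using lkz(1)[of \<sigma> b] lkz(2)[of \<sigma>] lkz(4)[of \<sigma>] by auto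
      also have "\<dots> = coef (?E (xpow b)) g" by (simp only: lookup_add 1 2 3 add_ac)
      finally show "coef (D (xpow b)) g = coef (?E (xpow b)) g" .
    qed
  qed
  then show thesis using that F m0 by blast
qed

lemma Der_mod_Inn:
  assumes D: "D \<in> derivations U J"
  obtains c z p E where "E \<in> Inn U J"
    "D = (\<lambda>u. lscale c (Delta u) + lscale z (D_mtheta u) + (\<Sum>i\<in>UNIV. lscale (p i) (D_ind i u)) + E u)"
proof -
  obtain c z F l where F: "finite F" "\<forall>\<sigma>. pairing (l \<sigma>) (\<sigma> + theta) = 0"
    "D = (\<lambda>u. lscale c (Delta u) + lscale z (D_mtheta u) + (\<Sum>\<sigma>\<in>F. hmap (pairing (l \<sigma>)) \<sigma> u))"
    by (rule Der_structure[OF D], rule that)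
  \<comment> \<open>The degree -\<theta> component is the only one that \<open>hmap_Inn\<close> does
    not cover; its coefficients multiply the \<open>D_ind i\<close>.\<close>
  define p where "p i = (if - theta \<in> F then l (- theta) $ i else 0)" for i
  define E where "E = (\<lambda>u. \<Sum>\<sigma>\<in>F - {- theta}. hmap (pairing (l \<sigma>)) \<sigma> u)"
  have E: "E \<in> Inn U J" unfolding E_def by (rule Inn_sum, rule hmap_Inn) (use F(2) in auto)
  have "pairing (l (- theta)) = (\<lambda>b. \<Sum>i\<in>UNIV. l (- theta) $ i * pairing (axis i 1) b)"
  proof -
    have "pairing (axis i 1) v = (of_int (v $ i) :: 'k)" for i and v :: "(int, 'n) vec"
      by (simp add: pairing_def axis_def if_distrib[of "\<lambda>x. x * _"] cong: if_cong)
    then show ?thesis by (simp add: pairing_def[of "l (- theta)"] fun_eq_iff)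
  qed
  then have 1: "hmap (pairing (l (- theta))) (- theta) u = (\<Sum>i\<in>UNIV. lscale (l (- theta) $ i) (D_ind i u))" for u
    unfolding D_ind_hmap hmap_sum[symmetric] by simp
  have "(\<Sum>\<sigma>\<in>F. hmap (pairing (l \<sigma>)) \<sigma> u) = (\<Sum>i\<in>UNIV. lscale (p i) (D_ind i u)) + E u" for u
  proof (cases "- theta \<in> F")
    case True
    then show ?thesis using F(1) by (simp add: sum.remove E_def p_def 1)
  next
    case False
    then show ?thesis by (simp add: E_def p_def)
  qed
  then show thesis using that[OF E, of c z p] F(3) by (simp add: add.assoc)
qed

end

subsection \<open>Functionals separating the outer derivations\<close>

text \<open>The trace of the degree 0 component on x_1, ..., x_n; for a linear weight \<lambda> of
  degree 0 it is \<lambda>(\<theta>).\<close>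

definition qf :: "(('k::field, 'n::finite) laurent \<Rightarrow> ('k, 'n) laurent) \<Rightarrow> 'k" where
  "qf D = (\<Sum>i\<in>UNIV. coef (D (xpow (axis i 1))) (axis i 1))"

text \<open>Reads the degree \<theta> component at -\<theta>, the only argument where it can deviate
  from a linear form.\<close>

definition zf :: "(('k::field, 'n::finite) laurent \<Rightarrow> ('k, 'n) laurent) \<Rightarrow> 'k" where
  "zf D = coef (D (xpow (- theta))) 0"

text \<open>The i-th coefficient of the degree -\<theta> component, a degree in which interior
  derivations have no component.\<close>

definition pf :: "'n \<Rightarrow> (('k::field, 'n::finite) laurent \<Rightarrow> ('k, 'n) laurent) \<Rightarrow> 'k" where
  "pf i D = coef (D (xpow (axis i 1))) (axis i 1 - theta)"

lemma functional_hmap: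
  "qf (hmap f \<sigma>) = (if \<sigma> = 0 then \<Sum>i\<in>UNIV. f (axis i 1) else 0)"
  "zf (hmap f \<sigma>) = (if \<sigma> = theta then f (- theta) else 0)"
  "pf i (hmap f \<sigma>) = (if \<sigma> = - theta then f (axis i 1) else 0)"
proof -
  have "- theta + \<sigma> = 0 \<longleftrightarrow> \<sigma> = theta" "axis i 1 + \<sigma> = axis i 1 - theta \<longleftrightarrow> \<sigma> = - theta"
    by (metis add.left_inverse add_left_cancel) (metis add_left_cancel diff_conv_add_uminus)
  then show "qf (hmap f \<sigma>) = (if \<sigma> = 0 then \<Sum>i\<in>UNIV. f (axis i 1) else 0)"
    "zf (hmap f \<sigma>) = (if \<sigma> = theta then f (- theta) else 0)"
    "pf i (hmap f \<sigma>) = (if \<sigma> = - theta then f (axis i 1) else 0)"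
    by (simp_all add: qf_def zf_def pf_def hmap_xpow lookup_single_if)
qed

lemma functional_add:
  "qf (\<lambda>u. D u + E u) = qf D + qf E" "zf (\<lambda>u. D u + E u) = zf D + zf E" "pf i (\<lambda>u. D u + E u) = pf i D + pf i E"
  by (simp_all add: qf_def zf_def pf_def lookup_add sum.distrib)

lemma functional_scale:
  "qf (\<lambda>u. lscale c (D u)) = c * qf D" "zf (\<lambda>u. lscale c (D u)) = c * zf D" "pf i (\<lambda>u. lscale c (D u)) = c * pf i D"
  by (simp_all add: qf_def zf_def pf_def sum_distrib_left)

lemma functional_sum:
  "qf (\<lambda>u. \<Sum>a\<in>A. F a u) = (\<Sum>a\<in>A. qf (F a))" "zf (\<lambda>u. \<Sum>a\<in>A. F a u) = (\<Sum>a\<in>A. zf (F a))"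
  "pf i (\<lambda>u. \<Sum>a\<in>A. F a u) = (\<Sum>a\<in>A. pf i (F a))"
proof -
  show "qf (\<lambda>u. \<Sum>a\<in>A. F a u) = (\<Sum>a\<in>A. qf (F a))"
    unfolding qf_def lookup_sum by (rule sum.swap)
qed (simp_all add: zf_def pf_def lookup_sum)

lemma comm_derivations_closed:
  "D \<in> comm_derivations laurent_space \<Longrightarrow> E \<in> comm_derivations laurent_space \<Longrightarrow> (\<lambda>u. D u + E u) \<in> comm_derivations laurent_space"
  "D \<in> comm_derivations laurent_space \<Longrightarrow> (\<lambda>u. lscale c (D u)) \<in> comm_derivations laurent_space"
  "(\<And>a. F a \<in> comm_derivations laurent_space) \<Longrightarrow> (\<lambda>u. \<Sum>a\<in>A. F a u) \<in> comm_derivations laurent_space"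
  unfolding comm_derivations_laurent
  by (intro conjI linear_map_closed; simp add: lscale_mult algebra_simps sum.distrib sum_distrib_left sum_distrib_right)+

context jacobian
begin

lemma Delta_functionals: "qf (Delta :: ('k, 'n) laurent \<Rightarrow> ('k, 'n) laurent) = (Delta_const TYPE('n) :: 'k)" "zf (Delta :: ('k, 'n) laurent \<Rightarrow> ('k, 'n) laurent) = (0 :: 'k)" "pf i (Delta :: ('k, 'n) laurent \<Rightarrow> ('k, 'n) laurent) = (0 :: 'k)"
proof -
  have th: "(0 :: (int, 'n) vec) \<noteq> theta" "(0 :: (int, 'n) vec) \<noteq> - theta"
    by (auto simp: vec_eq_iff theta_def)
  show "zf (Delta :: ('k, 'n) laurent \<Rightarrow> ('k, 'n) laurent) = (0 :: 'k)" "pf i (Delta :: ('k, 'n) laurent \<Rightarrow> ('k, 'n) laurent) = (0 :: 'k)"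
    unfolding Delta_hmap functional_hmap using th by auto
  have "qf (Delta :: ('k, 'n) laurent \<Rightarrow> ('k, 'n) laurent) = (of_nat CARD('n) + of_nat CARD('n) * Delta_const TYPE('n) :: 'k)"
    unfolding Delta_hmap functional_hmap by (simp add: sum.distrib distrib_left)
  \<comment> \<open>With k = \<open>Delta_const\<close> the relation n = (1 - n) k gives n + n k =
    k.\<close>
  also have "\<dots> = Delta_const TYPE('n)"
    using Delta_const_eq pairing_ones_theta by (simp add: algebra_simps)
  finally show "qf (Delta :: ('k, 'n) laurent \<Rightarrow> ('k, 'n) laurent) = (Delta_const TYPE('n) :: 'k)" .
qed

lemma D_mtheta_functionals: "qf (D_mtheta :: ('k, 'n) laurent \<Rightarrow> ('k, 'n) laurent) = (0 :: 'k)" "zf (D_mtheta :: ('k, 'n) laurent \<Rightarrow> ('k, 'n) laurent) = (1 :: 'k)" "pf i (D_mtheta :: ('k, 'n) laurent \<Rightarrow> ('k, 'n) laurent) = (0 :: 'k)"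
proof -
  have th: "(theta :: (int, 'n) vec) \<noteq> 0" "(theta :: (int, 'n) vec) \<noteq> - theta"
    by (auto simp: vec_eq_iff theta_def)
  show "qf (D_mtheta :: ('k, 'n) laurent \<Rightarrow> ('k, 'n) laurent) = (0 :: 'k)" "zf (D_mtheta :: ('k, 'n) laurent \<Rightarrow> ('k, 'n) laurent) = (1 :: 'k)" "pf i (D_mtheta :: ('k, 'n) laurent \<Rightarrow> ('k, 'n) laurent) = (0 :: 'k)"
    unfolding D_mtheta_hmap functional_hmap using th by auto
qed

lemma axis_nth_if: "axis j (x :: 'a::zero) $ i = (if i = j then x else 0)"
  by (simp add: axis_def)

lemma D_ind_functionals: "qf (D_ind j :: ('k, 'n) laurent \<Rightarrow> ('k, 'n) laurent) = (0 :: 'k)" "zf (D_ind j :: ('k, 'n) laurent \<Rightarrow> ('k, 'n) laurent) = (0 :: 'k)"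
  "pf i (D_ind j :: ('k, 'n) laurent \<Rightarrow> ('k, 'n) laurent) = (if i = j then 1 else 0 :: 'k)"
proof -
  have th: "- theta \<noteq> (0 :: (int, 'n) vec)" "- theta \<noteq> (theta :: (int, 'n) vec)"
    by (auto simp: vec_eq_iff theta_def)
  show "qf (D_ind j :: ('k, 'n) laurent \<Rightarrow> ('k, 'n) laurent) = (0 :: 'k)" "zf (D_ind j :: ('k, 'n) laurent \<Rightarrow> ('k, 'n) laurent) = (0 :: 'k)"
    "pf i (D_ind j :: ('k, 'n) laurent \<Rightarrow> ('k, 'n) laurent) = (if i = j then 1 else 0 :: 'k)"
    unfolding D_ind_hmap functional_hmap pairing_simps using th by (auto simp: axis_nth_if)
qed

text \<open>Only the degrees 0 and \<theta> are seen. There the hypothesis reads \<lambda>(\<theta>)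
  = 0 or 2 \<lambda>(\<theta>) = 0, and the characteristic is 0.\<close>

lemma pairing_hmap_functionals:
  fixes l :: "('k, 'n) vec"
  assumes "pairing l (\<sigma> + theta) = 0"
  shows "qf (hmap (pairing l) \<sigma>) = 0" "zf (hmap (pairing l) \<sigma>) = 0"
proof -
  have "pairing l theta = 0" if "\<sigma> = 0 \<or> \<sigma> = theta"
    using assms that by auto
  moreover have "pairing l theta = (\<Sum>i\<in>UNIV. l $ i)" by (simp add: pairing_def theta_def)
  ultimately show "qf (hmap (pairing l) \<sigma>) = 0" "zf (hmap (pairing l) \<sigma>) = 0"
    unfolding functional_hmap by auto
qed

lemma Inn_functionals:
  assumes "D \<in> Inn U J"
  shows "qf D = 0" "zf D = 0" "pf i D = 0"
proof -
  have "qf D = 0 \<and> zf D = 0 \<and> pf i D = 0"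
    using assms
    by (induction D rule: Inn_induct)
      (simp_all add: pairing_hmap_functionals functional_hmap(3) functional_add functional_scale)
  then show "qf D = 0" "zf D = 0" "pf i D = 0" by auto
qed

abbreviation T where "T \<equiv> comm_derivations U \<inter> derivations U J"

lemma T_closed:
  "D \<in> T \<Longrightarrow> E \<in> T \<Longrightarrow> (\<lambda>u. D u + E u) \<in> T" "D \<in> T \<Longrightarrow> (\<lambda>u. lscale c (D u)) \<in> T" "(\<lambda>u. 0) \<in> T"
proof -
  show "D \<in> T \<Longrightarrow> E \<in> T \<Longrightarrow> (\<lambda>u. D u + E u) \<in> T"
    using comm_derivations_closed(1)[of D E] derivations_laurent_closed(1)[of D E] by simp
  show "D \<in> T \<Longrightarrow> (\<lambda>u. lscale c (D u)) \<in> T"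
    using comm_derivations_closed(2)[of D c] derivations_laurent_closed(2)[of D c] by simp
  have "(\<lambda>u. 0) \<in> comm_derivations U" by (simp add: comm_derivations_laurent linear_map_def)
  moreover have "(\<lambda>u. 0) \<in> derivations U J" using Inn_closed(3) U.Inn_subset by blast
  ultimately show "(\<lambda>u. 0) \<in> T" by simp
qed

lemma Inn_T: "Inn U J \<subseteq> T"
proof
  fix D assume "D \<in> Inn U J"
  then show "D \<in> T"
  proof (induction D rule: Inn_induct)
    case (hmap l \<sigma>)
    then show ?case by (intro IntI hmap_pairing_comm hmap_pairing_derivation)
  qed (fact T_closed)+
qed

text \<open>Modulo homogeneous maps with linear weight, which respect the product, a derivation is c
  \<open>Delta\<close> + z \<open>D_mtheta\<close>, and the functionals read off c up to a nonzero
  factor and z. So \<open>T\<close> is the kernel of a map to K^2.\<close>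

lemma comm_iff:
  assumes D: "D \<in> derivations U J"
  shows "D \<in> comm_derivations U \<longleftrightarrow> qf D = 0 \<and> zf D = 0"
proof -
  obtain c z F l where F: "finite F" "\<forall>\<sigma>. pairing (l \<sigma>) (\<sigma> + theta) = 0"
    "D = (\<lambda>u. lscale c (Delta u) + lscale z (D_mtheta u) + (\<Sum>\<sigma>\<in>F. hmap (pairing (l \<sigma>)) \<sigma> u))"
    by (rule Der_structure[OF D], rule that)
  define E where "E = (\<lambda>u. \<Sum>\<sigma>\<in>F. hmap (pairing (l \<sigma>)) \<sigma> u)"
  have D': "D = (\<lambda>u. lscale c (Delta u) + lscale z (D_mtheta u) + E u)" using F(3) by (simp add: E_def)
  have E: "E \<in> comm_derivations U"
    unfolding E_def by (rule comm_derivations_closed(3), rule hmap_pairing_comm)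
  have "qf E = 0" "zf E = 0"
    unfolding E_def functional_sum using F(2) by (simp_all add: pairing_hmap_functionals)
  then have f: "qf D = c * Delta_const TYPE('n)" "zf D = z"
    unfolding D' functional_add functional_scale by (simp_all add: Delta_functionals D_mtheta_functionals)
  show ?thesis
  proof
    assume "D \<in> comm_derivations U"
    then have "(\<lambda>u. D u + lscale (-1) (E u)) \<in> comm_derivations U"
      by (rule comm_derivations_closed(1)[OF _ comm_derivations_closed(2)[OF E]])
    moreover have "(\<lambda>u. D u + lscale (-1) (E u)) = (\<lambda>u. lscale c (Delta u) + lscale z (D_mtheta u))"
      by (simp add: D')
    ultimately have "(\<lambda>u. lscale c (Delta u) + lscale z (D_mtheta u)) \<in> comm_derivations U" by (simp only:)
    then have C: "lscale c (Delta (u * v)) + lscale z (D_mtheta (u * v)) =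
        (lscale c (Delta u) + lscale z (D_mtheta u)) * v + u * (lscale c (Delta v) + lscale z (D_mtheta v))" for u v :: "('k, 'n) laurent"
      by (simp add: comm_derivations_laurent)
    have th: "- theta \<noteq> (0 :: (int, 'n) vec)" "- theta \<noteq> (theta :: (int, 'n) vec)"
      "theta + theta \<noteq> (0 :: (int, 'n) vec)"
      by (auto simp: vec_eq_iff theta_def)
    have D1: "D_mtheta (1 :: ('k, 'n) laurent) = 0"
      unfolding xpow_0[symmetric] D_mtheta_hmap hmap_xpow using th by simp
    have De1: "Delta (1 :: ('k, 'n) laurent) = lscale (Delta_const TYPE('n)) 1"
      unfolding xpow_0[symmetric] Delta_hmap hmap_xpow by (simp add: single_eq_lscale)
    \<comment> \<open>The Leibniz rule for 1 = 1 * 1 forces the value at 1 to vanish, while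
      \<open>Delta\<close> multiplies 1 by a nonzero constant.\<close>
    have "coef (lscale c (Delta (1 :: ('k, 'n) laurent))) 0 = 0"
      using C[of 1 1] by (simp add: D1)
    then have c: "c = 0" unfolding De1 using Delta_const_neq_0 by simp
    have m1: "D_mtheta (xpow (- theta)) = (1 :: ('k, 'n) laurent)"
      unfolding D_mtheta_hmap hmap_xpow by simp
    have m2: "D_mtheta (xpow theta) = (0 :: ('k, 'n) laurent)"
      unfolding D_mtheta_hmap hmap_xpow using th by (simp add: eq_neg_iff_add_eq_0)
    \<comment> \<open>The product of x^(-\<theta>) and x^\<theta> is 1, which
      \<open>D_mtheta\<close> kills, whereas the Leibniz rule would give z x^\<theta>.\<close>
    have "0 = lscale z (xpow theta :: ('k, 'n) laurent)"
      using C[of "xpow (- theta)" "xpow theta"] unfolding xpow_mult c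
      by (simp add: xpow_0 D1 m1 m2 lscale_mult)
    then have "coef (lscale z (xpow theta :: ('k, 'n) laurent)) theta = coef 0 theta" by simp
    then have "z = 0" by (simp add: lookup_xpow)
    then show "qf D = 0 \<and> zf D = 0" using c f by simp
  next
    assume "qf D = 0 \<and> zf D = 0"
    then have "c = 0" "z = 0" using f Delta_const_neq_0 by auto
    then show "D \<in> comm_derivations U" using E unfolding D' by simp
  qed
qed

subsection \<open>Bases of the spaces of outer derivations\<close>

lemma Der_simps:
  "carrier (Der U J) = derivations U J" "D \<oplus>\<^bsub>Der U J\<^esub> E = (\<lambda>u. D u + E u)"
  "c \<odot>\<^bsub>Der U J\<^esub> D = (\<lambda>u. lscale c (D u))" "\<zero>\<^bsub>Der U J\<^esub> = (\<lambda>u. 0)"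
  by (simp_all add: Der_def)

lemma Der_minus:
  assumes "D \<in> derivations U J" "E \<in> derivations U J"
  shows "D \<ominus>\<^bsub>Der U J\<^esub> E = (\<lambda>u. D u - E u)"
proof -
  interpret V: vspace "Der U J" by (rule vspace.intro[OF U.Der_vec_space])
  have "\<ominus>\<^bsub>Der U J\<^esub> E = (\<lambda>u. - E u)"
    using V.minus_eq_smult[of E] assms(2) by (simp add: Der_simps)
  then show ?thesis by (simp add: a_minus_def Der_simps)
qed

lemma Der_combination:
  assumes "b \<in> I \<rightarrow> derivations U J" "finite I"
  shows "(\<Oplus>\<^bsub>Der U J\<^esub>i\<in>I. c i \<odot>\<^bsub>Der U J\<^esub> b i) = (\<lambda>u. \<Sum>i\<in>I. lscale (c i) (b i u))"
proof -
  interpret V: vspace "Der U J" by (rule vspace.intro[OF U.Der_vec_space])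
  show ?thesis
    using assms(2,1)
  proof (induction I)
    case (insert i I)
    have "(\<Oplus>\<^bsub>Der U J\<^esub>j\<in>insert i I. c j \<odot>\<^bsub>Der U J\<^esub> b j) =
        c i \<odot>\<^bsub>Der U J\<^esub> b i \<oplus>\<^bsub>Der U J\<^esub> (\<Oplus>\<^bsub>Der U J\<^esub>j\<in>I. c j \<odot>\<^bsub>Der U J\<^esub> b j)"
      by (rule V.combination_insert) (use insert in \<open>auto simp: Der_simps\<close>)
    then show ?case using insert by (simp add: Der_simps)
  qed (simp add: Der_simps)
qed

lemma T_subspace: "vec_subspace (Der U J) T"
proof -
  interpret V: vspace "Der U J" by (rule vspace.intro[OF U.Der_vec_space])
  show ?thesis
    by (rule V.subspaceI) (use T_closed in \<open>auto simp: Der_simps\<close>)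
qed

sublocale QC: quotient_chain "Der U J" "Inn U J" T
  by (intro quotient_chain.intro quotient_spaceI quotient_chain_axioms.intro
      U.Der_vec_space U.Inn_subspace T_subspace Inn_T)

lemma Der_comm_eq: "Der_comm U J = (Der U J)\<lparr>carrier := T\<rparr>"
  by (simp add: Der_def Der_comm_def)

lemma Out_incl_eq: "Out_incl U J = QC.incl"
  by (simp add: Out_incl_def QC.incl_def Der_comm_eq)

lemma N_eq: "Out_incl U J ` carrier (Out_comm U J) = QC.image_TS"
  unfolding Out_incl_eq Out_comm_def Der_comm_eq by (rule QC.incl_image)

text \<open>The nested option type supplies exactly n + 2 indices.\<close>

definition outer :: "'n option option \<Rightarrow> ('k, 'n) laurent \<Rightarrow> ('k, 'n) laurent" where
  "outer j = (case j of None \<Rightarrow> Delta | Some None \<Rightarrow> D_mtheta | Some (Some i) \<Rightarrow> D_ind i)"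

lemma outer_derivation: "outer j \<in> derivations U J"
  using Delta_derivation D_mtheta_derivation D_ind_derivation
  by (auto simp: outer_def split: option.split)

lemma sum_option: "(\<Sum>j\<in>(UNIV :: 'a::finite option set). g j) = g None + (\<Sum>i\<in>UNIV. g (Some i))"
  unfolding UNIV_option_conv by (subst sum.insert) (auto simp: sum.reindex)

lemma combination_functionals:
  "qf (\<lambda>u. \<Sum>j\<in>UNIV. lscale (c j) (outer j u)) = c None * Delta_const TYPE('n)"
  "zf (\<lambda>u. \<Sum>j\<in>UNIV. lscale (c j) (outer j u)) = c (Some None)"
  "pf i (\<lambda>u. \<Sum>j\<in>UNIV. lscale (c j) (outer j u)) = c (Some (Some i))"
  unfolding functional_sum functional_scale
  unfolding sum_option outer_def
  by (simp_all add: Delta_functionals D_mtheta_functionals D_ind_functionals if_distrib cong: if_cong)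

lemma outer_combination:
  "(\<Oplus>\<^bsub>Der U J\<^esub>j\<in>UNIV. d j \<odot>\<^bsub>Der U J\<^esub> outer j) = (\<lambda>u. \<Sum>j\<in>UNIV. lscale (d j) (outer j u))"
  by (rule Der_combination) (use outer_derivation in auto)

lemma Out_basis: "fin_basis (Out U J) UNIV (\<lambda>j. Inn U J +>\<^bsub>Der U J\<^esub> outer j)"
  unfolding Out_def
proof (rule QC.quot_basis)
  fix D assume "D \<in> carrier (Der U J)"
  then have D: "D \<in> derivations U J" by (simp add: Der_simps)
  obtain c z p E where E: "E \<in> Inn U J"
    "D = (\<lambda>u. lscale c (Delta u) + lscale z (D_mtheta u) + (\<Sum>i\<in>UNIV. lscale (p i) (D_ind i u)) + E u)"
    by (rule Der_mod_Inn[OF D], rule that)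
  define d where "d j = (case j of None \<Rightarrow> c | Some None \<Rightarrow> z | Some (Some i) \<Rightarrow> p i)" for j
  have s: "(\<lambda>u. \<Sum>j\<in>UNIV. lscale (d j) (outer j u)) \<in> derivations U J"
    using QC.combination_in[of outer UNIV d] outer_derivation
    unfolding outer_combination by (simp add: Der_simps)
  have e: "D \<ominus>\<^bsub>Der U J\<^esub> (\<Oplus>\<^bsub>Der U J\<^esub>j\<in>UNIV. d j \<odot>\<^bsub>Der U J\<^esub> outer j) = E"
    unfolding outer_combination Der_minus[OF D s]
    by (simp add: E(2) sum_option d_def outer_def fun_eq_iff)
  show "\<exists>d. D \<ominus>\<^bsub>Der U J\<^esub> (\<Oplus>\<^bsub>Der U J\<^esub>j\<in>UNIV. d j \<odot>\<^bsub>Der U J\<^esub> outer j) \<in> Inn U J"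
    by (rule exI[of _ d]) (unfold e, rule E(1))
next
  fix c :: "'n option option \<Rightarrow> 'k" and j
  assume "(\<Oplus>\<^bsub>Der U J\<^esub>j\<in>UNIV. c j \<odot>\<^bsub>Der U J\<^esub> outer j) \<in> Inn U J"
  then have "(\<lambda>u. \<Sum>j\<in>UNIV. lscale (c j) (outer j u)) \<in> Inn U J"
    unfolding outer_combination .
  from Inn_functionals[OF this] show "c j = 0"
    unfolding combination_functionals using Delta_const_neq_0 by (cases j rule: option.exhaust) (auto, metis option.exhaust)
qed (use outer_derivation in \<open>auto simp: Der_simps\<close>)

lemma Out_comm_basis: "fin_basis (Out_comm U J) UNIV (\<lambda>i. Inn U J +>\<^bsub>Der_comm U J\<^esub> D_ind i)"
  unfolding Out_comm_def Der_comm_eq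
proof (rule QC.T.quot_basis)
  have comb: "(\<Oplus>\<^bsub>QC.VT\<^esub>i\<in>UNIV. c i \<odot>\<^bsub>QC.VT\<^esub> D_ind i) = (\<lambda>u. \<Sum>i\<in>UNIV. lscale (c i) (D_ind i u))" for c :: "'n \<Rightarrow> 'k"
  proof -
    have "(\<Oplus>\<^bsub>QC.VT\<^esub>i\<in>UNIV. c i \<odot>\<^bsub>QC.VT\<^esub> D_ind i) = (\<Oplus>\<^bsub>Der U J\<^esub>i\<in>UNIV. c i \<odot>\<^bsub>Der U J\<^esub> D_ind i)"
      using finsum_subspace[OF QC.vec_space T_subspace, of "\<lambda>i. c i \<odot>\<^bsub>Der U J\<^esub> D_ind i" UNIV]
        D_ind_derivation T_closed(2) by (simp add: Der_simps Pi_iff)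
    then show ?thesis using Der_combination[of D_ind UNIV c] D_ind_derivation by simp
  qed
  have combT: "(\<lambda>u. \<Sum>i\<in>UNIV. lscale (c i) (D_ind i u)) \<in> T" for c :: "'n \<Rightarrow> 'k"
    using QC.T.combination_in[of D_ind UNIV c] D_ind_derivation unfolding comb by simp
  fix D assume "D \<in> carrier QC.VT"
  then have D: "D \<in> derivations U J" "D \<in> comm_derivations U" by auto
  obtain c z p E where E: "E \<in> Inn U J"
    "D = (\<lambda>u. lscale c (Delta u) + lscale z (D_mtheta u) + (\<Sum>i\<in>UNIV. lscale (p i) (D_ind i u)) + E u)"
    by (rule Der_mod_Inn[OF D(1)], rule that)
  have "qf D = 0" "zf D = 0" using comm_iff[OF D(1)] D(2) by auto
  then have cz: "c = 0" "z = 0"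
    unfolding E(2) functional_add functional_scale functional_sum
    using Inn_functionals[OF E(1)] Delta_const_neq_0
    by (simp_all add: Delta_functionals D_mtheta_functionals D_ind_functionals)
  have "\<ominus>\<^bsub>QC.VT\<^esub> F = (\<lambda>u. - F u)" if "F \<in> T" for F
    using QC.T.minus_eq_smult[of F] that by (simp add: Der_simps)
  then have e: "D \<ominus>\<^bsub>QC.VT\<^esub> (\<Oplus>\<^bsub>QC.VT\<^esub>i\<in>UNIV. p i \<odot>\<^bsub>QC.VT\<^esub> D_ind i) = E"
    unfolding comb using combT[of p] by (simp add: a_minus_def Der_simps E(2) cz fun_eq_iff)
  show "\<exists>p. D \<ominus>\<^bsub>QC.VT\<^esub> (\<Oplus>\<^bsub>QC.VT\<^esub>i\<in>UNIV. p i \<odot>\<^bsub>QC.VT\<^esub> D_ind i) \<in> Inn U J"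
    by (rule exI[of _ p]) (unfold e, rule E(1))
next
  fix c :: "'n \<Rightarrow> 'k" and i
  have "(\<Oplus>\<^bsub>QC.VT\<^esub>i\<in>UNIV. c i \<odot>\<^bsub>QC.VT\<^esub> D_ind i) = (\<Oplus>\<^bsub>Der U J\<^esub>i\<in>UNIV. c i \<odot>\<^bsub>Der U J\<^esub> D_ind i)"
    using finsum_subspace[OF QC.vec_space T_subspace, of "\<lambda>i. c i \<odot>\<^bsub>Der U J\<^esub> D_ind i" UNIV]
      D_ind_derivation T_closed(2) by (simp add: Der_simps Pi_iff)
  moreover assume "(\<Oplus>\<^bsub>QC.VT\<^esub>i\<in>UNIV. c i \<odot>\<^bsub>QC.VT\<^esub> D_ind i) \<in> Inn U J"
  ultimately have "(\<lambda>u. \<Sum>i\<in>UNIV. lscale (c i) (D_ind i u)) \<in> Inn U J"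
    using Der_combination[of D_ind UNIV c] D_ind_derivation by simp
  from Inn_functionals(3)[OF this, of i] show "c i = 0"
    unfolding functional_sum functional_scale by (simp add: D_ind_functionals if_distrib cong: if_cong)
qed (use D_ind_derivation in auto)

lemma Out_Out_comm_basis:
  "fin_basis (quot (Out U J) QC.image_TS) UNIV
    (\<lambda>b. QC.image_TS +>\<^bsub>Out U J\<^esub> (Inn U J +>\<^bsub>Der U J\<^esub> (if b then Delta else D_mtheta)))"
  unfolding Out_def
proof (rule QC.quot_quot_basis)
  let ?b = "\<lambda>b. if b then Delta else D_mtheta :: ('k, 'n) laurent \<Rightarrow> ('k, 'n) laurent"
  have b: "?b \<in> UNIV \<rightarrow> derivations U J" using Delta_derivation D_mtheta_derivation by auto
  have comb: "(\<Oplus>\<^bsub>Der U J\<^esub>j\<in>UNIV. d j \<odot>\<^bsub>Der U J\<^esub> ?b j) =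
      (\<lambda>u. lscale (d False) (D_mtheta u) + lscale (d True) (Delta u))" for d :: "bool \<Rightarrow> 'k"
    using Der_combination[OF b] by (simp add: UNIV_bool)
  have combD: "(\<lambda>u. lscale (d False) (D_mtheta u) + lscale (d True) (Delta u)) \<in> derivations U J" for d :: "bool \<Rightarrow> 'k"
    by (intro derivations_laurent_closed Delta_derivation D_mtheta_derivation)
  {
    fix D assume "D \<in> carrier (Der U J)"
    then have D: "D \<in> derivations U J" by (simp add: Der_simps)
    \<comment> \<open>The coefficients are read off by the functionals, so that the remainder lies
      in their common kernel.\<close>
    define d where "d b = (if b then qf D / Delta_const TYPE('n) else zf D)" for b
    let ?E = "\<lambda>u. D u + lscale (-1) (lscale (d False) (D_mtheta u) + lscale (d True) (Delta u))"
    have "?E \<in> derivations U J"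
      by (rule derivations_laurent_closed(1)[OF D derivations_laurent_closed(2)[OF combD]])
    moreover have "qf ?E = 0" "zf ?E = 0"
      unfolding functional_add functional_scale using Delta_const_neq_0
      by (simp_all add: Delta_functionals D_mtheta_functionals d_def)
    ultimately have ET: "?E \<in> T" using comm_iff[of ?E] by simp
    have e: "D \<ominus>\<^bsub>Der U J\<^esub> (\<Oplus>\<^bsub>Der U J\<^esub>j\<in>UNIV. d j \<odot>\<^bsub>Der U J\<^esub> ?b j) = ?E"
      unfolding comb Der_minus[OF D combD] by (simp add: fun_eq_iff)
    show "\<exists>d. D \<ominus>\<^bsub>Der U J\<^esub> (\<Oplus>\<^bsub>Der U J\<^esub>j\<in>UNIV. d j \<odot>\<^bsub>Der U J\<^esub> ?b j) \<in> T"
      by (rule exI[of _ d]) (unfold e, rule ET)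
  }
  {
    fix d :: "bool \<Rightarrow> 'k" and i
    assume "(\<Oplus>\<^bsub>Der U J\<^esub>j\<in>UNIV. d j \<odot>\<^bsub>Der U J\<^esub> ?b j) \<in> T"
    then have "qf (\<lambda>u :: ('k, 'n) laurent. lscale (d False) (D_mtheta u) + lscale (d True) (Delta u)) = 0"
      "zf (\<lambda>u :: ('k, 'n) laurent. lscale (d False) (D_mtheta u) + lscale (d True) (Delta u)) = 0"
      unfolding comb using comm_iff[OF combD] by auto
    then show "d i = 0"
      unfolding functional_add functional_scale using Delta_const_neq_0
      by (cases i) (simp_all add: Delta_functionals D_mtheta_functionals)
  }
qed (use Delta_derivation D_mtheta_derivation in \<open>auto simp: Der_simps\<close>)

lemma short_exact_Out:
  "\<exists>g. short_exact (Out_comm U J) (Out U J) (coord_space :: ('k, 'k ^ 2) module) (Out_incl U J) g"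
  unfolding Out_incl_eq Out_comm_def Out_def Der_comm_eq
proof (rule QC.short_exact_quot)
  \<comment> \<open>The pair of functionals has kernel \<open>T\<close> by \<open>comm_iff\<close>;
    it is onto because their values on \<open>Delta\<close> and \<open>D_mtheta\<close> form a
    diagonal matrix with nonzero diagonal.\<close>
  let ?\<phi> = "\<lambda>D :: ('k, 'n) laurent \<Rightarrow> ('k, 'n) laurent. (\<chi> i. if i = 1 then qf D else zf D) :: 'k ^ 2"
  have cs: "carrier (coord_space :: ('k, 'k ^ 2) module) = UNIV"
    "\<And>x y. x \<oplus>\<^bsub>coord_space :: ('k, 'k ^ 2) module\<^esub> y = x + y" "\<And>c x. c \<odot>\<^bsub>coord_space :: ('k, 'k ^ 2) module\<^esub> x = c *s x"
    "\<zero>\<^bsub>coord_space :: ('k, 'k ^ 2) module\<^esub> = 0"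
    by (simp_all add: coord_space_def type_space_def)
  have "vec_space (coord_space :: ('k, 'k ^ 2) module)"
    unfolding coord_space_def by (rule vec_space_type_space) (auto simp: vec_eq_iff algebra_simps)
  then show "lin_map (Der U J) coord_space ?\<phi>"
    unfolding lin_map_def using U.Der_vec_space
    by (simp add: cs Der_simps functional_add functional_scale vec_eq_iff)
  show "?\<phi> D = \<zero>\<^bsub>coord_space\<^esub> \<longleftrightarrow> D \<in> T" if "D \<in> carrier (Der U J)" for D
    using comm_iff[of D] that by (auto simp: cs Der_simps vec_eq_iff forall_2)
  show "?\<phi> ` carrier (Der U J) = carrier coord_space"
  proof -
    have "x \<in> ?\<phi> ` derivations U J" for x
    proof -
      let ?D = "\<lambda>u. lscale (x $ 1 / Delta_const TYPE('n)) (Delta u) + lscale (x $ 2) (D_mtheta u) :: ('k, 'n) laurent"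
      have D: "?D \<in> derivations U J"
        by (intro derivations_laurent_closed Delta_derivation D_mtheta_derivation)
      have "?\<phi> ?D = x"
        unfolding functional_add functional_scale using Delta_const_neq_0
        by (simp add: vec_eq_iff forall_2 Delta_functionals D_mtheta_functionals)
      then show ?thesis by (intro image_eqI[OF _ D]) (rule sym)
    qed
    then show ?thesis by (auto simp: cs Der_simps)
  qed
qed

end

section \<open>Commutators of homogeneous maps, and exponents the Jacobian kills or misses\<close>

lemma hmap_hmap: "hmap f \<sigma> (hmap g \<tau> u) = hmap (\<lambda>b. f (b + \<tau>) * g b) (\<sigma> + \<tau>) u"
  by (rule poly_mapping_eqI) (simp add: lookup_hmap diff_diff_eq2 diff_diff_eq algebra_simps)

lemma hmap_diff: "hmap f \<sigma> u - hmap g \<sigma> u = hmap (\<lambda>b. f b - g b) \<sigma> u"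
  by (rule poly_mapping_eqI) (simp add: lookup_hmap lookup_minus algebra_simps)

lemma hmap_scale: "hmap (\<lambda>b. c * f b) \<sigma> u = lscale c (hmap f \<sigma> u)"
  by (rule poly_mapping_eqI) (simp add: lookup_hmap algebra_simps)

definition commutator :: "(('k::field, 'n::finite) laurent \<Rightarrow> ('k, 'n) laurent) \<Rightarrow>
    (('k, 'n) laurent \<Rightarrow> ('k, 'n) laurent) \<Rightarrow> ('k, 'n) laurent \<Rightarrow> ('k, 'n) laurent" where
  "commutator D E = (\<lambda>u. D (E u) - E (D u))"

lemma commutator_hmap:
  "commutator (hmap f \<sigma>) (hmap g \<tau>) = hmap (\<lambda>b. f (b + \<tau>) * g b - g (b + \<sigma>) * f b) (\<sigma> + \<tau>)"
  unfolding commutator_def hmap_hmap by (simp add: add.commute[of \<tau> \<sigma>] hmap_diff)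

lemma Jac_one: "Jac (u(k := 1)) = 0"
proof -
  have *: "(\<chi> i. part_deriv i (1 :: ('b::field, 'a::finite) laurent)) = 0"
    unfolding xpow_0[symmetric] part_deriv_xpow by (simp add: vec_eq_iff)
  show ?thesis unfolding Jac_rows_upd * by (rule det_row_0)
qed

lemma Jac_lookup_mtheta: "coef (Jac u) (- theta) = 0"
proof (induction u rule: multilinear_induct)
  case (xpow \<beta>)
  then show ?case using idet_sum_zero[of \<beta>] by (auto simp: Jac_xpow lookup_single_if)
qed (simp_all add: Jac_add Jac_lscale lookup_add del: fun_upd_apply)

lemma (in nlie) swap_position_ex:
  assumes a: "a \<in> UNIV \<rightarrow> carrier V"
  shows "\<exists>a' s. a' \<in> UNIV \<rightarrow> carrier V \<and> s \<noteq> 0 \<and>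
    (\<forall>x\<in>carrier V. \<omega> (a(j := x)) = s \<odot> \<omega> (a'(m := x)))"
  using swap_position[OF a zero_closed, where j=j and m=m] by metis

context jacobian
begin

subsection \<open>Brackets with derivations of both structures\<close>

text \<open>On \<open>T\<close> the functionals vanish, so in \<open>Der_structure\<close> the
  multiples of \<open>Delta\<close> and \<open>D_mtheta\<close> drop out and only linear weights
  remain.\<close>

lemma T_induct [consumes 1, case_names hmap add zero]:
  assumes E: "E \<in> T"
    and hmap: "\<And>l \<sigma>. pairing l (\<sigma> + theta) = 0 \<Longrightarrow> P (hmap (pairing l) \<sigma>)"
    and add: "\<And>D E. P D \<Longrightarrow> P E \<Longrightarrow> P (\<lambda>u. D u + E u)" and zero: "P (\<lambda>u. 0)"
  shows "P E"
proof -
  have E': "E \<in> derivations U J" "qf E = 0" "zf E = 0" using E comm_iff by auto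
  obtain c z F l where F: "finite F" "\<forall>\<sigma>. pairing (l \<sigma>) (\<sigma> + theta) = 0"
    "E = (\<lambda>u. lscale c (Delta u) + lscale z (D_mtheta u) + (\<Sum>\<sigma>\<in>F. hmap (pairing (l \<sigma>)) \<sigma> u))"
    by (rule Der_structure[OF E'(1)], rule that)
  have "c = 0" "z = 0"
    using E'(2,3) F(2) Delta_const_neq_0 unfolding F(3) functional_add functional_scale functional_sum
    by (simp_all add: pairing_hmap_functionals Delta_functionals D_mtheta_functionals)
  then have "E = (\<lambda>u. \<Sum>\<sigma>\<in>F. hmap (pairing (l \<sigma>)) \<sigma> u)" using F(3) by simp
  moreover have "P (\<lambda>u. \<Sum>\<sigma>\<in>G. hmap (pairing (l \<sigma>)) \<sigma> u)" if "finite G" for G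
    using that
  proof (induction G)
    case (insert \<sigma> G)
    have "(\<lambda>u. \<Sum>\<sigma>\<in>insert \<sigma> G. hmap (pairing (l \<sigma>)) \<sigma> u) =
        (\<lambda>u. hmap (pairing (l \<sigma>)) \<sigma> u + (\<Sum>\<sigma>\<in>G. hmap (pairing (l \<sigma>)) \<sigma> u))"
      using insert by simp
    then show ?case using add[OF hmap insert.IH] F(2) by simp
  qed (simp add: zero)
  ultimately show ?thesis using F(1) by simp
qed

lemma hmap_T: "pairing l (\<sigma> + theta) = 0 \<Longrightarrow> hmap (pairing l) \<sigma> \<in> T"
  by (intro IntI hmap_pairing_comm hmap_pairing_derivation)

lemma T_sum: "(\<And>a. F a \<in> T) \<Longrightarrow> (\<lambda>u. \<Sum>a\<in>A. F a u) \<in> T"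
proof (induction A rule: infinite_finite_induct)
  case (insert a A)
  then show ?case using T_closed(1)[of "F a" "\<lambda>u. \<Sum>a\<in>A. F a u"] by simp
qed (use T_closed(3) in simp_all)

text \<open>For homogeneous E of degree \<tau>, \<open>Delta\<close> acts by the scalar |\<tau>|,
  \<open>D_mtheta\<close> commutes with E, and two linear weights give a linear weight
  again.\<close>

lemma commutator_T:
  assumes D: "D \<in> derivations U J" and E: "E \<in> T"
  shows "commutator D E \<in> T"
proof -
  obtain c z F m where F: "finite F" "\<forall>\<sigma>. pairing (m \<sigma>) (\<sigma> + theta) = 0"
    "D = (\<lambda>u. lscale c (Delta u) + lscale z (D_mtheta u) + (\<Sum>\<sigma>\<in>F. hmap (pairing (m \<sigma>)) \<sigma> u))"
    by (rule Der_structure[OF D], rule that)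
  have lin: "linear_map D" using D by (simp add: derivations_laurent)
  show ?thesis
    using E
  proof (induction E rule: T_induct)
    case (hmap l \<tau>)
    let ?E = "hmap (pairing l) \<tau> :: ('k, 'n) laurent \<Rightarrow> _"
    have lE: "linear_map ?E" by (rule linear_hmap)
    have 1: "commutator Delta ?E = (\<lambda>u. lscale (pairing (\<chi> i. 1) \<tau>) (?E u))"
      unfolding Delta_hmap commutator_hmap hmap_scale[symmetric, abs_def]
      by (rule arg_cong2[of _ _ _ _ hmap]) (auto simp: algebra_simps)
    \<comment> \<open>One product is supported at b = -(\<tau> + \<theta>), where \<lambda>
      vanishes; the other at b = -\<theta>, where \<lambda>(b + \<theta>) = 0.\<close>
    have 2: "commutator D_mtheta ?E = (\<lambda>u. 0)"
    proof -
      have "(if b + \<tau> = - theta then 1 else 0) * pairing l b - pairing l (b + theta) * (if b = - theta then 1 else 0) = 0" for b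
      proof -
        have "pairing l b = 0" if "b + \<tau> = - theta"
        proof -
          have "b = (b + \<tau>) - \<tau>" by simp
          also have "\<dots> = - (\<tau> + theta)" unfolding that by simp
          finally have b: "b = - (\<tau> + theta)" .
          show ?thesis unfolding b pairing_simps(4) hmap by simp
        qed
        then show ?thesis by (cases "b + \<tau> = - theta"; cases "b = - theta") simp_all
      qed
      then show ?thesis unfolding D_mtheta_hmap commutator_hmap
        by (intro ext poly_mapping_eqI) (simp add: lookup_hmap)
    qed
    have 3: "commutator (hmap (pairing (m \<sigma>)) \<sigma>) ?E \<in> T" for \<sigma>
    proof -
      \<comment> \<open>The weight of the commutator; at \<sigma> + \<tau> + \<theta> the two
        relations for \<open>l\<close> and \<open>m \<sigma>\<close> leave two cancelling
        terms.\<close>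
      let ?q = "pairing (m \<sigma>) \<tau> *s l - pairing l \<sigma> *s m \<sigma>"
      have q: "pairing ?q b = pairing (m \<sigma>) \<tau> * pairing l b - pairing l \<sigma> * pairing (m \<sigma>) b" for b
        by (simp add: pairing_def[of ?q] pairing_def[of l b] pairing_def[of "m \<sigma>" b]
            left_diff_distrib sum_subtractf sum_distrib_left mult.assoc)
      have "commutator (hmap (pairing (m \<sigma>)) \<sigma>) ?E = hmap (pairing ?q) (\<sigma> + \<tau>)"
        unfolding commutator_hmap
        by (rule arg_cong2[of _ _ _ _ hmap]) (auto simp: q algebra_simps)
      moreover have "pairing ?q (\<sigma> + \<tau> + theta) = 0"
      proof -
        have "pairing (m \<sigma>) \<sigma> = - pairing (m \<sigma>) theta" "pairing l \<tau> = - pairing l theta"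
          using F(2) hmap by (simp_all add: eq_neg_iff_add_eq_0)
        then show ?thesis by (simp add: q algebra_simps)
      qed
      ultimately show ?thesis using hmap_T by metis
    qed
    have "commutator D ?E = (\<lambda>u. (lscale c (commutator Delta ?E u) + lscale z (commutator D_mtheta ?E u)) +
        (\<Sum>\<sigma>\<in>F. commutator (hmap (pairing (m \<sigma>)) \<sigma>) ?E u))"
      unfolding commutator_def F(3) linear_mapD[OF lE] by (simp add: sum_subtractf algebra_simps)
    also have "\<dots> \<in> T"
      unfolding 1 2 by (intro T_closed T_sum 3 hmap_T hmap)
    finally show ?case .
  next
    case (add A B)
    have "commutator D (\<lambda>u. A u + B u) = (\<lambda>u. commutator D A u + commutator D B u)"
      unfolding commutator_def linear_mapD(1)[OF lin] by (simp add: algebra_simps)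
    then show ?case using T_closed(1)[OF add] by simp
  next
    case zero
    then show ?case using T_closed(3) by (simp add: commutator_def linear_mapD(3)[OF lin])
  qed
qed

lemma Der_mult: "D \<otimes>\<^bsub>Der U J\<^esub> E = commutator D E"
  by (simp add: Der_def gl_def commutator_def)

lemma commutator_Inn:
  assumes "D \<in> derivations U J" "E \<in> Inn U J"
  shows "commutator D E \<in> Inn U J"
  using U.bracket_left_mult[OF assms] by (simp add: gl_def commutator_def)

text \<open>The bracket of cosets is a union over both sets of representatives, so its independence
  of each representative is checked before \<open>commutator_T\<close> is applied.\<close>

lemma lie_ideal_Out: "lie_ideal (Out U J) QC.image_TS"
  unfolding lie_ideal_def
proof (intro conjI ballI)
  show "vec_subspace (Out U J) QC.image_TS" unfolding Out_def by (rule QC.image_subspace)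
  fix X Y assume X: "X \<in> carrier (Out U J)" and Y: "Y \<in> QC.image_TS"
  obtain D where D: "D \<in> derivations U J" "X = Inn U J +>\<^bsub>Der U J\<^esub> D"
    using QC.quot_cases[of X] X by (auto simp: Out_def Der_simps)
  obtain E where E: "E \<in> T" "Y = Inn U J +>\<^bsub>Der U J\<^esub> E"
    using Y by (auto simp: QC.image_TS_def)
  have Ed: "E \<in> derivations U J" using E by simp
  have comm: "commutator A B \<in> derivations U J" if "A \<in> derivations U J" "B \<in> T" for A B
    using commutator_T[OF that] by simp
  have lin: "linear_map A" if "A \<in> derivations U J" for A
    using that by (simp add: derivations_laurent)
  have diff: "(\<lambda>u. A u - B u) \<in> Inn U J"
    if "A \<in> Inn U J +>\<^bsub>Der U J\<^esub> B" "B \<in> derivations U J" for A B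
    using QC.in_coset[of B A] QC.coset_eq_iff[of A B] that Der_minus[of A B] by (simp add: Der_simps)
  have mem: "A \<in> derivations U J" if "A \<in> Inn U J +>\<^bsub>Der U J\<^esub> B" "B \<in> derivations U J" for A B
    using QC.in_coset[of B A] that by (simp add: Der_simps)
  have memT: "B \<in> T" if B: "B \<in> Y" for B
  proof -
    have "(\<lambda>u. (B u - E u) + E u) \<in> T"
      by (rule T_closed(1)) (use diff[of B E] Inn_T B E Ed in auto)
    then show ?thesis by simp
  qed
  have 1: "Inn U J +>\<^bsub>Der U J\<^esub> commutator A B = Inn U J +>\<^bsub>Der U J\<^esub> commutator A E"
    if A: "A \<in> derivations U J" and B: "B \<in> Y" for A B
  proof -
    have "commutator A (\<lambda>u. B u - E u) \<in> Inn U J"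
      by (rule commutator_Inn[OF A]) (use diff[of B E] B E Ed in auto)
    moreover have "commutator A (\<lambda>u. B u - E u) = (\<lambda>u. commutator A B u - commutator A E u)"
    proof -
      have "A (v - w) = A v - A w" for v w
        using linear_mapD(1,2)[OF lin[OF A]] by (metis add_diff_cancel_right' diff_add_cancel)
      then show ?thesis by (simp add: commutator_def fun_eq_iff algebra_simps)
    qed
    ultimately show ?thesis
      using QC.coset_eq_iff comm[OF A memT[OF B]] comm[OF A E(1)] Der_minus by (simp add: Der_simps)
  qed
  have 2: "Inn U J +>\<^bsub>Der U J\<^esub> commutator A E = Inn U J +>\<^bsub>Der U J\<^esub> commutator D E"
    \<comment> \<open>The first representative changes by an interior derivation; antisymmetry turns
      this into a commutator of E with an interior derivation.\<close>
    if A: "A \<in> X" for A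
  proof -
    have Ad: "A \<in> derivations U J" using mem A D by blast
    have "(\<lambda>u. lscale (-1) (commutator E (\<lambda>u. A u - D u) u)) \<in> Inn U J"
      by (intro Inn_closed(2) commutator_Inn[OF Ed]) (use diff[of A D] A D in auto)
    moreover have "(\<lambda>u. lscale (-1) (commutator E (\<lambda>u. A u - D u) u)) = (\<lambda>u. commutator A E u - commutator D E u)"
    proof -
      have "E (v - w) = E v - E w" for v w
        using linear_mapD(1,2)[OF lin[OF Ed]] by (metis add_diff_cancel_right' diff_add_cancel)
      then show ?thesis by (simp add: commutator_def fun_eq_iff algebra_simps)
    qed
    ultimately show ?thesis
      using QC.coset_eq_iff comm[OF Ad E(1)] comm[OF D(1) E(1)] Der_minus by (simp add: Der_simps)
  qed
  have "X \<otimes>\<^bsub>Out U J\<^esub> Y = (\<Union>A\<in>X. \<Union>B\<in>Y. Inn U J +>\<^bsub>Der U J\<^esub> commutator A B)"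
    by (simp add: Out_def quot_def rcoset_mult_def Der_mult)
  also have "\<dots> = Inn U J +>\<^bsub>Der U J\<^esub> commutator D E"
  proof -
    have ne: "D \<in> X" "E \<in> Y" using QC.coset_self D E Ed by (auto simp: Der_simps)
    have "Inn U J +>\<^bsub>Der U J\<^esub> commutator A B = Inn U J +>\<^bsub>Der U J\<^esub> commutator D E"
      if "A \<in> X" "B \<in> Y" for A B
      using 1[OF mem[of A D] that(2)] 2[OF that(1)] that D by blast
    then show ?thesis using ne by blast
  qed
  finally show "X \<otimes>\<^bsub>Out U J\<^esub> Y \<in> QC.image_TS"
    using commutator_T[OF D(1) E(1)] by (auto simp: QC.image_TS_def)
qed

subsection \<open>Center and ideals\<close>

lemma lin_span_one: "lin_span U {1} = range (\<lambda>c. lscale c 1)"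
proof
  show "range (\<lambda>c. lscale c 1) \<subseteq> lin_span U {1}"
    using laurent.lin_span_superset[of "{1}"] laurent.subspaceD(4)[OF laurent.lin_span_subspace[of "{1}"]] by auto
  have "vec_subspace U (range (\<lambda>c. lscale c 1))"
    by (rule laurent.subspaceI)
      (auto simp: lscale_simps(3,4)[symmetric] simp del: lscale_simps(3,4) intro: image_eqI[of _ _ 0])
  then show "lin_span U {1} \<subseteq> range (\<lambda>c. lscale c 1)"
    by (rule laurent.lin_span_minimal) (auto intro: image_eqI[of _ _ 1])
qed

lemma constants_iff: "z \<in> lin_span U {1} \<longleftrightarrow> (\<forall>b. b \<noteq> 0 \<longrightarrow> coef z b = 0)"
  unfolding lin_span_one
proof
  assume "\<forall>b. b \<noteq> 0 \<longrightarrow> coef z b = 0"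
  then have "z = lscale (coef z 0) 1"
    by (intro poly_mapping_eqI) (auto simp: lookup_one when_def)
  then show "z \<in> range (\<lambda>c. lscale c 1)" by blast
qed (auto simp: lookup_one)

text \<open>Isolates one coefficient of \<open>z\<close>: a central element must have it zero
  whenever the minor is nonzero.\<close>

lemma Jac_pair_lookup:
  assumes "i \<noteq> j"
  shows "coef (J ((\<lambda>k. xpow (pair_tuple i j \<beta> b k))(i := z))) (\<beta> + b + pair_rest i j - theta) =
    coef z \<beta> * bracket i j \<beta> b"
proof -
  have \<beta>: "(pair_tuple i j \<beta> b) i = \<beta>" using assms by (simp add: pair_tuple_def)
  then have "(pair_tuple i j \<beta> b)(i := \<beta>) = pair_tuple i j \<beta> b" by (metis fun_upd_triv)
  then show ?thesis
    using lookup_Jac_upd[of "pair_tuple i j \<beta> b" i z 0] \<beta>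
    unfolding sum_pair_tuple[OF assms] by (simp add: idet_pair_tuple[OF assms] del: fun_upd_apply)
qed

lemma center_laurent: "center U J = lin_span U {1}"
proof
  show "center U J \<subseteq> lin_span U {1}"
  proof
    fix z assume z: "z \<in> center U J"
    show "z \<in> lin_span U {1}"
      unfolding constants_iff
    proof (intro allI impI)
      fix \<beta> :: "(int, 'n) vec" assume "\<beta> \<noteq> 0"
      then obtain i where i: "\<beta> $ i \<noteq> 0" by (auto simp: vec_eq_iff)
      obtain j where j: "i \<noteq> j" using ex_other_index[OF n] by metis
      \<comment> \<open>With the j-th standard vector as second exponent the minor is
        \<beta>_i.\<close>
      let ?a = "\<lambda>k. xpow (pair_tuple i j \<beta> (axis j 1) k) :: ('k, 'n) laurent"
      have "?a \<in> UNIV \<rightarrow> carrier U" by simp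
      from U.swap_position_ex[OF this, of i "Min UNIV"] obtain a s
        where "\<forall>x\<in>carrier U. J (?a(i := x)) = s \<odot>\<^bsub>U\<^esub> J (a(Min UNIV := x))"
        by blast
      then have a: "J (?a(i := x)) = lscale s (J (a(Min UNIV := x)))" for x
        by (simp del: fun_upd_apply)
      have "J (a(Min UNIV := z)) = 0" using z by (simp add: center_def)
      then have "coef (J (?a(i := z))) g = 0" for g unfolding a by simp
      then have "coef z \<beta> * bracket i j \<beta> (axis j 1) = 0"
        unfolding Jac_pair_lookup[OF j, symmetric] by simp
      then show "coef z \<beta> = 0" using i j by (simp add: bracket_def axis_def)
    qed
  qed
  show "lin_span U {1} \<subseteq> center U J"
    unfolding lin_span_one by (auto simp: center_def Jac_lscale Jac_one simp del: fun_upd_apply)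
qed

lemma constants_subspace: "vec_subspace U (lin_span U {1})"
  by (rule laurent.lin_span_subspace) simp

lemma constants_dim: "has_dim (U\<lparr>carrier := lin_span U {1}\<rparr>) 1"
proof -
  interpret C: vspace "U\<lparr>carrier := lin_span U {1}\<rparr>"
    by (rule vspace.intro[OF laurent.subspace_vec_space[OF constants_subspace]])
  have 1: "1 \<in> lin_span U {1}" using laurent.lin_span_superset[of "{1}"] by simp
  have comb: "(\<Oplus>\<^bsub>U\<lparr>carrier := lin_span U {1}\<rparr>\<^esub>i\<in>(UNIV :: unit set). c i \<odot>\<^bsub>U\<lparr>carrier := lin_span U {1}\<rparr>\<^esub> 1) = lscale (c ()) 1"
    for c :: "unit \<Rightarrow> 'k"
    using finsum_subspace[OF vec_space_laurent constants_subspace, of "\<lambda>i. lscale (c i) 1" "UNIV :: unit set"]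
      laurent.subspaceD(4)[OF constants_subspace 1] by (simp add: UNIV_unit)
  have "fin_basis (U\<lparr>carrier := lin_span U {1}\<rparr>) (UNIV :: unit set) (\<lambda>_. 1)"
  proof (rule C.fin_basisI)
    fix v assume "v \<in> carrier (U\<lparr>carrier := lin_span U {1}\<rparr>)"
    then obtain c where "v = lscale c 1" unfolding lin_span_one by auto
    then show "\<exists>c. v = (\<Oplus>\<^bsub>U\<lparr>carrier := lin_span U {1}\<rparr>\<^esub>i\<in>(UNIV :: unit set). c i \<odot>\<^bsub>U\<lparr>carrier := lin_span U {1}\<rparr>\<^esub> 1)"
      unfolding comb by auto
  next
    fix c :: "unit \<Rightarrow> 'k" and i
    assume "(\<Oplus>\<^bsub>U\<lparr>carrier := lin_span U {1}\<rparr>\<^esub>i\<in>(UNIV :: unit set). c i \<odot>\<^bsub>U\<lparr>carrier := lin_span U {1}\<rparr>\<^esub> 1) =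
      \<zero>\<^bsub>U\<lparr>carrier := lin_span U {1}\<rparr>\<^esub>"
    then have "lscale (c ()) 1 = (0 :: ('k, 'n) laurent)" unfolding comb by simp
    then have "coef (lscale (c ()) (1 :: ('k, 'n) laurent)) 0 = 0" by simp
    then show "c i = 0" by (cases i) simp
  qed (use 1 in auto)
  then show ?thesis by (rule C.fin_basis_has_dim) simp
qed

lemma laurent_bar_iff: "u \<in> (laurent_bar :: ('k, 'n) laurent set) \<longleftrightarrow> coef u (- theta) = 0"
proof
  have "vec_subspace U {u. coef u (- theta) = 0}"
    by (rule laurent.subspaceI) (auto simp: lookup_add)
  then have "laurent_bar \<subseteq> {u :: ('k, 'n) laurent. coef u (- theta) = 0}"
    unfolding laurent_bar_def by (rule laurent.lin_span_minimal) (auto simp: lookup_xpow)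
  then show "u \<in> laurent_bar \<Longrightarrow> coef u (- theta) = 0" by auto
  assume 0: "coef u (- theta) = 0"
  have "lscale (coef u g) (xpow g) \<in> laurent_bar" if "g \<in> supp u" for g
  proof -
    have "g \<noteq> - theta" using that 0 by (auto simp: in_keys_iff)
    then have "xpow g \<in> (laurent_bar :: ('k, 'n) laurent set)"
      unfolding laurent_bar_def using laurent.lin_span_superset by fastforce
    then show ?thesis
      using laurent.subspaceD(4)[OF laurent.lin_span_subspace] unfolding laurent_bar_def by fastforce
  qed
  then have "(\<Sum>g\<in>supp u. lscale (coef u g) (xpow g)) \<in> laurent_bar"
    unfolding laurent_bar_def
    using laurent.subspace_finsum[OF laurent.lin_span_subspace, of _ "\<lambda>g. lscale (coef u g) (xpow g)" "supp u"] by simp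
  then show "u \<in> laurent_bar" using laurent_expand[of u] by simp
qed

lemma laurent_bar_subspace: "vec_subspace U laurent_bar"
  unfolding laurent_bar_def by (rule laurent.lin_span_subspace) simp

lemma laurent_bar_ideal: "n_ideal U J laurent_bar"
  unfolding n_ideal_def using laurent_bar_subspace by (simp add: laurent_bar_iff Jac_lookup_mtheta)

lemma laurent_bar_codim: "has_dim (quot U laurent_bar) 1"
proof -
  interpret B: quotient_space U laurent_bar
    by (rule quotient_spaceI[OF vec_space_laurent laurent_bar_subspace])
  interpret QB: vspace "quot U laurent_bar" by (rule vspace.intro[OF B.quot_vec_space])
  have "fin_basis (quot U laurent_bar) (UNIV :: unit set) (\<lambda>_. laurent_bar +>\<^bsub>U\<^esub> xpow (- theta))"
  proof (rule B.quot_basis)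
    fix v :: "('k, 'n) laurent"
    show "\<exists>c. v \<ominus>\<^bsub>U\<^esub> (\<Oplus>\<^bsub>U\<^esub>i\<in>(UNIV :: unit set). c i \<odot>\<^bsub>U\<^esub> xpow (- theta)) \<in> laurent_bar"
      by (rule exI[of _ "\<lambda>_. coef v (- theta)"])
        (simp add: laurent_bar_iff lookup_minus lookup_xpow UNIV_unit)
  qed (auto simp: laurent_bar_iff lookup_xpow UNIV_unit)
  then show ?thesis by (rule QB.fin_basis_has_dim) simp
qed

lemma laurent_not_simple: "\<not> n_simple U J"
proof
  assume "n_simple U J"
  then have "laurent_bar = {0 :: ('k, 'n) laurent} \<or> laurent_bar = (UNIV :: ('k, 'n) laurent set)"
    using laurent_bar_ideal by (simp add: n_simple_def)
  moreover have "(1 :: ('k, 'n) laurent) \<in> laurent_bar"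
    by (simp add: laurent_bar_iff lookup_one vec_eq_iff theta_def)
  moreover have "xpow (- theta) \<notin> (laurent_bar :: ('k, 'n) laurent set)"
    by (simp add: laurent_bar_iff lookup_xpow)
  ultimately show False using zero_neq_one by (metis UNIV_I singletonD)
qed


subsection \<open>The factor algebra\<close>

abbreviation C where "C \<equiv> lin_span U {1}"
abbreviation bar where "bar \<equiv> laurent_bar :: ('k, 'n) laurent set"
abbreviation B where "B \<equiv> U\<lparr>carrier := laurent_bar\<rparr>"
abbreviation Q where "Q \<equiv> quot B C"
abbreviation OQ where "OQ \<equiv> quot_op B C J"
abbreviation cls where "cls x \<equiv> C +>\<^bsub>B\<^esub> x"
abbreviation induced where "induced \<equiv> quot_map B C B C"

lemma theta_neq: "theta \<noteq> (0 :: (int, 'n) vec)" "- theta \<noteq> (0 :: (int, 'n) vec)" "(0 :: (int, 'n) vec) \<noteq> - theta"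
  by (auto simp: vec_eq_iff theta_def)

lemma axis_neq: "axis i 1 \<noteq> (0 :: (int, 'n) vec)" "axis i 1 \<noteq> (- theta :: (int, 'n) vec)"
  "axis i 1 - theta \<noteq> (0 :: (int, 'n) vec)"
proof -
  show "axis i 1 \<noteq> (0 :: (int, 'n) vec)" by (simp add: axis_eq_0_iff)
  have "(axis i 1 :: (int, 'n) vec) $ i \<noteq> (- theta) $ i" by (simp add: theta_def)
  then show "axis i 1 \<noteq> (- theta :: (int, 'n) vec)" by metis
  obtain j where "j \<noteq> i" using ex_other_index[OF n] by blast
  then have "(axis i 1 - theta :: (int, 'n) vec) $ j \<noteq> 0" by (simp add: theta_def axis_def)
  then show "axis i 1 - theta \<noteq> (0 :: (int, 'n) vec)" by (metis zero_index)
qed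

lemma xpow_bar: "xpow b \<in> bar \<longleftrightarrow> b \<noteq> - theta"
  by (auto simp: laurent_bar_iff lookup_xpow)

lemma C_bar: "C \<subseteq> bar"
  using constants_iff laurent_bar_iff theta_neq by blast

lemma bar_closed: "u \<in> bar \<Longrightarrow> v \<in> bar \<Longrightarrow> u + v \<in> bar" "u \<in> bar \<Longrightarrow> v \<in> bar \<Longrightarrow> u - v \<in> bar"
  "u \<in> bar \<Longrightarrow> lscale c u \<in> bar" "0 \<in> bar" "J a \<in> bar"
  by (simp_all add: laurent_bar_iff lookup_add lookup_minus Jac_lookup_mtheta)

lemma bar_sum: "(\<And>a. a \<in> A \<Longrightarrow> g a \<in> bar) \<Longrightarrow> sum g A \<in> bar"
  by (induction A rule: infinite_finite_induct) (simp_all add: bar_closed)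

lemma B_simps [simp]: "carrier B = bar" "u \<oplus>\<^bsub>B\<^esub> v = u + v" "c \<odot>\<^bsub>B\<^esub> u = lscale c u" "\<zero>\<^bsub>B\<^esub> = 0"
  by simp_all

lemma B_vec_space: "vec_space B"
  by (rule laurent.subspace_vec_space[OF laurent_bar_subspace])

lemma C_subspace: "vec_subspace B C"
  by (rule subspace_of_subspace[OF vec_space_laurent laurent_bar_subspace constants_subspace C_bar])

sublocale QB: quotient_space B C
  by (rule quotient_spaceI[OF B_vec_space C_subspace])

lemma Q_vec_space: "vec_space Q"
  by (rule QB.quot_vec_space)

sublocale QV: vspace Q
  by (rule vspace.intro[OF Q_vec_space])

lemma B_minus: "u \<in> bar \<Longrightarrow> v \<in> bar \<Longrightarrow> u \<ominus>\<^bsub>B\<^esub> v = u - v"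
  using QB.minus_eq_smult[of v] by (simp add: a_minus_def)

lemma cls_eq_iff:
  assumes "x \<in> bar" "y \<in> bar"
  shows "cls x = cls y \<longleftrightarrow> (\<forall>b. b \<noteq> 0 \<longrightarrow> coef x b = coef y b)"
  using QB.coset_eq_iff[of x y] assms by (simp add: B_minus constants_iff lookup_minus)

lemma cls_in: "x \<in> bar \<Longrightarrow> cls x \<in> carrier Q"
  using QB.coset_in[of x] by simp

lemma Q_cases: "X \<in> carrier Q \<Longrightarrow> \<exists>x. x \<in> bar \<and> X = cls x"
  using QB.quot_cases[of X] by (metis B_simps(1))

lemma cls_add: "x \<in> bar \<Longrightarrow> y \<in> bar \<Longrightarrow> cls x \<oplus>\<^bsub>Q\<^esub> cls y = cls (x + y)"
  using QB.coset_add[of x y] by simp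

lemma cls_smult: "x \<in> bar \<Longrightarrow> c \<odot>\<^bsub>Q\<^esub> cls x = cls (lscale c x)"
  using QB.coset_smult[of x c] by simp

lemma cls_zero: "\<zero>\<^bsub>Q\<^esub> = cls 0"
  using QB.coset_zero by simp

lemma cls_sum:
  assumes "\<And>a. a \<in> A \<Longrightarrow> g a \<in> bar"
  shows "cls (sum g A) = (\<Oplus>\<^bsub>Q\<^esub>a\<in>A. cls (g a))"
proof -
  have "finsum B g A = sum g A"
    using finsum_subspace[OF vec_space_laurent laurent_bar_subspace, of g A] assms by simp
  then show ?thesis
    using lin_map_finsum[OF QB.lin_map_coset, of g A] assms by simp
qed

text \<open>An arbitrary choice of representatives in \<open>bar\<close>, without any
  linearity.\<close>

definition rep where "rep X = (SOME x. x \<in> bar \<and> X = cls x)"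

lemma rep: "X \<in> carrier Q \<Longrightarrow> rep X \<in> bar \<and> cls (rep X) = X"
proof -
  assume "X \<in> carrier Q"
  from someI_ex[OF Q_cases[OF this]] show ?thesis unfolding rep_def by blast
qed

lemma tuple_rep:
  assumes "A \<in> UNIV \<rightarrow> carrier Q"
  obtains a where "\<And>k. a k \<in> bar" "A = (\<lambda>k. cls (a k))"
proof
  show "rep (A k) \<in> bar" for k using rep[of "A k"] assms by auto
  show "A = (\<lambda>k. cls (rep (A k)))" using rep assms by (auto simp: fun_eq_iff)
qed

lemma cls_upd: "(\<lambda>k. cls (a k))(i := cls x) = (\<lambda>k. cls ((a(i := x)) k))"
  by (rule ext) simp

text \<open>Arguments are exchanged one at a time; each exchange adds a constant, which is
  central.\<close>

lemma Jac_mod_constants: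
  assumes "\<And>k. y k - x k \<in> C"
  shows "J y = J x"
proof -
  have "J (\<lambda>k. if k \<in> T then y k else x k) = J x" if "finite T" for T
    using that
  proof (induction T)
    case (insert i T)
    let ?w = "\<lambda>k. if k \<in> T then y k else x k"
    obtain c where c: "y i - x i = lscale c 1" using assms[of i] unfolding lin_span_one by blast
    have "(\<lambda>k. if k \<in> insert i T then y k else x k) = ?w(i := x i + lscale c 1)"
      using c[symmetric] by (auto simp: fun_eq_iff)
    then have "J (\<lambda>k. if k \<in> insert i T then y k else x k) = J (?w(i := x i))"
      by (simp only: Jac_add Jac_lscale Jac_one lscale_simps add_0_right)
    also have "?w(i := x i) = ?w" using insert.hyps by auto
    finally show ?case using insert.IH by simp
  qed simp
  from this[of UNIV] show ?thesis by simp
qed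

lemma op_cls:
  assumes "\<And>k. x k \<in> bar"
  shows "OQ (\<lambda>k. cls (x k)) = cls (J x)"
proof -
  have "cls (J y) = cls (J x)" if y: "y \<in> Pi UNIV (\<lambda>k. cls (x k))" for y
  proof -
    have "y k - x k \<in> C" for k
    proof -
      have "y k \<in> cls (x k)" using y by auto
      then have "y k \<in> bar" "cls (y k) = cls (x k)"
        using QB.in_coset[of "x k" "y k"] assms[of k] by auto
      then show ?thesis using QB.coset_eq_iff[of "y k" "x k"] assms[of k] by (simp add: B_minus)
    qed
    then show ?thesis by (simp only: Jac_mod_constants[of y x])
  qed
  moreover have "x \<in> Pi UNIV (\<lambda>k. cls (x k))"
    using QB.coset_self assms by auto
  ultimately have "(\<lambda>y. cls (J y)) ` Pi UNIV (\<lambda>k. cls (x k)) = {cls (J x)}" by blast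
  then show ?thesis unfolding quot_op_def by (metis ccpo_Sup_singleton)
qed

lemma op_cls_upd:
  assumes "\<And>k. a k \<in> bar" "x \<in> bar"
  shows "OQ ((\<lambda>k. cls (a k))(i := cls x)) = cls (J (a(i := x)))"
  unfolding cls_upd by (rule op_cls) (use assms in auto)

text \<open>The linear maps that pass to the factor space.\<close>

definition stable :: "(('k, 'n) laurent \<Rightarrow> ('k, 'n) laurent) \<Rightarrow> bool" where
  "stable D \<longleftrightarrow> linear_map D \<and> (\<forall>u\<in>bar. D u \<in> bar) \<and> (\<forall>u\<in>C. D u \<in> C)"

lemma stable_closed:
  "stable D \<Longrightarrow> stable E \<Longrightarrow> stable (\<lambda>u. D u + E u)" "stable D \<Longrightarrow> stable (\<lambda>u. lscale c (D u))"
  "stable (\<lambda>u. 0)"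
proof -
  note S = laurent.subspaceD[OF constants_subspace, simplified]
  show "stable D \<Longrightarrow> stable E \<Longrightarrow> stable (\<lambda>u. D u + E u)" "stable D \<Longrightarrow> stable (\<lambda>u. lscale c (D u))"
    using S(3) S(4) linear_map_closed(1)[of D E] linear_map_closed(2)[of D c] bar_closed
    by (auto simp: stable_def)
  show "stable (\<lambda>u. 0)" using S(2) bar_closed(4) by (simp add: stable_def linear_map_def)
qed

text \<open>Degree \<sigma> reaches -\<theta> only from -(\<sigma> + \<theta>), where the weight
  vanishes, so values lie in \<open>bar\<close>; constants are killed because the weight is zero at
  0.\<close>

lemma stable_T: "D \<in> T \<Longrightarrow> stable D"
proof (induction D rule: T_induct)
  case (hmap l \<sigma>)
  have 0: "pairing l (- theta - \<sigma>) = 0"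
  proof -
    have e: "- theta - \<sigma> = - (\<sigma> + theta)" by simp
    show ?thesis unfolding e pairing_simps(4) hmap by simp
  qed
  have 1: "coef (hmap (pairing l) \<sigma> u) (- theta) = 0" for u unfolding lookup_hmap 0 by simp
  have "hmap (pairing l) \<sigma> (lscale c 1) = 0" for c
    unfolding linear_mapD(2)[OF linear_hmap] xpow_0[symmetric] hmap_xpow by simp
  moreover have "0 \<in> C" by (simp add: constants_iff)
  ultimately show ?case
    unfolding stable_def lin_span_one using 1 by (auto simp: linear_hmap laurent_bar_iff)
qed (fact stable_closed)+

lemma stable_Delta: "stable Delta"
proof -
  have "Delta (lscale c (1 :: ('k, 'n) laurent)) = lscale (c * Delta_const TYPE('n)) 1" for c
    unfolding Delta_hmap linear_mapD(2)[OF linear_hmap] xpow_0[symmetric] hmap_xpow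
    by (simp add: single_eq_lscale)
  then show ?thesis
    unfolding stable_def lin_span_one Delta_hmap using theta_neq
    by (auto simp: linear_hmap laurent_bar_iff lookup_hmap simp del: lscale_simps(4))
qed

lemma stable_Inn: "D \<in> Inn U J \<Longrightarrow> stable D"
  using Inn_T stable_T by blast

lemma induced_cls:
  assumes D: "stable D" and x: "x \<in> bar"
  shows "induced D (cls x) = cls (D x)"
proof -
  have "cls x \<in> a_rcosets\<^bsub>B\<^esub> C" using cls_in[OF x] by (simp add: quot_def)
  then have "induced D (cls x) = (\<Union>y\<in>cls x. cls (D y))" by (simp add: quot_map_def)
  also have "\<dots> = cls (D x)"
  proof (rule QB.coset_Union)
    fix y assume "y \<in> cls x"
    then have y: "y \<in> bar" "cls y = cls x" using QB.in_coset[of x y] x by auto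
    then have "y - x \<in> C" using QB.coset_eq_iff[of y x] x by (simp add: B_minus)
    then have "D (y - x) \<in> C" using D by (simp add: stable_def)
    moreover have "D (y - x) + D x = D y"
      using linear_mapD(1)[of D "y - x" x] D by (simp add: stable_def)
    ultimately have "D y - D x \<in> C" by (metis add_diff_cancel_right')
    then show "cls (D y) = cls (D x)"
      using QB.coset_eq_iff[of "D y" "D x"] x y D by (simp add: B_minus stable_def)
  qed (use x in simp)
  finally show ?thesis .
qed

lemma induced_ext: "induced D \<in> extensional (carrier Q)"
  by (simp add: quot_map_def quot_def)

lemma induced_gl:
  assumes D: "stable D"
  shows "induced D \<in> carrier (gl Q)"
proof (rule QV.gl_I[OF induced_ext])
  have lin: "linear_map D" and bar: "\<And>u. u \<in> bar \<Longrightarrow> D u \<in> bar" using D by (auto simp: stable_def)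
  show "induced D X \<in> carrier Q" if "X \<in> carrier Q" for X
    using Q_cases[OF that] induced_cls[OF D] cls_in bar by metis
  show "induced D (X \<oplus>\<^bsub>Q\<^esub> Y) = induced D X \<oplus>\<^bsub>Q\<^esub> induced D Y" if XY: "X \<in> carrier Q" "Y \<in> carrier Q" for X Y
  proof -
    obtain x y where "x \<in> bar" "y \<in> bar" "X = cls x" "Y = cls y" using Q_cases XY by metis
    then show ?thesis
      by (simp add: cls_add induced_cls[OF D] bar_closed bar linear_mapD(1)[OF lin] del: QB.quot_sel)
  qed
  show "induced D (c \<odot>\<^bsub>Q\<^esub> X) = c \<odot>\<^bsub>Q\<^esub> induced D X" if X: "X \<in> carrier Q" for c X
  proof -
    obtain x where "x \<in> bar" "X = cls x" using Q_cases X by metis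
    then show ?thesis
      by (simp add: cls_smult induced_cls[OF D] bar_closed bar linear_mapD(2)[OF lin])
  qed
qed

lemma induced_add:
  assumes "stable D" "stable E"
  shows "induced (\<lambda>u. D u + E u) = induced D \<oplus>\<^bsub>gl Q\<^esub> induced E"
proof (rule QV.gl_eqI[OF induced_ext])
  fix X assume X: "X \<in> carrier Q"
  then obtain x where x: "x \<in> bar" "X = cls x" using Q_cases by metis
  have "D x \<in> bar" "E x \<in> bar" using assms x by (auto simp: stable_def)
  then show "induced (\<lambda>u. D u + E u) X = (induced D \<oplus>\<^bsub>gl Q\<^esub> induced E) X"
    using X x assms stable_closed(1)[OF assms]
    by (simp add: induced_cls cls_add del: QB.quot_sel)
qed simp

lemma induced_scale:
  assumes "stable D"
  shows "induced (\<lambda>u. lscale c (D u)) = c \<odot>\<^bsub>gl Q\<^esub> induced D"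
proof (rule QV.gl_eqI[OF induced_ext])
  fix X assume X: "X \<in> carrier Q"
  then obtain x where x: "x \<in> bar" "X = cls x" using Q_cases by metis
  have "D x \<in> bar" using assms x by (auto simp: stable_def)
  then show "induced (\<lambda>u. lscale c (D u)) X = (c \<odot>\<^bsub>gl Q\<^esub> induced D) X"
    using X x assms stable_closed(2)[OF assms]
    by (simp add: induced_cls cls_smult)
qed simp

lemma induced_derivation:
  assumes D: "stable D" and der: "D \<in> derivations U J"
  shows "induced D \<in> derivations Q OQ"
proof -
  have bar: "\<And>u. u \<in> bar \<Longrightarrow> D u \<in> bar" using D by (auto simp: stable_def)
  have "induced D (OQ A) = (\<Oplus>\<^bsub>Q\<^esub>i\<in>UNIV. OQ (A(i := induced D (A i))))" if A: "A \<in> UNIV \<rightarrow> carrier Q" for A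
  proof -
    obtain a where a: "\<And>k. a k \<in> bar" "A = (\<lambda>k. cls (a k))" using tuple_rep[OF A] by blast
    have "induced D (OQ A) = cls (D (J a))"
      unfolding a(2) op_cls[OF a(1)] by (rule induced_cls[OF D bar_closed(5)])
    also have "D (J a) = (\<Sum>i\<in>UNIV. J (a(i := D (a i))))" using der by (simp add: derivations_laurent)
    also have "cls \<dots> = (\<Oplus>\<^bsub>Q\<^esub>i\<in>UNIV. cls (J (a(i := D (a i)))))"
      by (rule cls_sum) (rule bar_closed(5))
    also have "(\<lambda>i. cls (J (a(i := D (a i))))) = (\<lambda>i. OQ (A(i := induced D (A i))))"
    proof
      fix i
      have "induced D (A i) = cls (D (a i))" unfolding a(2) by (rule induced_cls[OF D a(1)])
      then show "cls (J (a(i := D (a i)))) = OQ (A(i := induced D (A i)))"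
        using op_cls_upd[of a "D (a i)" i] a(1) bar by (simp only: a(2))
    qed
    finally show ?thesis .
  qed
  then show ?thesis using induced_gl[OF D] by (simp add: derivations_def)
qed

lemma induced_left_mult:
  assumes "\<And>k. a k \<in> bar"
  shows "left_mult Q OQ (\<lambda>k. cls (a k)) = induced (left_mult U J a)"
proof (rule QV.gl_eqI)
  fix X assume X: "X \<in> carrier Q"
  then obtain x where x: "x \<in> bar" "X = cls x" using Q_cases by metis
  have "stable (left_mult U J a)" by (rule stable_Inn, rule U.left_mult_Inn) simp
  then have "induced (left_mult U J a) X = cls (left_mult U J a x)" using induced_cls x by metis
  moreover have "left_mult Q OQ (\<lambda>k. cls (a k)) X = cls (J (a(Max UNIV := x)))"
    using X op_cls_upd[where i="Max UNIV", OF assms x(1)] by (simp only: left_mult_def restrict_apply' x(2))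
  ultimately show "left_mult Q OQ (\<lambda>k. cls (a k)) X = induced (left_mult U J a) X"
    by (simp only: left_mult_laurent)
qed (simp_all add: left_mult_def induced_ext)

lemma nlie_Q: "n_lie_algebra Q OQ"
proof -
  have "multilinear Q OQ"
    unfolding multilinear_def
  proof (intro ballI allI)
    fix A :: "'n \<Rightarrow> ('k, 'n) laurent set" and i assume A: "A \<in> UNIV \<rightarrow> carrier Q"
    obtain a where a: "\<And>k. a k \<in> bar" "A = (\<lambda>k. cls (a k))" using tuple_rep[OF A] by blast
    have op: "OQ (A(i := cls x)) = cls (J (a(i := x)))" if "x \<in> bar" for x
      unfolding a(2) by (rule op_cls_upd[OF a(1) that])
    show "lin_map Q Q (\<lambda>X. OQ (A(i := X)))"
    proof (rule QV.lin_mapI)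
      fix X assume "X \<in> carrier Q"
      then obtain x where x: "x \<in> bar" "X = cls x" using Q_cases by metis
      show "OQ (A(i := X)) \<in> carrier Q" unfolding x(2) op[OF x(1)] by (rule cls_in[OF bar_closed(5)])
      show "OQ (A(i := c \<odot>\<^bsub>Q\<^esub> X)) = c \<odot>\<^bsub>Q\<^esub> OQ (A(i := X))" for c
        unfolding x(2) cls_smult[OF x(1)] op[OF x(1)] op[OF bar_closed(3)[OF x(1)]] Jac_lscale
        by (rule cls_smult[OF bar_closed(5), symmetric])
      fix Y assume "Y \<in> carrier Q"
      then obtain y where y: "y \<in> bar" "Y = cls y" using Q_cases by metis
      show "OQ (A(i := X \<oplus>\<^bsub>Q\<^esub> Y)) = OQ (A(i := X)) \<oplus>\<^bsub>Q\<^esub> OQ (A(i := Y))"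
        unfolding x(2) y(2) cls_add[OF x(1) y(1)] op[OF x(1)] op[OF y(1)] op[OF bar_closed(1)[OF x(1) y(1)]] Jac_add
        by (rule cls_add[OF bar_closed(5) bar_closed(5), symmetric])
    qed
  qed
  moreover have "skew_symmetric Q OQ"
    unfolding skew_symmetric_def
  proof (intro ballI allI impI)
    fix A :: "'n \<Rightarrow> ('k, 'n) laurent set" and p :: "'n \<Rightarrow> 'n"
    assume A: "A \<in> UNIV \<rightarrow> carrier Q" and p: "p permutes UNIV"
    obtain a where a: "\<And>k. a k \<in> bar" "A = (\<lambda>k. cls (a k))" using tuple_rep[OF A] by blast
    have "A \<circ> p = (\<lambda>k. cls ((a \<circ> p) k))" by (auto simp: a(2))
    then have "OQ (A \<circ> p) = cls (J (a \<circ> p))" using op_cls[of "a \<circ> p"] a(1) by simp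
    then show "OQ (A \<circ> p) = of_int (sign p) \<odot>\<^bsub>Q\<^esub> OQ A"
      unfolding Jac_permute[OF p] a(2) op_cls[OF a(1)] cls_smult[OF bar_closed(5)] .
  qed
  moreover have "left_mult Q OQ A \<in> derivations Q OQ" if A: "A \<in> UNIV \<rightarrow> carrier Q" for A
  proof -
    obtain a where a: "\<And>k. a k \<in> bar" "A = (\<lambda>k. cls (a k))" using tuple_rep[OF A] by blast
    have L: "left_mult U J a \<in> Inn U J" by (rule U.left_mult_Inn) simp
    show ?thesis
      unfolding a(2) induced_left_mult[OF a(1)]
      by (rule induced_derivation[OF stable_Inn[OF L]]) (use L U.Inn_subset in blast)
  qed
  ultimately show ?thesis using Q_vec_space by (simp add: n_lie_algebra_def)
qed

sublocale QL: nlie Q OQ by (rule nlie.intro[OF nlie_Q])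

subsection \<open>Derivations of the factor algebra\<close>

text \<open>The coefficients of a chosen lift H satisfy the derivation identity off
  \<open>S0\<close>, so the classification applies to each degree. Linearity of H holds only modulo
  constants, that is, for coefficients at nonzero exponents.\<close>

lemma Der_Q_structure:
  assumes D: "D \<in> derivations Q OQ"
  obtains c E where "E \<in> T" "D = induced (\<lambda>u. lscale c (Delta u) + E u)"
proof -
  have Dgl: "D \<in> carrier (gl Q)" using D by (simp add: derivations_def)
  define H where "H u = rep (D (cls u))" for u
  have DH: "H u \<in> bar" "D (cls u) = cls (H u)" if "u \<in> bar" for u
    using rep[OF QV.gl_closed[OF Dgl cls_in[OF that]]] by (simp_all add: H_def)
  \<comment> \<open>At 0 coefficients are defined only modulo constants; at -\<theta> the monomial
    is missing from \<open>bar\<close>.\<close>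
  define S0 where "S0 = {0, - theta :: (int, 'n) vec}"
  define f where "f \<sigma> b = coef (H (xpow b)) (b + \<sigma>)" for \<sigma> b
  have hd: "hom_der (f \<sigma>) \<sigma> \<beta>"
    if \<beta>: "\<And>k. \<beta> k \<notin> S0" and g: "sum \<beta> UNIV - theta + \<sigma> \<notin> S0" for \<sigma> \<beta>
    unfolding f_def
  proof (rule coefficient_hom_der)
    let ?x = "\<lambda>k. xpow (\<beta> k) :: ('k, 'n) laurent"
    have x: "?x k \<in> bar" for k using \<beta>[of k] by (auto simp: xpow_bar S0_def)
    have X: "(\<lambda>k. cls (?x k)) \<in> UNIV \<rightarrow> carrier Q" using cls_in[OF x] by auto
    have g0: "sum \<beta> UNIV - theta + \<sigma> \<noteq> 0" using g by (auto simp: S0_def)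
    have "D (OQ (\<lambda>k. cls (?x k))) = (\<Oplus>\<^bsub>Q\<^esub>i\<in>UNIV. OQ ((\<lambda>k. cls (?x k))(i := D (cls (?x i)))))"
      using D X by (simp add: derivations_def)
    also have "(\<lambda>i. OQ ((\<lambda>k. cls (?x k))(i := D (cls (?x i))))) = (\<lambda>i. cls (J (?x(i := H (?x i)))))"
    proof
      fix i
      show "OQ ((\<lambda>k. cls (?x k))(i := D (cls (?x i)))) = cls (J (?x(i := H (?x i))))"
        unfolding DH(2)[OF x] by (rule op_cls_upd[OF x DH(1)[OF x]])
    qed
    also have "(\<Oplus>\<^bsub>Q\<^esub>i\<in>UNIV. cls (J (?x(i := H (?x i))))) = cls (\<Sum>i\<in>UNIV. J (?x(i := H (?x i))))"
      by (rule cls_sum[symmetric]) (rule bar_closed(5))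
    finally have e: "cls (H (J ?x)) = cls (\<Sum>i\<in>UNIV. J (?x(i := H (?x i))))"
      unfolding op_cls[OF x] DH(2)[OF bar_closed(5)] .
    show "coef (H (J ?x)) (sum \<beta> UNIV - theta + \<sigma>) =
        coef (\<Sum>i\<in>UNIV. J (?x(i := H (?x i)))) (sum \<beta> UNIV - theta + \<sigma>)"
      using cls_eq_iff[of "H (J ?x)" "\<Sum>i\<in>UNIV. J (?x(i := H (?x i)))",
          OF DH(1)[OF bar_closed(5)] bar_sum[OF bar_closed(5)]] e g0 by blast
    let ?q = "sum \<beta> UNIV - theta"
    have lin: "cls (H (lscale c u)) = cls (lscale c (H u))" if u: "u \<in> bar" for c u
      using QV.gl_hom(2)[OF Dgl cls_in[OF u], of c] u
      by (simp only: cls_smult DH bar_closed)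
    have coef0: "coef (H (lscale c u)) b = c * coef (H u) b" if "u \<in> bar" "b \<noteq> 0" for c u b
      using lin[OF that(1), of c] cls_eq_iff[of "H (lscale c u)" "lscale c (H u)"] DH(1) that bar_closed(3) by simp
    show "coef (H (lscale (idet \<beta>) (xpow ?q))) (?q + \<sigma>) = idet \<beta> * coef (H (xpow ?q)) (?q + \<sigma>)"
    proof (cases "?q = - theta")
      case True
      \<comment> \<open>The output monomial lies outside \<open>bar\<close> here, but its
        coefficient, the determinant, is zero.\<close>
      then have "sum \<beta> UNIV = 0" by simp
      then have z: "idet \<beta> = (0 :: 'k)" by (rule idet_sum_zero)
      have "coef (H (lscale 0 (xpow ?q))) (?q + \<sigma>) = 0"
        using coef0[OF bar_closed(4) g0, of 0] by simp
      then show ?thesis unfolding z by simp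
    next
      case False
      then show ?thesis using coef0[OF _ g0] xpow_bar by blast
    qed
  qed
  have "homogeneous_derivation (f \<sigma>) \<sigma> S0" for \<sigma>
    by unfold_locales (use n hd axis_neq in \<open>auto simp: S0_def\<close>)
  then have "\<exists>l k. (\<forall>v. v \<noteq> - theta \<longrightarrow> v + \<sigma> \<notin> S0 \<longrightarrow> f \<sigma> v = pairing l v + k) \<and>
      (\<sigma> \<noteq> 0 \<longrightarrow> k = 0) \<and> pairing l (\<sigma> + theta) = (1 - of_nat CARD('n)) * k" for \<sigma>
    using homogeneous_derivation.classification by metis
  then obtain l k where lk:
    "\<And>\<sigma> v. v \<noteq> - theta \<Longrightarrow> v + \<sigma> \<notin> S0 \<Longrightarrow> f \<sigma> v = pairing (l \<sigma>) v + k \<sigma>"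
    "\<And>\<sigma>. \<sigma> \<noteq> 0 \<Longrightarrow> k \<sigma> = 0" "\<And>\<sigma>. pairing (l \<sigma>) (\<sigma> + theta) = (1 - of_nat CARD('n)) * k \<sigma>"
    by metis
  define c where "c = k 0 / Delta_const TYPE('n)"
  define m where "m \<sigma> = (if \<sigma> = 0 then l 0 - c *s (\<chi> i. 1) else l \<sigma>)" for \<sigma>
  have pm: "pairing (m \<sigma>) v = pairing (l \<sigma>) v - (if \<sigma> = 0 then c * pairing (\<chi> i. 1) v else 0)" for \<sigma> v
    by (simp add: m_def pairing_def left_diff_distrib sum_subtractf sum_distrib_left)
  have m0: "pairing (m \<sigma>) (\<sigma> + theta) = 0" for \<sigma>
  proof (cases "\<sigma> = 0")
    case True
    have cd: "c * Delta_const TYPE('n) = k 0" unfolding c_def using Delta_const_neq_0 by simp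
    show ?thesis unfolding pm using True lk(3)[of 0]
      by (simp add: Delta_const_eq cd[symmetric] mult.left_commute)
  next
    case False
    then show ?thesis unfolding pm using lk(2,3)[of \<sigma>] by simp
  qed
  \<comment> \<open>Degrees that carry some x_i into \<open>S0\<close> are included as well, since
    the classification does not describe the coefficient there.\<close>
  define F where "F = {0} \<union> (\<Union>i. (\<lambda>g. g - axis i 1) ` (supp (H (xpow (axis i 1))) \<union> S0))"
  have F: "finite F" by (simp add: F_def S0_def)
  have out: "pairing (m \<sigma>) v = 0" if "\<sigma> \<notin> F" for \<sigma> v
  proof -
    have s: "\<sigma> \<noteq> 0" using that by (auto simp: F_def)
    have "l \<sigma> $ i = 0" for i
    proof -
      have "axis i 1 + \<sigma> \<notin> supp (H (xpow (axis i 1))) \<union> S0"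
      proof
        assume "axis i 1 + \<sigma> \<in> supp (H (xpow (axis i 1))) \<union> S0"
        then have "axis i 1 + \<sigma> - axis i 1 \<in> F" unfolding F_def by blast
        then show False using that by simp
      qed
      then have "f \<sigma> (axis i 1) = 0" "axis i 1 + \<sigma> \<notin> S0" by (auto simp: f_def in_keys_iff)
      then show ?thesis using lk(1)[of "axis i 1" \<sigma>] lk(2)[OF s] axis_neq by simp
    qed
    then show ?thesis unfolding pm using s by (simp add: pairing_def)
  qed
  define E where "E = (\<lambda>u. \<Sum>\<sigma>\<in>F. hmap (pairing (m \<sigma>)) \<sigma> u)"
  have ET: "E \<in> T" unfolding E_def by (rule T_sum, rule hmap_T, rule m0)
  let ?G = "\<lambda>u. lscale c (Delta u) + E u"
  have st: "stable ?G" by (intro stable_closed stable_Delta stable_T ET)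
  have Gbar: "?G u \<in> bar" if "u \<in> bar" for u using st that by (simp add: stable_def)
  have Glin: "linear_map ?G" using st by (simp add: stable_def)
  have mono: "D (cls (xpow b)) = induced ?G (cls (xpow b))" if b: "b \<noteq> - theta" for b
  proof -
    have xb: "xpow b \<in> bar" using b by (simp add: xpow_bar)
    have "coef (H (xpow b)) g = coef (?G (xpow b)) g" if g: "g \<noteq> 0" for g
    proof (cases "g = - theta")
      case True
      \<comment> \<open>This exponent lies in \<open>S0\<close>, but elements of \<open>bar\<close>
        have no coefficient there.\<close>
      then show ?thesis using DH(1)[OF xb] Gbar[OF xb] by (simp add: laurent_bar_iff)
    next
      case False
      define \<sigma> where "\<sigma> = g - b"
      have "coef (E (xpow b)) g = (\<Sum>\<tau>\<in>F. if \<tau> = \<sigma> then pairing (m \<tau>) b else 0)"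
        unfolding E_def lookup_sum by (rule sum.cong) (auto simp: hmap_xpow lookup_single_if \<sigma>_def algebra_simps)
      also have "\<dots> = pairing (m \<sigma>) b" using F out by simp
      finally have 1: "coef (E (xpow b)) g = pairing (m \<sigma>) b" .
      have 2: "coef (lscale c (Delta (xpow b))) g = (if \<sigma> = 0 then c * pairing (\<chi> i. 1) b + k 0 else 0)"
        using Delta_const_neq_0
        by (auto simp: Delta_hmap hmap_xpow lookup_single_if \<sigma>_def c_def field_simps)
      have b\<sigma>: "b + \<sigma> \<notin> S0" using g False by (simp add: \<sigma>_def S0_def)
      have "coef (H (xpow b)) g = pairing (l \<sigma>) b + k \<sigma>"
        using lk(1)[OF b b\<sigma>] by (simp add: f_def \<sigma>_def)
      also have "\<dots> = (if \<sigma> = 0 then c * pairing (\<chi> i. 1) b + k 0 else 0) + pairing (m \<sigma>) b"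
        unfolding pm using lk(2)[of \<sigma>] by auto
      finally show ?thesis by (simp only: lookup_add 1 2)
    qed
    then show ?thesis
      unfolding DH(2)[OF xb] induced_cls[OF st xb] using cls_eq_iff[OF DH(1)[OF xb] Gbar[OF xb]] by blast
  qed
  have "D = induced ?G"
  proof (rule QV.gl_eqI[OF QV.gl_ext[OF Dgl] induced_ext])
    fix X assume "X \<in> carrier Q"
    then obtain x where x: "x \<in> bar" "X = cls x" using Q_cases by metis
    have bg: "xpow g \<in> bar" "g \<noteq> - theta" if "g \<in> supp x" for g
    proof -
      show "g \<noteq> - theta" using that x(1) by (auto simp: laurent_bar_iff in_keys_iff)
      then show "xpow g \<in> bar" by (simp add: xpow_bar)
    qed
    have cx: "cls x = (\<Oplus>\<^bsub>Q\<^esub>g\<in>supp x. coef x g \<odot>\<^bsub>Q\<^esub> cls (xpow g))"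
    proof -
      have "cls x = (\<Oplus>\<^bsub>Q\<^esub>g\<in>supp x. cls (lscale (coef x g) (xpow g)))"
        by (subst laurent_expand[of x], rule cls_sum) (use bg bar_closed in blast)
      also have "\<dots> = (\<Oplus>\<^bsub>Q\<^esub>g\<in>supp x. coef x g \<odot>\<^bsub>Q\<^esub> cls (xpow g))"
        by (rule QV.finsum_cong') (use bg cls_smult cls_in in auto)
      finally show ?thesis .
    qed
    have dist: "A (cls x) = (\<Oplus>\<^bsub>Q\<^esub>g\<in>supp x. coef x g \<odot>\<^bsub>Q\<^esub> A (cls (xpow g)))" if "A \<in> carrier (gl Q)" for A
      unfolding cx using lin_map_combination[of Q Q A "\<lambda>g. cls (xpow g)" "supp x" "coef x"] that bg cls_in
      by (auto simp: QV.gl_mem)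
    have "D (cls x) = (\<Oplus>\<^bsub>Q\<^esub>g\<in>supp x. coef x g \<odot>\<^bsub>Q\<^esub> D (cls (xpow g)))" by (rule dist[OF Dgl])
    also have "\<dots> = (\<Oplus>\<^bsub>Q\<^esub>g\<in>supp x. coef x g \<odot>\<^bsub>Q\<^esub> induced ?G (cls (xpow g)))"
      by (rule QV.finsum_cong') (use mono bg cls_in QV.gl_closed[OF induced_gl[OF st]] in auto)
    also have "\<dots> = induced ?G (cls x)" by (rule dist[OF induced_gl[OF st], symmetric])
    finally show "D X = induced ?G X" using x by simp
  qed
  then show thesis using that ET by blast
qed

end

section \<open>Outer and interior derivations of the factor algebra\<close>

lemma (in vspace) add_minus_cancel:
  "x \<in> carrier V \<Longrightarrow> y \<in> carrier V \<Longrightarrow> (x \<oplus> y) \<ominus> x = y"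
  by (simp add: a_minus_def a_comm[of x y] a_assoc r_neg)

context jacobian
begin

text \<open>Parameters range over all of \<open>U\<close>, including x^(-\<theta>), which has no
  class in \<open>Q\<close>; this is where \<open>I\<close> may exceed the interior derivations of
  \<open>Q\<close>.\<close>

abbreviation I where "I \<equiv> induced ` Inn U J"

text \<open>\<open>D_mtheta\<close> is absent because it vanishes on \<open>bar\<close>; n + 1
  indices remain.\<close>

definition outer_Q :: "'n option \<Rightarrow> ('k, 'n) laurent \<Rightarrow> ('k, 'n) laurent" where
  "outer_Q j = (case j of None \<Rightarrow> Delta | Some i \<Rightarrow> D_ind i)"

lemma outer_Q: "stable (outer_Q j)" "outer_Q j \<in> derivations U J"
  using stable_Delta stable_T D_ind_derivation Delta_derivation
  by (auto simp: outer_Q_def split: option.split)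

lemma I_derivations: "I \<subseteq> derivations Q OQ"
  using induced_derivation stable_Inn U.Inn_subset by blast

lemma I_subspace_gl: "vec_subspace (gl Q) I"
proof -
  interpret gl: vspace "gl Q" by (rule vspace.intro[OF QV.gl_vec_space])
  show ?thesis
  proof (rule gl.subspaceI)
    show "I \<subseteq> carrier (gl Q)" using I_derivations QL.derivations_gl by blast
    have "induced (\<lambda>u. 0) = \<zero>\<^bsub>gl Q\<^esub>"
    proof (rule QV.gl_eqI[OF induced_ext])
      fix X assume X: "X \<in> carrier Q"
      then obtain x where x: "x \<in> bar" "X = cls x" using Q_cases by metis
      show "induced (\<lambda>u. 0) X = \<zero>\<^bsub>gl Q\<^esub> X"
        using X unfolding x(2) induced_cls[OF stable_closed(3) x(1)] QV.gl_sel cls_zero by simp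
    qed simp
    then show "\<zero>\<^bsub>gl Q\<^esub> \<in> I" using Inn_closed(3) by (metis image_eqI)
  next
    fix A A' assume "A \<in> I" "A' \<in> I"
    then obtain D E where D: "D \<in> Inn U J" "A = induced D" and E: "E \<in> Inn U J" "A' = induced E" by blast
    have e: "A \<oplus>\<^bsub>gl Q\<^esub> A' = induced (\<lambda>u. D u + E u)"
      unfolding D(2) E(2) by (rule induced_add[OF stable_Inn[OF D(1)] stable_Inn[OF E(1)], symmetric])
    show "A \<oplus>\<^bsub>gl Q\<^esub> A' \<in> I" unfolding e by (rule imageI) (rule Inn_closed(1)[OF D(1) E(1)])
  next
    fix c A assume "A \<in> I"
    then obtain D where D: "D \<in> Inn U J" "A = induced D" by blast
    have e: "c \<odot>\<^bsub>gl Q\<^esub> A = induced (\<lambda>u. lscale c (D u))"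
      unfolding D(2) by (rule induced_scale[OF stable_Inn[OF D(1)], symmetric])
    show "c \<odot>\<^bsub>gl Q\<^esub> A \<in> I" unfolding e by (rule imageI) (rule Inn_closed(2)[OF D(1)])
  qed
qed

lemma I_subspace: "vec_subspace (Der Q OQ) I"
  unfolding Der_def
  by (rule subspace_of_subspace[OF QV.gl_vec_space QL.derivations_subspace I_subspace_gl I_derivations])

sublocale QD: quotient_space "Der Q OQ" I
  by (rule quotient_spaceI[OF QL.Der_vec_space I_subspace])

lemma Der_Q_simps: "carrier (Der Q OQ) = derivations Q OQ" "D \<oplus>\<^bsub>Der Q OQ\<^esub> E = D \<oplus>\<^bsub>gl Q\<^esub> E"
  "c \<odot>\<^bsub>Der Q OQ\<^esub> D = c \<odot>\<^bsub>gl Q\<^esub> D" "\<zero>\<^bsub>Der Q OQ\<^esub> = \<zero>\<^bsub>gl Q\<^esub>"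
  by (simp_all add: Der_def del: QV.gl_sel)

lemma outer_Q_combination:
  assumes "finite A"
  shows "stable (\<lambda>u. \<Sum>j\<in>A. lscale (c j) (outer_Q j u)) \<and>
    (\<Oplus>\<^bsub>Der Q OQ\<^esub>j\<in>A. c j \<odot>\<^bsub>Der Q OQ\<^esub> induced (outer_Q j)) = induced (\<lambda>u. \<Sum>j\<in>A. lscale (c j) (outer_Q j u))"
  using assms
proof (induction A)
  case empty
  have "induced (\<lambda>u. 0 :: ('k, 'n) laurent) = induced (\<lambda>u. lscale 0 (outer_Q None u))" by simp
  also have "\<dots> = 0 \<odot>\<^bsub>gl Q\<^esub> induced (outer_Q None)" by (rule induced_scale[OF outer_Q(1)])
  also have "\<dots> = \<zero>\<^bsub>Der Q OQ\<^esub>"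
    using QD.smult_0_left[of "induced (outer_Q None)"] induced_derivation[OF outer_Q]
    by (simp only: Der_Q_simps)
  finally show ?case using stable_closed(3) by simp
next
  case (insert j A)
  have "(\<Oplus>\<^bsub>Der Q OQ\<^esub>i\<in>insert j A. c i \<odot>\<^bsub>Der Q OQ\<^esub> induced (outer_Q i)) =
      c j \<odot>\<^bsub>Der Q OQ\<^esub> induced (outer_Q j) \<oplus>\<^bsub>Der Q OQ\<^esub> (\<Oplus>\<^bsub>Der Q OQ\<^esub>i\<in>A. c i \<odot>\<^bsub>Der Q OQ\<^esub> induced (outer_Q i))"
    by (rule QD.combination_insert) (use insert induced_derivation outer_Q in \<open>auto simp: Der_Q_simps(1)\<close>)
  also have "\<dots> = induced (\<lambda>u. lscale (c j) (outer_Q j u)) \<oplus>\<^bsub>gl Q\<^esub> induced (\<lambda>u. \<Sum>i\<in>A. lscale (c i) (outer_Q i u))"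
    using insert.IH by (simp only: Der_Q_simps induced_scale[OF outer_Q(1)])
  also have "\<dots> = induced (\<lambda>u. lscale (c j) (outer_Q j u) + (\<Sum>i\<in>A. lscale (c i) (outer_Q i u)))"
    by (rule induced_add[symmetric]) (use insert.IH stable_closed(2) outer_Q(1) in auto)
  finally show ?case
    using insert stable_closed(1)[OF stable_closed(2)[OF outer_Q(1)], of "\<lambda>u. \<Sum>i\<in>A. lscale (c i) (outer_Q i u)" "c j" j]
    by simp
qed

lemma outer_Q_functionals:
  "qf (\<lambda>u. \<Sum>j\<in>UNIV. lscale (c j) (outer_Q j u)) = c None * Delta_const TYPE('n)"
  "pf i (\<lambda>u. \<Sum>j\<in>UNIV. lscale (c j) (outer_Q j u)) = c (Some i)"
  unfolding functional_sum functional_scale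
  unfolding sum_option outer_Q_def
  by (simp_all add: Delta_functionals D_ind_functionals if_distrib cong: if_cong)

lemma T_mod_Inn:
  assumes E: "E \<in> T"
  obtains p E' where "E' \<in> Inn U J" "E = (\<lambda>u. (\<Sum>i\<in>UNIV. lscale (p i) (D_ind i u)) + E' u)"
proof -
  have Ed: "E \<in> derivations U J" and qz: "qf E = 0" "zf E = 0" using E comm_iff by auto
  obtain c z p E' where E': "E' \<in> Inn U J"
    "E = (\<lambda>u. lscale c (Delta u) + lscale z (D_mtheta u) + (\<Sum>i\<in>UNIV. lscale (p i) (D_ind i u)) + E' u)"
    by (rule Der_mod_Inn[OF Ed], rule that)
  have "c = 0" "z = 0"
    using qz Inn_functionals[OF E'(1)] Delta_const_neq_0
    unfolding E'(2) functional_add functional_scale functional_sum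
    by (simp_all add: Delta_functionals D_mtheta_functionals D_ind_functionals)
  then show thesis using that[OF E'(1), of p] E'(2) by simp
qed

lemma Der_Q_basis: "fin_basis (quot (Der Q OQ) I) UNIV (\<lambda>j. I +>\<^bsub>Der Q OQ\<^esub> induced (outer_Q j))"
proof (rule QD.quot_basis)
  fix D assume "D \<in> carrier (Der Q OQ)"
  then have D: "D \<in> derivations Q OQ" by (simp add: Der_Q_simps(1))
  obtain c E where E: "E \<in> T" "D = induced (\<lambda>u. lscale c (Delta u) + E u)"
    by (rule Der_Q_structure[OF D], rule that)
  obtain p E' where E': "E' \<in> Inn U J" "E = (\<lambda>u. (\<Sum>i\<in>UNIV. lscale (p i) (D_ind i u)) + E' u)"
    by (rule T_mod_Inn[OF E(1)], rule that)
  define d where "d j = (case j of None \<Rightarrow> c | Some i \<Rightarrow> p i)" for j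
  let ?G = "\<lambda>u. \<Sum>j\<in>UNIV. lscale (d j) (outer_Q j u)"
  have G: "stable ?G" "(\<Oplus>\<^bsub>Der Q OQ\<^esub>j\<in>UNIV. d j \<odot>\<^bsub>Der Q OQ\<^esub> induced (outer_Q j)) = induced ?G"
    using outer_Q_combination[of UNIV d] by simp_all
  have Gd: "induced ?G \<in> carrier (Der Q OQ)"
    using QD.combination_in[of "\<lambda>j. induced (outer_Q j)" UNIV d] induced_derivation outer_Q
    unfolding G(2) by (simp add: Der_Q_simps(1))
  have "(\<lambda>u. lscale c (Delta u) + E u) = (\<lambda>u. ?G u + E' u)"
    by (simp add: sum_option d_def outer_Q_def E'(2) add.assoc)
  then have "D = induced ?G \<oplus>\<^bsub>Der Q OQ\<^esub> induced E'"
    unfolding E(2) Der_Q_simps(2) using induced_add[OF G(1) stable_Inn[OF E'(1)]] by simp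
  then have "D \<ominus>\<^bsub>Der Q OQ\<^esub> induced ?G = induced E'"
    using QD.add_minus_cancel[OF Gd, of "induced E'"] I_derivations E'(1) by (auto simp: Der_Q_simps(1))
  then have m: "D \<ominus>\<^bsub>Der Q OQ\<^esub> (\<Oplus>\<^bsub>Der Q OQ\<^esub>j\<in>UNIV. d j \<odot>\<^bsub>Der Q OQ\<^esub> induced (outer_Q j)) \<in> I"
    unfolding G(2) using E'(1) by blast
  show "\<exists>d. D \<ominus>\<^bsub>Der Q OQ\<^esub> (\<Oplus>\<^bsub>Der Q OQ\<^esub>j\<in>UNIV. d j \<odot>\<^bsub>Der Q OQ\<^esub> induced (outer_Q j)) \<in> I"
    by (rule exI[of _ d]) (rule m)
next
  fix c :: "'n option \<Rightarrow> 'k" and j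
  let ?G = "\<lambda>u. \<Sum>j\<in>UNIV. lscale (c j) (outer_Q j u)"
  assume "(\<Oplus>\<^bsub>Der Q OQ\<^esub>j\<in>UNIV. c j \<odot>\<^bsub>Der Q OQ\<^esub> induced (outer_Q j)) \<in> I"
  then obtain E where E: "E \<in> Inn U J" "induced ?G = induced E"
    using outer_Q_combination[of UNIV c] by auto
  have st: "stable ?G" using outer_Q_combination[of UNIV c] by simp
  have x: "xpow (axis i 1) \<in> bar" for i using axis_neq by (simp add: xpow_bar)
  have eq: "coef (?G (xpow (axis i 1))) b = coef (E (xpow (axis i 1))) b" if "b \<noteq> 0" for i b
  proof -
    have "cls (?G (xpow (axis i 1))) = cls (E (xpow (axis i 1)))"
      using induced_cls[OF st x] induced_cls[OF stable_Inn[OF E(1)] x] E(2) by metis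
    moreover have "?G (xpow (axis i 1)) \<in> bar" "E (xpow (axis i 1)) \<in> bar"
      using st stable_Inn[OF E(1)] x by (auto simp: stable_def)
    ultimately show ?thesis using cls_eq_iff that by blast
  qed
  \<comment> \<open>Both functionals read only coefficients at e_i and e_i - \<theta>. These
    exponents are nonzero (the second because n > 1), so the values depend only on the induced
    map.\<close>
  have "qf ?G = qf E" "\<And>i. pf i ?G = pf i E"
    unfolding qf_def pf_def using eq[OF axis_neq(1)] eq[OF axis_neq(3)] by simp_all
  then have "qf ?G = 0" "\<And>i. pf i ?G = 0" using Inn_functionals[OF E(1)] by simp_all
  then show "c j = 0"
    unfolding outer_Q_functionals using Delta_const_neq_0 by (cases j) auto
qed (use induced_derivation outer_Q in \<open>auto simp: Der_Q_simps(1)\<close>)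

lemma Inn_Q_subset: "Inn Q OQ \<subseteq> I"
  unfolding Inn_def[of Q OQ]
proof (rule vspace.lin_span_minimal[OF vspace.intro[OF QV.gl_vec_space] I_subspace_gl], rule subsetI)
  fix L assume "L \<in> {left_mult Q OQ A | A. A \<in> UNIV \<rightarrow> carrier Q}"
  then obtain A where A: "A \<in> UNIV \<rightarrow> carrier Q" "L = left_mult Q OQ A" by blast
  obtain a where a: "\<And>k. a k \<in> bar" "A = (\<lambda>k. cls (a k))" using tuple_rep[OF A(1)] by blast
  have "left_mult U J a \<in> Inn U J" by (rule U.left_mult_Inn) simp
  then show "L \<in> I" unfolding A(2) a(2) induced_left_mult[OF a(1)] by blast
qed

lemma Inn_Q_closed:
  "stable D \<Longrightarrow> stable E \<Longrightarrow> induced D \<in> Inn Q OQ \<Longrightarrow> induced E \<in> Inn Q OQ \<Longrightarrow> induced (\<lambda>u. D u + E u) \<in> Inn Q OQ"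
  "stable D \<Longrightarrow> induced D \<in> Inn Q OQ \<Longrightarrow> induced (\<lambda>u. lscale c (D u)) \<in> Inn Q OQ"
proof -
  note S = vspace.subspaceD[OF vspace.intro[OF QV.gl_vec_space] QL.Inn_subspace_gl]
  show "induced (\<lambda>u. D u + E u) \<in> Inn Q OQ"
    if D: "stable D" "stable E" "induced D \<in> Inn Q OQ" "induced E \<in> Inn Q OQ"
    unfolding induced_add[OF D(1,2)] by (rule S(3)[OF D(3,4)])
  show "induced (\<lambda>u. lscale c (D u)) \<in> Inn Q OQ" if D: "stable D" "induced D \<in> Inn Q OQ"
    unfolding induced_scale[OF D(1)] by (rule S(4)[OF D(2)])
qed

lemma induced_position_Inn:
  assumes \<beta>: "\<And>k. \<beta> k \<noteq> - theta"
  shows "induced (\<lambda>u. J ((\<lambda>k. xpow (\<beta> k))(j := u))) \<in> Inn Q OQ"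
proof -
  let ?x = "\<lambda>k. xpow (\<beta> k) :: ('k, 'n) laurent"
  have x: "?x k \<in> bar" for k using \<beta> by (simp add: xpow_bar)
  have A: "(\<lambda>k. cls (?x k)) \<in> UNIV \<rightarrow> carrier Q" using cls_in[OF x] by auto
  have L: "(\<lambda>u. J (?x(j := u))) \<in> Inn U J"
    using U.left_mult_position_Inn[of ?x j] by simp
  have "induced (\<lambda>u. J (?x(j := u))) = (\<lambda>X\<in>carrier Q. OQ ((\<lambda>k. cls (?x k))(j := X)))"
  proof (rule QV.gl_eqI[OF induced_ext])
    fix X assume X: "X \<in> carrier Q"
    then obtain v where v: "v \<in> bar" "X = cls v" using Q_cases by metis
    show "induced (\<lambda>u. J (?x(j := u))) X = (\<lambda>X\<in>carrier Q. OQ ((\<lambda>k. cls (?x k))(j := X))) X"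
      using X induced_cls[OF stable_Inn[OF L] v(1)] op_cls_upd[where i=j, OF x v(1)]
      by (simp only: v(2) restrict_apply')
  qed simp
  then show ?thesis using QL.left_mult_position_Inn[OF A, of j] by (simp only:)
qed

text \<open>With a third index available, the parameter \<open>x\<^sup>-\<^sup>\<theta>\<close>, which has no class in the factor
  algebra, can be avoided.\<close>

lemma induced_bracket_Inn:
  assumes n2: "CARD('n) > 2" and ij: "i \<noteq> j"
  shows "induced (hmap (bracket i j w) (w - theta)) \<in> Inn Q OQ"
proof (cases "w - pair_rest i j = - theta")
  case False
  let ?\<beta> = "pair_tuple i j (w - pair_rest i j) 0"
  have "?\<beta>(j := b) = pair_tuple i j (w - pair_rest i j) b" for b by (simp add: pair_tuple_def)
  then have 1: "(\<lambda>b. idet (?\<beta>(j := b)) :: 'k) = bracket i j w"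
    by (simp add: idet_pair_tuple[OF ij] bracket_rest(2)[OF ij])
  have 2: "sum ?\<beta> UNIV - ?\<beta> j - theta = w - theta"
    unfolding sum_pair_tuple[OF ij] by (simp add: pair_tuple_def)
  have "?\<beta> k \<noteq> - theta" for k
    using False axis_neq theta_neq by (auto simp: pair_tuple_def)
  from induced_position_Inn[of ?\<beta> j, OF this] show ?thesis unfolding Jac_position_xpow 1 2 .
next
  case True
  have "\<exists>k. k \<notin> {i, j}"
  proof (rule ccontr)
    assume "\<not> ?thesis"
    then have "(UNIV :: 'n set) = {i, j}" by auto
    then have "CARD('n) = card {i, j}" by (rule arg_cong)
    then show False using n2 ij by simp
  qed
  then obtain k where k: "k \<noteq> i" "k \<noteq> j" by blast
  \<comment> \<open>A standard vector e_k is moved from row i to row k. The total is unchanged, the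
    minor ignores coordinate k, and row k becomes 2 e_k, which doubles the determinant.\<close>
  let ?a = "w - pair_rest i j - axis k 1"
  let ?\<beta> = "(pair_tuple i j ?a 0)(k := axis k 1 + axis k 1)"
  have "idet (?\<beta>(j := b)) = 2 * (bracket i j w b :: 'k)" for b
  proof -
    have "?\<beta>(j := b) = (pair_tuple i j ?a b)(k := axis k 1 + axis k 1)"
      using k by (auto simp: pair_tuple_def)
    moreover have "(pair_tuple i j ?a b)(k := axis k 1) = pair_tuple i j ?a b"
      using k by (auto simp: pair_tuple_def)
    moreover have "bracket i j ?a b = (bracket i j (w - pair_rest i j) b :: 'k)"
      using k by (simp add: bracket_def axis_def)
    ultimately show ?thesis
      by (simp only: idet_double idet_pair_tuple[OF ij] bracket_rest(2)[OF ij])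
  qed
  then have 1: "(\<lambda>b. idet (?\<beta>(j := b)) :: 'k) = (\<lambda>b. 2 * bracket i j w b)" by blast
  have 2: "sum ?\<beta> UNIV - ?\<beta> j - theta = w - theta"
    unfolding sum_fun_upd sum_pair_tuple[OF ij] using k by (simp add: pair_tuple_def)
  have \<beta>: "?\<beta> m \<noteq> - theta" for m
  proof -
    have "(axis k 1 + axis k 1 :: (int, 'n) vec) $ k \<noteq> (- theta) $ k" by (simp add: theta_def)
    then have "axis k 1 + axis k 1 \<noteq> (- theta :: (int, 'n) vec)" by metis
    moreover have "?a \<noteq> - theta" unfolding True using axis_neq(1) by simp
    ultimately show ?thesis using axis_neq theta_neq by (auto simp: pair_tuple_def)
  qed
  have st: "stable (hmap (\<lambda>b. 2 * bracket i j w b) (w - theta))"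
    unfolding hmap_scale[abs_def] by (rule stable_closed(2), rule stable_Inn, rule bracket_Inn[OF ij])
  have "induced (hmap (\<lambda>b. 2 * bracket i j w b) (w - theta)) \<in> Inn Q OQ"
    using induced_position_Inn[of ?\<beta> j, OF \<beta>] unfolding Jac_position_xpow 1 2 .
  \<comment> \<open>The factor 2 is removed by scaling with 1/2.\<close>
  from Inn_Q_closed(2)[OF st this, of "1 / 2"] show ?thesis
    unfolding hmap_scale[symmetric, abs_def] by simp
qed

lemma Inn_Q_eq:
  assumes n2: "CARD('n) > 2"
  shows "Inn Q OQ = I"
proof
  have "stable D \<and> induced D \<in> Inn Q OQ" if "D \<in> Inn U J" for D
    using that
  proof (induction D rule: Inn_induct)
    case (hmap l \<sigma>)
    define w where "w = \<sigma> + theta"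
    have "w \<noteq> 0" using hmap(2) by (simp add: w_def add_eq_0_iff2)
    then obtain i where i: "w $ i \<noteq> 0" by (auto simp: vec_eq_iff)
    have 1: "pairing l = (\<lambda>b. \<Sum>j\<in>UNIV - {i}. l $ j / of_int (w $ i) * bracket i j w b)"
      by (rule ext, rule pairing_bracket[OF _ i]) (use hmap(1) in \<open>simp only: w_def\<close>)
    have 2: "\<sigma> = w - theta" by (simp add: w_def)
    have e: "hmap (pairing l) \<sigma> = (\<lambda>u. \<Sum>j\<in>UNIV - {i}. lscale (l $ j / of_int (w $ i)) (hmap (bracket i j w) (w - theta) u))"
      by (subst 1, subst 2) (simp only: hmap_sum[abs_def])
    \<comment> \<open>Stability is carried through the induction because inducing is additive only
      on stable maps.\<close>
    have "stable (\<lambda>u. \<Sum>j\<in>A. lscale (l $ j / of_int (w $ i)) (hmap (bracket i j w) (w - theta) u)) \<and>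
        induced (\<lambda>u. \<Sum>j\<in>A. lscale (l $ j / of_int (w $ i)) (hmap (bracket i j w) (w - theta) u)) \<in> Inn Q OQ"
      if "finite A" "A \<subseteq> UNIV - {i}" for A
      using that
    proof (induction A)
      case empty
      have "stable (\<lambda>u. lscale 0 (left_mult U J undefined u))" "induced (\<lambda>u. lscale 0 (left_mult U J (\<lambda>_. 0) u)) \<in> Inn Q OQ"
      proof -
        show "stable (\<lambda>u. lscale 0 (left_mult U J undefined u))"
          using stable_closed(3) by simp
        have "left_mult Q OQ (\<lambda>k. cls 0) \<in> Inn Q OQ"
          by (rule QL.left_mult_Inn) (use cls_in[OF bar_closed(4)] in auto)
        then have "induced (left_mult U J (\<lambda>_. 0)) \<in> Inn Q OQ"
          using induced_left_mult[of "\<lambda>_. 0"] bar_closed(4) by simp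
        then show "induced (\<lambda>u. lscale 0 (left_mult U J (\<lambda>_. 0) u)) \<in> Inn Q OQ"
          by (rule Inn_Q_closed(2)[rotated]) (rule stable_Inn, rule U.left_mult_Inn, simp)
      qed
      then show ?case by simp
    next
      case (insert j A)
      have j: "i \<noteq> j" using insert.prems by auto
      have s: "stable (\<lambda>u. lscale (l $ j / of_int (w $ i)) (hmap (bracket i j w) (w - theta) u))"
        by (rule stable_closed(2), rule stable_Inn, rule bracket_Inn[OF j])
      have ind: "induced (\<lambda>u. lscale (l $ j / of_int (w $ i)) (hmap (bracket i j w) (w - theta) u)) \<in> Inn Q OQ"
        by (rule Inn_Q_closed(2)[OF _ induced_bracket_Inn[OF n2 j]]) (rule stable_Inn, rule bracket_Inn[OF j])
      have IH: "stable (\<lambda>u. \<Sum>j\<in>A. lscale (l $ j / of_int (w $ i)) (hmap (bracket i j w) (w - theta) u))"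
        "induced (\<lambda>u. \<Sum>j\<in>A. lscale (l $ j / of_int (w $ i)) (hmap (bracket i j w) (w - theta) u)) \<in> Inn Q OQ"
        using insert by auto
      show ?case
        using stable_closed(1)[OF s IH(1)] Inn_Q_closed(1)[OF s IH(1) ind IH(2)] insert.hyps by simp
    qed
    from this[of "UNIV - {i}"] show ?case unfolding e by simp
  next
    case (add D E)
    then show ?case using stable_closed(1)[of D E] Inn_Q_closed(1)[of D E] by simp
  next
    case (scale c D)
    then show ?case using stable_closed(2)[of D c] Inn_Q_closed(2)[of D c] by simp
  qed
  then show "I \<subseteq> Inn Q OQ" by blast
qed (rule Inn_Q_subset)


subsection \<open>Simplicity of the factor algebra\<close>

lemma Jac_pair_hmap:
  assumes "i \<noteq> j"
  shows "J ((\<lambda>k. xpow (pair_tuple i j 0 b k))(i := u)) =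
    hmap (\<lambda>\<tau>. bracket i j \<tau> b) (b + pair_rest i j - theta) u"
proof -
  have "(pair_tuple i j 0 b)(i := \<tau>) = pair_tuple i j \<tau> b" for \<tau>
    using assms by (auto simp: pair_tuple_def)
  then have 1: "(\<lambda>\<tau>. idet ((pair_tuple i j 0 b)(i := \<tau>)) :: 'k) = (\<lambda>\<tau>. bracket i j \<tau> b)"
    by (simp add: idet_pair_tuple[OF assms])
  have 2: "sum (pair_tuple i j 0 b) UNIV - pair_tuple i j 0 b i - theta = b + pair_rest i j - theta"
    unfolding sum_pair_tuple[OF assms] using assms by (simp add: pair_tuple_def)
  show ?thesis using fun_cong[OF Jac_position_xpow[of "pair_tuple i j 0 b" i], of u] unfolding 1 2 .
qed

lemma bracket_simps:
  "bracket i j 0 b = 0" "bracket i j b b = 0"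
  "bracket i j (a + b) c = bracket i j a c + bracket i j b c"
  by (simp_all add: bracket_def algebra_simps)

context
  fixes K
  assumes K: "n_ideal Q OQ K"
begin

text \<open>The preimage of the ideal, so that supports of Laurent polynomials can be used in place
  of cosets.\<close>

definition K' where "K' = {u \<in> bar. cls u \<in> K}"

lemma K_subspace: "vec_subspace Q K"
  using K by (simp add: n_ideal_def)

lemma K'_closed:
  "u \<in> K' \<Longrightarrow> v \<in> K' \<Longrightarrow> u + v \<in> K'" "u \<in> K' \<Longrightarrow> lscale c u \<in> K'" "w \<in> C \<Longrightarrow> w \<in> K'"
proof -
  note S = QV.subspaceD[OF K_subspace]
  show "u + v \<in> K'" if "u \<in> K'" "v \<in> K'"
    using that S(3)[of "cls u" "cls v"] by (simp add: K'_def bar_closed cls_add del: QB.quot_sel)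
  show "lscale c u \<in> K'" if "u \<in> K'"
    using that S(4)[of "cls u" c] by (simp add: K'_def bar_closed cls_smult)
  show "w \<in> K'" if "w \<in> C"
  proof -
    have w: "w \<in> bar" using that C_bar by blast
    have "\<forall>b. b \<noteq> 0 \<longrightarrow> coef w b = coef 0 b" using that constants_iff by simp
    then have "cls w = cls 0" using cls_eq_iff[OF w bar_closed(4)] by blast
    then have "cls w = \<zero>\<^bsub>Q\<^esub>" unfolding cls_zero .
    then show ?thesis using w S(2) by (simp add: K'_def)
  qed
qed

lemma K'_pair:
  assumes u: "u \<in> K'" and b: "b \<noteq> - theta" and ij: "i \<noteq> j"
  shows "hmap (\<lambda>\<tau>. bracket i j \<tau> b) (b + pair_rest i j - theta) u \<in> K'"
proof -
  let ?x = "\<lambda>k. xpow (pair_tuple i j 0 b k) :: ('k, 'n) laurent"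
  have x: "?x k \<in> bar" for k using b axis_neq theta_neq by (auto simp: xpow_bar pair_tuple_def)
  have A: "(\<lambda>k. cls (?x k)) \<in> UNIV \<rightarrow> carrier Q" using cls_in[OF x] by auto
  have u': "u \<in> bar" "cls u \<in> K" using u by (auto simp: K'_def)
  have "OQ ((\<lambda>k. cls (?x k))(i := cls u)) \<in> K" by (rule QL.ideal_position[OF K u'(2) A])
  then have "cls (J (?x(i := u))) \<in> K" unfolding op_cls_upd[OF x u'(1)] .
  then show ?thesis unfolding Jac_pair_hmap[OF ij, symmetric] using bar_closed(5) by (simp only: K'_def mem_Collect_eq simp_thms)
qed

text \<open>Exponent 0 is left out since constants are zero in the factor algebra.\<close>

definition size where "size u = card (supp (u :: ('k, 'n) laurent) - {0})"

lemma ev_ne: "\<forall>\<^sub>F N in sequentially. v + moment N \<noteq> (w :: (int, 'n) vec)"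
  using generic_neq[of 1 v w] by simp

text \<open>In an element of minimal positive support, two exponents could be made independent by a generic
  shift, and the bracket with one of the two resulting monomials would kill just one of them.\<close>

lemma ex_monomial:
  assumes "K \<noteq> {\<zero>\<^bsub>Q\<^esub>}"
  obtains b where "b \<noteq> 0" "xpow b \<in> K'"
proof -
  have "\<exists>u. u \<in> K' \<and> size u > 0"
  proof -
    obtain X where X: "X \<in> K" "X \<noteq> \<zero>\<^bsub>Q\<^esub>" using assms QV.subspaceD(2)[OF K_subspace] by blast
    then have "X \<in> carrier Q" using QV.subspaceD(1)[OF K_subspace] by blast
    then obtain x where x: "x \<in> bar" "X = cls x" using Q_cases by metis
    have "cls x \<noteq> cls 0" using X(2) unfolding x(2) cls_zero .
    then obtain b where "b \<noteq> 0" "coef x b \<noteq> 0" using cls_eq_iff[OF x(1) bar_closed(4)] by auto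
    then have "b \<in> supp x - {0}" by (simp add: in_keys_iff)
    then have "size x > 0" unfolding size_def by (subst card_gt_0_iff) auto
    then show ?thesis using x X(1) by (auto simp: K'_def)
  qed
  then obtain u where u: "u \<in> K'" "size u > 0" and min: "\<And>v. v \<in> K' \<Longrightarrow> size v > 0 \<Longrightarrow> size u \<le> size v"
    using ex_has_least_nat[of "\<lambda>u. u \<in> K' \<and> size u > 0" _ size] by metis
  define A where "A = supp u - {0}"
  have finA: "finite A" by (simp add: A_def)
  have sizeA: "size u = card A" by (simp add: size_def A_def)
  have "A \<noteq> {}" using u(2) sizeA by auto
  then obtain \<beta> where \<beta>: "\<beta> \<in> A" by blast
  have "A = {\<beta>}"
  proof (rule ccontr)
    assume "A \<noteq> {\<beta>}"
    then obtain \<beta>' where \<beta>': "\<beta>' \<in> A" "\<beta>' \<noteq> \<beta>" using \<beta> by blast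
    have "\<beta> \<noteq> 0" using \<beta> by (simp add: A_def)
    then obtain i where i: "\<beta> $ i \<noteq> 0" by (auto simp: vec_eq_iff)
    obtain j where j: "i \<noteq> j" using ex_other_index[OF n] by metis
    have "\<beta>' - \<beta> \<noteq> 0" using \<beta>' by simp
    then obtain p where p: "(\<beta>' - \<beta>) $ p \<noteq> 0" by (auto simp: vec_eq_iff)
    obtain q where q: "p \<noteq> q" using ex_other_index[OF n] by metis
    let ?r = "pair_rest i j - theta" and ?r' = "pair_rest p q - theta"
    \<comment> \<open>Together with two moments this is where \<beta>' ends up after both brackets;
      it must not be 0, or the surviving term would be a constant.\<close>
    let ?c = "\<beta>' + \<beta> + ?r + ?r + ?r'"
    have dbl: "\<forall>\<^sub>F N in sequentially. ?c + (moment N + moment N) \<notin> {0}"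
      by (rule generic_notin_double) simp
    have "\<forall>\<^sub>F N in sequentially. bracket i j \<beta> (0 + moment N) \<noteq> (0 :: 'k) \<and>
        bracket p q (\<beta>' - \<beta>) (\<beta> + ?r + moment N) \<noteq> (0 :: 'k) \<and>
        0 + moment N \<noteq> (- theta :: (int, 'n) vec) \<and> \<beta> + ?r + moment N \<noteq> 0 \<and> \<beta> + ?r + moment N \<noteq> - theta \<and>
        ?c + (moment N + moment N) \<notin> {0}"
      using generic_bracket_0[where 'k='k, OF j i, of 0] generic_bracket_0[where 'k='k, OF q p, of "\<beta> + ?r"]
        ev_ne[of 0 "- theta"] ev_ne[of "\<beta> + ?r" 0] ev_ne[of "\<beta> + ?r" "- theta"] dbl
      by (intro eventually_conj)
    then obtain N where N: "bracket i j \<beta> (0 + moment N) \<noteq> (0 :: 'k)"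
        "bracket p q (\<beta>' - \<beta>) (\<beta> + ?r + moment N) \<noteq> (0 :: 'k)"
        "0 + moment N \<noteq> (- theta :: (int, 'n) vec)" "\<beta> + ?r + moment N \<noteq> 0" "\<beta> + ?r + moment N \<noteq> - theta"
        "?c + (moment N + moment N) \<notin> {0}"
      using eventually_sequentially_ex by blast
    define b where "b = (moment N :: (int, 'n) vec)"
    define s where "s = b + pair_rest i j - theta"
    \<comment> \<open>The generic bracket shifts every exponent by s and keeps the term of
      \<beta>.\<close>
    define u1 where "u1 = hmap (\<lambda>\<tau>. bracket i j \<tau> b) s u"
    have u1K: "u1 \<in> K'" unfolding u1_def s_def by (rule K'_pair[OF u(1) _ j]) (use N(3) in \<open>simp add: b_def\<close>)
    have u1: "coef u1 (\<tau> + s) = bracket i j \<tau> b * coef u \<tau>" for \<tau> by (simp add: u1_def lookup_hmap)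
    have \<beta>s: "\<beta> + s \<noteq> 0" "\<beta> + s \<noteq> - theta" using N(4,5) by (simp_all add: s_def b_def algebra_simps)
    \<comment> \<open>The constant term of u contributes nothing, as the minor with exponent 0
      vanishes.\<close>
    have sub1: "supp u1 \<subseteq> (\<lambda>\<tau>. \<tau> + s) ` A"
    proof
      fix g assume "g \<in> supp u1"
      then have "bracket i j (g - s) b * coef u (g - s) \<noteq> 0"
        using u1[of "g - s"] by (simp add: in_keys_iff)
      then have "g - s \<in> A" by (auto simp: A_def in_keys_iff bracket_simps(1))
      then have "(g - s) + s \<in> (\<lambda>\<tau>. \<tau> + s) ` A" by (rule imageI)
      then show "g \<in> (\<lambda>\<tau>. \<tau> + s) ` A" by simp
    qed
    have cardA: "card ((\<lambda>\<tau>. \<tau> + s) ` A) = card A" by (rule card_image) (simp add: inj_on_def)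
    have "coef u1 (\<beta> + s) \<noteq> 0" unfolding u1 using N(1) \<beta> by (simp add: b_def A_def in_keys_iff)
    then have "\<beta> + s \<in> supp u1 - {0}" using \<beta>s by (simp add: in_keys_iff)
    then have "size u1 > 0" unfolding size_def by (subst card_gt_0_iff) auto
    then have "card A \<le> card (supp u1 - {0})" using min[OF u1K] sizeA by (simp add: size_def)
    \<comment> \<open>Minimality of u forbids losing a term, so the term of \<beta>' survives
      too.\<close>
    then have "supp u1 - {0} = (\<lambda>\<tau>. \<tau> + s) ` A"
      using sub1 finA cardA by (intro card_seteq) auto
    then have \<beta>'1: "coef u1 (\<beta>' + s) \<noteq> 0" using \<beta>' by (auto simp: in_keys_iff)
    \<comment> \<open>The second bracket uses the shifted \<beta> itself as parameter: that term is
      killed by the repeated row, while \<beta>' survives by the generic choice.\<close>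
    define b' where "b' = \<beta> + s"
    define s' where "s' = b' + pair_rest p q - theta"
    define u2 where "u2 = hmap (\<lambda>\<tau>. bracket p q \<tau> b') s' u1"
    have u2K: "u2 \<in> K'" unfolding u2_def s'_def by (rule K'_pair[OF u1K _ q]) (use \<beta>s in \<open>simp add: b'_def\<close>)
    have u2: "coef u2 (\<tau> + s') = bracket p q \<tau> b' * coef u1 \<tau>" for \<tau> by (simp add: u2_def lookup_hmap)
    have "supp u2 - {0} \<subseteq> (\<lambda>\<tau>. \<tau> + s') ` ((\<lambda>\<tau>. \<tau> + s) ` (A - {\<beta>}))"
    proof
      fix g assume "g \<in> supp u2 - {0}"
      then have ne: "bracket p q (g - s') b' * coef u1 (g - s') \<noteq> 0"
        using u2[of "g - s'"] by (simp add: in_keys_iff)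
      then have "g - s' \<in> (\<lambda>\<tau>. \<tau> + s) ` A" using sub1 by (auto simp: in_keys_iff)
      moreover have "g - s' \<noteq> \<beta> + s" using ne by (auto simp: b'_def bracket_simps(2))
      ultimately have "g - s' \<in> (\<lambda>\<tau>. \<tau> + s) ` (A - {\<beta>})" by auto
      then have "(g - s') + s' \<in> (\<lambda>\<tau>. \<tau> + s') ` ((\<lambda>\<tau>. \<tau> + s) ` (A - {\<beta>}))" by (rule imageI)
      then show "g \<in> (\<lambda>\<tau>. \<tau> + s') ` ((\<lambda>\<tau>. \<tau> + s) ` (A - {\<beta>}))" by simp
    qed
    then have "size u2 \<le> card ((\<lambda>\<tau>. \<tau> + s') ` ((\<lambda>\<tau>. \<tau> + s) ` (A - {\<beta>})))"
      unfolding size_def by (rule card_mono[rotated]) (use finA in auto)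
    also have "\<dots> \<le> card (A - {\<beta>})"
      by (rule order_trans[OF card_image_le card_image_le]) (use finA in auto)
    also have "\<dots> < card A" by (rule card_Diff1_less[OF finA \<beta>])
    finally have "size u2 < size u" using sizeA by simp
    moreover have "size u2 > 0"
    proof -
      have "bracket p q (\<beta>' + s) b' = (bracket p q (\<beta>' - \<beta>) (\<beta> + ?r + moment N) :: 'k)"
      proof -
        have "\<beta>' + s = (\<beta>' - \<beta>) + b'" "b' = \<beta> + ?r + moment N" by (simp_all add: b'_def s_def b_def)
        then show ?thesis by (simp only: bracket_simps(2,3) add_0_right)
      qed
      then have nz: "coef u2 ((\<beta>' + s) + s') \<noteq> 0" unfolding u2 using N(2) \<beta>'1 by simp
      have eq: "(\<beta>' + s) + s' = ?c + (moment N + moment N)"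
        by (simp add: s'_def b'_def s_def b_def algebra_simps)
      have n0: "(\<beta>' + s) + s' \<notin> {0}" unfolding eq by (rule N(6))
      have "(\<beta>' + s) + s' \<in> supp u2" unfolding in_keys_iff by (rule nz)
      then have "(\<beta>' + s) + s' \<in> supp u2 - {0}" using n0 by (rule DiffI)
      then show ?thesis unfolding size_def by (subst card_gt_0_iff) auto
    qed
    ultimately show False using min[OF u2K] by simp
  qed
  then have supp: "supp u - {0} = {\<beta>}" by (simp add: A_def)
  have \<beta>u: "\<beta> \<noteq> 0" "coef u \<beta> \<noteq> 0" using \<beta> by (auto simp: A_def in_keys_iff)
  \<comment> \<open>Removing the constant term, which lies in \<open>K'\<close>, leaves a multiple
    of one monomial.\<close>
  have "u + lscale (- coef u 0) 1 \<in> K'"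
    by (intro K'_closed u K'_closed(3)) (auto simp: lin_span_one)
  moreover have "u + lscale (- coef u 0) 1 = lscale (coef u \<beta>) (xpow \<beta>)"
  proof (rule poly_mapping_eqI)
    fix g
    have "g \<notin> supp u" if "g \<noteq> 0" "g \<noteq> \<beta>" using that supp by blast
    then have "g \<noteq> 0 \<Longrightarrow> g \<noteq> \<beta> \<Longrightarrow> coef u g = 0" by (simp add: in_keys_iff)
    then show "coef (u + lscale (- coef u 0) 1) g = coef (lscale (coef u \<beta>) (xpow \<beta>)) g"
      using \<beta>u by (auto simp: lookup_add lookup_one lookup_xpow when_def)
  qed
  ultimately have "lscale (1 / coef u \<beta>) (lscale (coef u \<beta>) (xpow \<beta>)) \<in> K'"
    using K'_closed(2) by metis
  then have "xpow \<beta> \<in> K'" using \<beta>u by (simp add: lscale_simps(4)[symmetric] del: lscale_simps(4))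
  then show thesis using that \<beta>u by blast
qed

text \<open>The parameter exponent is chosen so that x^a is sent to a multiple of x^g; the multiple
  is the minor of a and g + \<theta>.\<close>

lemma monomial_step:
  assumes a: "xpow a \<in> K'" and ij: "i \<noteq> j" and b: "g + theta - a - pair_rest i j \<noteq> - theta"
    and ne: "bracket i j a (g + theta) \<noteq> (0 :: 'k)"
  shows "xpow g \<in> K'"
proof -
  let ?b = "g + theta - a - pair_rest i j"
  have "hmap (\<lambda>\<tau>. bracket i j \<tau> ?b) (?b + pair_rest i j - theta) (xpow a) \<in> K'"
    by (rule K'_pair[OF a b ij])
  moreover have "bracket i j a ?b = (bracket i j a (g + theta) :: 'k)"
    using ij by (simp add: bracket_def pair_rest_def theta_def axis_def algebra_simps)
  ultimately have "lscale (bracket i j a (g + theta)) (xpow g) \<in> K'"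
    unfolding hmap_xpow by (simp add: single_eq_lscale)
  then have "lscale (1 / bracket i j a (g + theta)) (lscale (bracket i j a (g + theta)) (xpow g)) \<in> K'"
    by (rule K'_closed(2))
  then show ?thesis using ne by (simp add: lscale_simps(4)[symmetric] del: lscale_simps(4))
qed

lemma ideal_full:
  assumes "K \<noteq> {\<zero>\<^bsub>Q\<^esub>}"
  shows "K = carrier Q"
proof
  show "K \<subseteq> carrier Q" using QV.subspaceD(1)[OF K_subspace] .
  obtain a where a: "a \<noteq> 0" "xpow a \<in> K'" using ex_monomial[OF assms] .
  have mono: "xpow g \<in> K'" if g: "g \<noteq> - theta" for g
  proof -
    obtain i where i: "a $ i \<noteq> 0" using a(1) by (auto simp: vec_eq_iff)
    obtain j where j: "i \<noteq> j" using ex_other_index[OF n] by metis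
    have "g + theta \<noteq> 0" using g by (simp add: add_eq_0_iff2)
    then obtain p where p: "(g + theta) $ p \<noteq> 0" by (auto simp: vec_eq_iff)
    obtain q where q: "p \<noteq> q" using ex_other_index[OF n] by metis
    \<comment> \<open>The minor of a and g + \<theta> may vanish for every index pair, so a generic
      monomial serves as an intermediate stop.\<close>
    have "\<forall>\<^sub>F N in sequentially. bracket i j a (theta + moment N) \<noteq> (0 :: 'k) \<and>
        bracket p q (g + theta) (0 + moment N) \<noteq> (0 :: 'k) \<and>
        (theta - a - pair_rest i j) + moment N \<noteq> - theta \<and>
        (g + theta - pair_rest p q) - moment N \<notin> {- theta}"
      by (intro eventually_conj generic_bracket_0[OF j i] generic_bracket_0[OF q p] ev_ne generic_notin_uminus) simp
    then obtain N where N: "bracket i j a (theta + moment N) \<noteq> (0 :: 'k)"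
        "bracket p q (g + theta) (0 + moment N) \<noteq> (0 :: 'k)"
        "(theta - a - pair_rest i j) + moment N \<noteq> - theta"
        "(g + theta - pair_rest p q) - moment N \<notin> {- theta}"
      using eventually_sequentially_ex by blast
    have "xpow (moment N) \<in> K'"
    proof (rule monomial_step[OF a(2) j])
      have "moment N + theta - a - pair_rest i j = (theta - a - pair_rest i j) + moment N" by simp
      then show "moment N + theta - a - pair_rest i j \<noteq> - theta" using N(3) by metis
      show "bracket i j a (moment N + theta) \<noteq> (0 :: 'k)"
        unfolding add.commute[of "moment N" theta] by (rule N(1))
    qed
    then show ?thesis
    proof (rule monomial_step[OF _ q])
      have "g + theta - moment N - pair_rest p q = (g + theta - pair_rest p q) - moment N" by simp
      then show "g + theta - moment N - pair_rest p q \<noteq> - theta" using N(4) by (metis singletonI)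
      have "bracket p q (moment N) (g + theta) = - (bracket p q (g + theta) (0 + moment N) :: 'k)"
        by (simp add: bracket_def algebra_simps)
      then show "bracket p q (moment N) (g + theta) \<noteq> (0 :: 'k)"
        using N(2) by (metis neg_equal_0_iff_equal)
    qed
  qed
  show "carrier Q \<subseteq> K"
  proof
    fix X assume "X \<in> carrier Q"
    then obtain x where x: "x \<in> bar" "X = cls x" using Q_cases by metis
    have z: "0 \<in> K'" by (rule K'_closed(3)) (simp add: constants_iff)
    have "lscale (coef x g) (xpow g) \<in> K'" if "g \<in> supp x" for g
    proof -
      have "g \<noteq> - theta" using that x(1) by (auto simp: laurent_bar_iff in_keys_iff)
      then show ?thesis using mono K'_closed(2) by blast
    qed
    then have "(\<Sum>g\<in>G. lscale (coef x g) (xpow g)) \<in> K'" if "G \<subseteq> supp x" for G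
      using that by (induction G rule: infinite_finite_induct) (auto simp: z K'_closed(1))
    then have "x \<in> K'" using laurent_expand[of x] by (metis order_refl)
    then show "X \<in> K" by (simp add: K'_def x(2))
  qed
qed

end

lemma simple_Q: "n_simple Q OQ"
proof -
  fix i :: 'n
  obtain j where j: "i \<noteq> j" using ex_other_index[OF n] by metis
  \<comment> \<open>The coordinate functions with x_j squared, whose Jacobian is 2 x_j; the
    coordinate functions alone give 1, which is zero in the factor algebra.\<close>
  let ?\<beta> = "pair_tuple i j (axis i 1) (axis j 1 + axis j 1)"
  let ?x = "\<lambda>k. xpow (?\<beta> k) :: ('k, 'n) laurent"
  have x: "?x k \<in> bar" for k
  proof -
    have "(axis j 1 + axis j 1 :: (int, 'n) vec) $ j \<noteq> (- theta) $ j" by (simp add: theta_def)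
    then have "axis j 1 + axis j 1 \<noteq> (- theta :: (int, 'n) vec)" by metis
    then show ?thesis using axis_neq by (auto simp: xpow_bar pair_tuple_def)
  qed
  have "J ?x = Poly_Mapping.single (axis j 1) 2"
  proof -
    have "sum ?\<beta> UNIV - theta = axis j 1" unfolding sum_pair_tuple[OF j] pair_rest_def by simp
    moreover have "idet ?\<beta> = (2 :: 'k)" unfolding idet_pair_tuple[OF j] using j by (simp add: bracket_def axis_def)
    ultimately show ?thesis unfolding Jac_xpow by simp
  qed
  then have "coef (J ?x) (axis j 1) \<noteq> coef 0 (axis j 1)" by simp
  then have "OQ (\<lambda>k. cls (?x k)) \<noteq> \<zero>\<^bsub>Q\<^esub>"
    unfolding op_cls[OF x] cls_zero using cls_eq_iff[OF bar_closed(5) bar_closed(4)] axis_neq(1) by blast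
  moreover have "(\<lambda>k. cls (?x k)) \<in> UNIV \<rightarrow> carrier Q" using cls_in[OF x] by auto
  ultimately show ?thesis unfolding n_simple_def using ideal_full by blast
qed


section \<open>Explicit formulas, dimensions and assembly of the statements\<close>

lemma Delta_xpow:
  "Delta (xpow \<alpha> :: ('k, 'n) laurent) =
    lscale (of_int (\<Sum>i\<in>UNIV. \<alpha> $ i) + of_nat CARD('n) * inverse (1 - of_nat CARD('n))) (xpow \<alpha>)"
  unfolding Delta_hmap hmap_xpow single_eq_lscale by (simp add: pairing_def Delta_const_def)

lemma D_mtheta_xpow: "D_mtheta (xpow \<alpha> :: ('k, 'n) laurent) = lscale (if \<alpha> = - theta then 1 else 0) 1"
  by (simp add: D_mtheta_def lookup_xpow)

lemma D_ind_outer: "D_ind i \<in> carrier (Der_comm U J)" "D_ind i \<notin> Inn U J"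
proof -
  show "D_ind i \<in> carrier (Der_comm U J)" using D_ind_derivation by (simp add: Der_comm_def)
  show "D_ind i \<notin> Inn U J"
    using Inn_functionals(3)[of "D_ind i" i] D_ind_functionals(3)[of i i] by auto
qed

lemma dimensions:
  "has_dim (Out_comm U J) CARD('n)" "has_dim (Out U J) (CARD('n) + 2)"
  "has_dim (quot (Out U J) QC.image_TS) 2" "has_dim (quot (Der Q OQ) I) (CARD('n) + 1)"
proof -
  have V: "vspace V" if "fin_basis V X b" for V :: "('k, 'v) module" and X :: "'x set" and b
    using that by (auto simp only: fin_basis_def intro: vspace.intro)
  show "has_dim (Out_comm U J) CARD('n)"
    by (rule vspace.fin_basis_has_dim[OF V[OF Out_comm_basis] Out_comm_basis]) simp
  show "has_dim (Out U J) (CARD('n) + 2)"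
    by (rule vspace.fin_basis_has_dim[OF V[OF Out_basis] Out_basis]) simp
  show "has_dim (quot (Out U J) QC.image_TS) 2"
    by (rule vspace.fin_basis_has_dim[OF V[OF Out_Out_comm_basis] Out_Out_comm_basis]) simp
  show "has_dim (quot (Der Q OQ) I) (CARD('n) + 1)"
    by (rule vspace.fin_basis_has_dim[OF V[OF Der_Q_basis] Der_Q_basis]) simp
qed

lemma Out_span:
  "lin_span (quot (Out U J) QC.image_TS)
    {QC.image_TS +>\<^bsub>Out U J\<^esub> (Inn U J +>\<^bsub>Der U J\<^esub> Delta),
     QC.image_TS +>\<^bsub>Out U J\<^esub> (Inn U J +>\<^bsub>Der U J\<^esub> D_mtheta)} =
    carrier (quot (Out U J) QC.image_TS)"
proof -
  let ?b = "\<lambda>b. QC.image_TS +>\<^bsub>Out U J\<^esub> (Inn U J +>\<^bsub>Der U J\<^esub> (if b then Delta else D_mtheta))"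
  have "?b ` UNIV = {QC.image_TS +>\<^bsub>Out U J\<^esub> (Inn U J +>\<^bsub>Der U J\<^esub> Delta),
     QC.image_TS +>\<^bsub>Out U J\<^esub> (Inn U J +>\<^bsub>Der U J\<^esub> D_mtheta)}"
    by (auto simp: UNIV_bool)
  moreover have "lin_span (quot (Out U J) QC.image_TS) (?b ` UNIV) = carrier (quot (Out U J) QC.image_TS)"
    using Out_Out_comm_basis unfolding fin_basis_def by blast
  ultimately show ?thesis by (simp only:)
qed

lemma outer_Q_induced: "induced (outer_Q j) \<in> carrier (Der Q OQ)"
  using induced_derivation[OF outer_Q] by (simp add: Der_Q_simps(1))

lemma Out_Q:
  assumes "CARD('n) > 2"
  shows "fin_basis (Out Q OQ) UNIV (\<lambda>j. Inn Q OQ +>\<^bsub>Der Q OQ\<^esub> induced (outer_Q j))"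
    "has_dim (Out Q OQ) (CARD('n) + 1)"
  unfolding Out_def Inn_Q_eq[OF assms] by (rule Der_Q_basis dimensions(4))+

end

theorem theorem8p1:
  fixes U :: "('k::field_char_0, ('k, 'n::{finite,linorder}) laurent) module"
    and \<omega> :: "('n \<Rightarrow> ('k, 'n) laurent) \<Rightarrow> ('k, 'n) laurent"
    and Ubar :: "('k, ('k, 'n) laurent) module"
    and C :: "('k, 'n) laurent set"
    and Q :: "('k, ('k, 'n) laurent set) module"
    and \<omega>Q :: "('n \<Rightarrow> ('k, 'n) laurent set) \<Rightarrow> ('k, 'n) laurent set"
    and induced :: "(('k, 'n) laurent \<Rightarrow> ('k, 'n) laurent) \<Rightarrow> ('k, 'n) laurent set \<Rightarrow> ('k, 'n) laurent set"
    and I :: "(('k, 'n) laurent set \<Rightarrow> ('k, 'n) laurent set) set"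
    and N :: "(('k, 'n) laurent \<Rightarrow> ('k, 'n) laurent) set set"
  assumes n: "CARD('n) > 1"
    and U: "U = laurent_space"
    and \<omega>: "\<omega> = Jac"
    and Ubar: "Ubar = U\<lparr>carrier := laurent_bar\<rparr>"
    and C: "C = lin_span U {1}"
    and Q: "Q = quot Ubar C"
    and \<omega>Q: "\<omega>Q = quot_op Ubar C \<omega>"
    and induced: "induced = quot_map Ubar C Ubar C"
    and I: "I = induced ` Inn U \<omega>"
    and N: "N = Out_incl U \<omega> ` carrier (Out_comm U \<omega>)"
  shows
    \<comment> \<open>(i)\<close>
    "(n_lie_algebra U \<omega> \<and> \<not> n_simple U \<omega> \<and>
      center U \<omega> = C \<and> has_dim (U\<lparr>carrier := C\<rparr>) 1 \<and>
      n_ideal U \<omega> laurent_bar \<and> has_dim (quot U laurent_bar) 1 \<and>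
      n_lie_algebra Q \<omega>Q \<and> n_simple Q \<omega>Q)
     \<and>
     \<comment> \<open>(ii)\<close>
     ((\<exists>g. short_exact (Out_comm U \<omega>) (Out U \<omega>) (coord_space :: ('k, 'k ^ 2) module)
             (Out_incl U \<omega>) g) \<and>
      lie_ideal (Out U \<omega>) N \<and>
      (\<forall>\<alpha>. Delta (xpow \<alpha> :: ('k, 'n) laurent) =
             lscale (of_int (\<Sum>i\<in>UNIV. \<alpha> $ i) + of_nat CARD('n) * inverse (1 - of_nat CARD('n))) (xpow \<alpha>)) \<and>
      (\<forall>\<alpha>. D_mtheta (xpow \<alpha> :: ('k, 'n) laurent) = lscale (if \<alpha> = - theta then 1 else 0) 1) \<and>
      Delta \<in> carrier (Der U \<omega>) \<and> D_mtheta \<in> carrier (Der U \<omega>) \<and>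
      has_dim (quot (Out U \<omega>) N) 2 \<and>
      lin_span (quot (Out U \<omega>) N)
        {N +>\<^bsub>Out U \<omega>\<^esub> (Inn U \<omega> +>\<^bsub>Der U \<omega>\<^esub> Delta),
         N +>\<^bsub>Out U \<omega>\<^esub> (Inn U \<omega> +>\<^bsub>Der U \<omega>\<^esub> D_mtheta)}
        = carrier (quot (Out U \<omega>) N))
     \<and>
     \<comment> \<open>(iii)\<close>
     ((\<forall>i. D_ind i \<in> carrier (Der_comm U \<omega>) \<and> D_ind i \<notin> Inn U \<omega>) \<and>
      fin_basis (Out_comm U \<omega>) UNIV (\<lambda>i::'n. Inn U \<omega> +>\<^bsub>Der_comm U \<omega>\<^esub> D_ind i) \<and>
      has_dim (Out_comm U \<omega>) CARD('n) \<and>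
      has_dim (Out U \<omega>) (CARD('n) + 2))
     \<and>
     \<comment> \<open>(iv).  For \<open>n = 2\<close> the derivation of \<open>Q\<close> induced by \<open>L\<close> with parameter \<open>x\<^sup>-\<^sup>\<theta>\<close> is not
        in \<open>Inn Q \<omega>Q\<close>, and \<open>Out Q \<omega>Q\<close> has dimension \<open>n + 2\<close>.  The claim holds for all
        \<open>n > 1\<close> with the interior derivations induced from \<open>U\<close>, and for \<open>n > 2\<close> also with
        those of \<open>Q\<close> itself.\<close>
     (induced Delta \<in> carrier (Der Q \<omega>Q) \<and> (\<forall>i. induced (D_ind i) \<in> carrier (Der Q \<omega>Q)) \<and>
      fin_basis (quot (Der Q \<omega>Q) I) UNIV
        (\<lambda>j :: 'n option. I +>\<^bsub>Der Q \<omega>Q\<^esub>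
           induced (case j of None \<Rightarrow> Delta | Some i \<Rightarrow> D_ind i)) \<and>
      has_dim (quot (Der Q \<omega>Q) I) (CARD('n) + 1) \<and>
      (CARD('n) > 2 \<longrightarrow>
        fin_basis (Out Q \<omega>Q) UNIV
          (\<lambda>j :: 'n option. Inn Q \<omega>Q +>\<^bsub>Der Q \<omega>Q\<^esub>
             induced (case j of None \<Rightarrow> Delta | Some i \<Rightarrow> D_ind i)) \<and>
        has_dim (Out Q \<omega>Q) (CARD('n) + 1)))"
proof -
  interpret jac: jacobian "TYPE('k \<times> 'n)" by unfold_locales (rule n)
  note eqs = U \<omega> Ubar C Q \<omega>Q induced I
  have N': "N = jac.QC.image_TS" unfolding N U \<omega> by (rule jac.N_eq)
  have ind: "induced Delta \<in> carrier (Der Q \<omega>Q)" "induced (D_ind i) \<in> carrier (Der Q \<omega>Q)" for i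
    using jac.outer_Q_induced[of None] jac.outer_Q_induced[of "Some i"]
    unfolding eqs by (simp_all add: jac.outer_Q_def)
  have basis: "fin_basis (quot (Der Q \<omega>Q) I) UNIV
        (\<lambda>j :: 'n option. I +>\<^bsub>Der Q \<omega>Q\<^esub> induced (case j of None \<Rightarrow> Delta | Some i \<Rightarrow> D_ind i))"
    using jac.Der_Q_basis unfolding eqs jac.outer_Q_def .
  have Out_basis: "fin_basis (Out Q \<omega>Q) UNIV
        (\<lambda>j :: 'n option. Inn Q \<omega>Q +>\<^bsub>Der Q \<omega>Q\<^esub> induced (case j of None \<Rightarrow> Delta | Some i \<Rightarrow> D_ind i))"
    "has_dim (Out Q \<omega>Q) (CARD('n) + 1)" if "CARD('n) > 2"
    using jac.Out_Q[OF that] unfolding eqs jac.outer_Q_def .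
  have i: "n_lie_algebra U \<omega>" "\<not> n_simple U \<omega>" "center U \<omega> = C" "has_dim (U\<lparr>carrier := C\<rparr>) 1"
    "n_ideal U \<omega> laurent_bar" "has_dim (quot U laurent_bar) 1" "n_lie_algebra Q \<omega>Q" "n_simple Q \<omega>Q"
    unfolding eqs
    by (rule jac.nlie_laurent jac.laurent_not_simple jac.center_laurent jac.constants_dim
        jac.laurent_bar_ideal jac.laurent_bar_codim jac.nlie_Q jac.simple_Q)+
  have ii: "\<exists>g. short_exact (Out_comm U \<omega>) (Out U \<omega>) (coord_space :: ('k, 'k ^ 2) module) (Out_incl U \<omega>) g"
    "lie_ideal (Out U \<omega>) N" "has_dim (quot (Out U \<omega>) N) 2"
    "lin_span (quot (Out U \<omega>) N)
        {N +>\<^bsub>Out U \<omega>\<^esub> (Inn U \<omega> +>\<^bsub>Der U \<omega>\<^esub> Delta), N +>\<^bsub>Out U \<omega>\<^esub> (Inn U \<omega> +>\<^bsub>Der U \<omega>\<^esub> D_mtheta)}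
      = carrier (quot (Out U \<omega>) N)"
    unfolding N' unfolding U \<omega>
    by (rule jac.short_exact_Out jac.lie_ideal_Out jac.dimensions jac.Out_span)+
  have der: "Delta \<in> carrier (Der U \<omega>)" "D_mtheta \<in> carrier (Der U \<omega>)"
    using jac.Delta_derivation jac.D_mtheta_derivation by (simp_all add: U \<omega> Der_def)
  have iii: "D_ind i \<in> carrier (Der_comm U \<omega>)" "D_ind i \<notin> Inn U \<omega>"
    "fin_basis (Out_comm U \<omega>) UNIV (\<lambda>i::'n. Inn U \<omega> +>\<^bsub>Der_comm U \<omega>\<^esub> D_ind i)"
    "has_dim (Out_comm U \<omega>) CARD('n)" "has_dim (Out U \<omega>) (CARD('n) + 2)" for i
    unfolding U \<omega> by (rule jac.D_ind_outer jac.Out_comm_basis jac.dimensions)+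
  have iv: "has_dim (quot (Der Q \<omega>Q) I) (CARD('n) + 1)"
    unfolding eqs by (rule jac.dimensions)
  show ?thesis
    by (intro conjI allI impI i ii jac.Delta_xpow jac.D_mtheta_xpow der iii ind basis iv Out_basis)
qed

end
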